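(* Let $V$ be a simple Euclidean Jordan algebra with symmetric cone $\Omega$, let $\sigma$ be an involutive Jordan automorphism of $V$, and let $d_\sigma$ and $\Lambda_n^\sigma$ be as defined in the context. Then the mean $\Lambda_n^\sigma$ is the Karcher mean in the Hadamard space $(\Omega,d_\sigma)$; namely, for all $x_1,\dots,x_n\in\Omega$, $$\Lambda_n^\sigma(x_1,\dots,x_n)=\operatorname*{arg\,min}_{x\in\Omega}\ \frac1n\sum_{i=1}^n d_\sigma(x,x_i)^2 ,$$ i.e. $\Lambda_n^\sigma(x_1,\dots,x_n)$ is the unique minimizer.
   Context: A Euclidean Jordan algebra is a finite-dimensional real inner product space $V$ with a bilinear product $(x,y)\mapsto xy$ satisfying $xy=yx$, $x(x^2y)=x^2(xy)$, $\langle xy,z\rangle=\langle y,xz\rangle$, and having a unit element $e$; it is simple if it has no nontrivial ideals. Its symmetric cone is $\Omega=\operatorname{int}\{x^2:x\in V\}$. For $x\in V$, $L(x)y=xy$ and $P(x)=2L(x)^2-L(x^2)$ (quadratic representation). Every $x\in V$ has a spectral decomposition $x=\sum_{j=1}^r\lambda_jc_j$, with $(c_1,\dots,c_r)$ a Jordan frame (pairwise orthogonal primitive idempotents with sum $e$) and $\lambda_j\in\mathbb R$ the spectral values; for $x\in\Omega$ all $\lambda_j>0$ and $x^\alpha=\sum_j\lambda_j^\alpha c_j$ for $\alpha\in\mathbb R$ (so $x^{-1}$ is the Jordan inverse). The cone carries the distance $d(a,b)=\bigl(\sum_{i=1}^r\log^2\lambda_i\bigr)^{1/2}$, where $\lambda_1,\dots,\lambda_r$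 are the spectral values of $P(a^{-1/2})b$. For $a,b\in\Omega$, $a\mathbin{\#}b=P(a^{1/2})\bigl(P(a^{-1/2})b\bigr)^{1/2}$ (metric geometric mean) and $a\mathbin{\natural}b=P\bigl((a^{-1}\mathbin{\#}b)^{1/2}\bigr)a$ (spectral geometric mean). An involutive Jordan automorphism is a linear bijection $\sigma:V\to V$ with $\sigma(xy)=\sigma(x)\sigma(y)$ and $\sigma^2=\operatorname{id}$. Set $\Omega_\sigma^+=\{a\in\Omega:\sigma(a)=a\}$, $\Omega_\sigma^-=\{b\in\Omega:\sigma(b)=b^{-1}\}$, and let $d^\pm$ be the restriction of $d$ to $\Omega_\sigma^\pm$; with these distances $\Omega_\sigma^\pm$ are Hadamard spaces (complete CAT(0) spaces). The map $f_\sigma:\Omega_\sigma^+\times\Omega_\sigma^-\to\Omega$, $f_\sigma(a,b)=P(a^{1/2})b$, is a bijection with inverse $x\mapsto(x\mathbin{\#}\sigma(x),\,x\mathbin{\natural}\sigma(x^{-1}))$. For $x=f_\sigma(a_1,b_1)$, $y=f_\sigma(a_2,b_2)$ define $d_\sigma(x,y)=\bigl(d^+(a_1,a_2)^2+d^-(b_1,b_2)^2\bigr)^{1/2}$. For $a_1,\dots,a_n\in\Omega_\sigma^+$ and $b_1,\dots,b_n\in\Omega_\sigma^-$ let $$\Lambda_n^+(a_1,\dots,a_n)=\operatorname*{arg\,min}_{a\in\Omega_\sigma^+}\frac1n\sum_{i=1}^nd^+(a,a_i)^2,\qquad \Lambda_n^-(b_1,\dots,b_n)=\operatorname*{arg\,min}_{b\in\Omega_\sigma^-}\frac1n\sum_{i=1}^nd^-(b,b_i)^2$$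 (the minimizers exist and are unique because $\Omega_\sigma^\pm$ are Hadamard). For $x_i=f_\sigma(a_i,b_i)\in\Omega$, $i=1,\dots,n$, define $$\Lambda_n^\sigma(x_1,\dots,x_n)=f_\sigma\bigl(\Lambda_n^+(a_1,\dots,a_n),\ \Lambda_n^-(b_1,\dots,b_n)\bigr).$$ *)

theory Defs
  imports "HOL-Analysis.Analysis" "HOL-Library.Multiset"
begin

section \<open>Euclidean Jordan algebras\<close>

class euclidean_jordan_algebra = euclidean_space +
  fixes jordan_times :: "'a \<Rightarrow> 'a \<Rightarrow> 'a"  (infixl "\<odot>" 70)
    and jordan_unit :: 'a
  assumes jordan_add_left: "(x + y) \<odot> z = x \<odot> z + y \<odot> z"
    and jordan_scaleR_left: "(t *\<^sub>R x) \<odot> y = t *\<^sub>R (x \<odot> y)"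
    and jordan_add_right: "x \<odot> (y + z) = x \<odot> y + x \<odot> z"
    and jordan_scaleR_right: "x \<odot> (t *\<^sub>R y) = t *\<^sub>R (x \<odot> y)"
    and jordan_commute: "x \<odot> y = y \<odot> x"
    and jordan_identity: "x \<odot> ((x \<odot> x) \<odot> y) = (x \<odot> x) \<odot> (x \<odot> y)"
    and jordan_inner: "(x \<odot> y) \<bullet> z = y \<bullet> (x \<odot> z)"
    and jordan_unit: "jordan_unit \<odot> x = x"

definition (in euclidean_jordan_algebra) jordan_ideal :: "'a set \<Rightarrow> bool" where
  "jordan_ideal I \<longleftrightarrow>
     0 \<in> I \<and> (\<forall>x\<in>I. \<forall>y\<in>I. x + y \<in> I) \<and> (\<forall>t. \<forall>x\<in>I. t *\<^sub>R x \<in> I) \<and>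
     (\<forall>x. \<forall>y\<in>I. x \<odot> y \<in> I)"

text \<open>The zero algebra is already excluded, since a type of class \<open>euclidean_space\<close> has
  dimension at least 1.\<close>

class simple_euclidean_jordan_algebra = euclidean_jordan_algebra +
  assumes simple: "jordan_ideal I \<Longrightarrow> I = {0} \<or> I = UNIV"

definition symmetric_cone :: "'a::euclidean_jordan_algebra set" where
  "symmetric_cone = interior {x \<odot> x | x. True}"

definition jordan_L :: "'a::euclidean_jordan_algebra \<Rightarrow> 'a \<Rightarrow> 'a" where
  "jordan_L x y = x \<odot> y"

definition jordan_P :: "'a::euclidean_jordan_algebra \<Rightarrow> 'a \<Rightarrow> 'a" where
  "jordan_P x y = 2 *\<^sub>R jordan_L x (jordan_L x y) - jordan_L (x \<odot> x) y"


section \<open>Spectral decomposition and powers\<close>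

definition jordan_idempotent :: "'a::euclidean_jordan_algebra \<Rightarrow> bool" where
  "jordan_idempotent c \<longleftrightarrow> c \<odot> c = c"

definition primitive_idempotent :: "'a::euclidean_jordan_algebra \<Rightarrow> bool" where
  "primitive_idempotent c \<longleftrightarrow> jordan_idempotent c \<and> c \<noteq> 0 \<and>
     \<not> (\<exists>p q. jordan_idempotent p \<and> jordan_idempotent q \<and> p \<noteq> 0 \<and> q \<noteq> 0 \<and> c = p + q)"

definition jordan_frame :: "nat \<Rightarrow> (nat \<Rightarrow> 'a::euclidean_jordan_algebra) \<Rightarrow> bool" where
  "jordan_frame r c \<longleftrightarrow>
     (\<forall>i\<in>{1..r}. primitive_idempotent (c i)) \<and>
     (\<forall>i\<in>{1..r}. \<forall>j\<in>{1..r}. i \<noteq> j \<longrightarrow> c i \<odot> c j = 0) \<and>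
     (\<Sum>i=1..r. c i) = jordan_unit"

definition spectral_decomposition ::
  "'a::euclidean_jordan_algebra \<Rightarrow> nat \<Rightarrow> (nat \<Rightarrow> real) \<Rightarrow> (nat \<Rightarrow> 'a) \<Rightarrow> bool" where
  "spectral_decomposition x r l c \<longleftrightarrow> jordan_frame r c \<and> x = (\<Sum>j=1..r. l j *\<^sub>R c j)"

text \<open>The spectral values with multiplicity, and the powers, do not depend on the chosen
  spectral decomposition; this is what the definite descriptions below rely on.\<close>

definition spectral_values :: "'a::euclidean_jordan_algebra \<Rightarrow> real multiset" where
  "spectral_values x =
     (THE M. \<exists>r l c. spectral_decomposition x r l c \<and> M = image_mset l (mset_set {1..r}))"

text \<open>Meant for elements of the symmetric cone, whose spectral values are positive.\<close>

definition jordan_powr :: "'a::euclidean_jordan_algebra \<Rightarrow> real \<Rightarrow> 'a" where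
  "jordan_powr x \<alpha> =
     (THE y. \<exists>r l c. spectral_decomposition x r l c \<and> y = (\<Sum>j=1..r. (l j powr \<alpha>) *\<^sub>R c j))"

definition cone_dist :: "'a::euclidean_jordan_algebra \<Rightarrow> 'a \<Rightarrow> real" where
  "cone_dist a b =
     sqrt (\<Sum>t\<in>#spectral_values (jordan_P (jordan_powr a (- (1/2))) b). (ln t)\<^sup>2)"


section \<open>The decomposition of the cone induced by an involutive automorphism\<close>

definition involutive_jordan_automorphism ::
  "('a::euclidean_jordan_algebra \<Rightarrow> 'a) \<Rightarrow> bool" where
  "involutive_jordan_automorphism \<sigma> \<longleftrightarrow>
     linear \<sigma> \<and> bij \<sigma> \<and> (\<forall>x y. \<sigma> (x \<odot> y) = \<sigma> x \<odot> \<sigma> y) \<and> \<sigma> \<circ> \<sigma> = id"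

definition cone_plus :: "('a::euclidean_jordan_algebra \<Rightarrow> 'a) \<Rightarrow> 'a set" where
  "cone_plus \<sigma> = {a \<in> symmetric_cone. \<sigma> a = a}"

definition cone_minus :: "('a::euclidean_jordan_algebra \<Rightarrow> 'a) \<Rightarrow> 'a set" where
  "cone_minus \<sigma> = {b \<in> symmetric_cone. \<sigma> b = jordan_powr b (-1)}"

text \<open>The map \<open>f\<^sub>\<sigma>\<close> has the same formula for every \<open>\<sigma>\<close>; only its domain
  \<open>cone_plus \<sigma> \<times> cone_minus \<sigma>\<close> depends on \<open>\<sigma>\<close>.\<close>

definition cone_map :: "'a::euclidean_jordan_algebra \<times> 'a \<Rightarrow> 'a" where
  "cone_map = (\<lambda>(a, b). jordan_P (jordan_powr a (1/2)) b)"

definition plus_part :: "('a::euclidean_jordan_algebra \<Rightarrow> 'a) \<Rightarrow> 'a \<Rightarrow> 'a" where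
  "plus_part \<sigma> x = fst (the_inv_into (cone_plus \<sigma> \<times> cone_minus \<sigma>) cone_map x)"

definition minus_part :: "('a::euclidean_jordan_algebra \<Rightarrow> 'a) \<Rightarrow> 'a \<Rightarrow> 'a" where
  "minus_part \<sigma> x = snd (the_inv_into (cone_plus \<sigma> \<times> cone_minus \<sigma>) cone_map x)"

definition sigma_dist :: "('a::euclidean_jordan_algebra \<Rightarrow> 'a) \<Rightarrow> 'a \<Rightarrow> 'a \<Rightarrow> real" where
  "sigma_dist \<sigma> x y =
     sqrt ((cone_dist (plus_part \<sigma> x) (plus_part \<sigma> y))\<^sup>2
         + (cone_dist (minus_part \<sigma> x) (minus_part \<sigma> y))\<^sup>2)"


section \<open>Karcher means\<close>

definition mean_sq_dist :: "('a \<Rightarrow> 'a \<Rightarrow> real) \<Rightarrow> nat \<Rightarrow> (nat \<Rightarrow> 'a) \<Rightarrow> 'a \<Rightarrow> real" where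
  "mean_sq_dist d n p z = (1 / real n) * (\<Sum>i=1..n. (d z (p i))\<^sup>2)"

definition mean_plus ::
  "('a::euclidean_jordan_algebra \<Rightarrow> 'a) \<Rightarrow> nat \<Rightarrow> (nat \<Rightarrow> 'a) \<Rightarrow> 'a" where
  "mean_plus \<sigma> n a = arg_min (mean_sq_dist cone_dist n a) (\<lambda>z. z \<in> cone_plus \<sigma>)"

definition mean_minus ::
  "('a::euclidean_jordan_algebra \<Rightarrow> 'a) \<Rightarrow> nat \<Rightarrow> (nat \<Rightarrow> 'a) \<Rightarrow> 'a" where
  "mean_minus \<sigma> n b = arg_min (mean_sq_dist cone_dist n b) (\<lambda>z. z \<in> cone_minus \<sigma>)"

definition sigma_mean ::
  "('a::euclidean_jordan_algebra \<Rightarrow> 'a) \<Rightarrow> nat \<Rightarrow> (nat \<Rightarrow> 'a) \<Rightarrow> 'a" where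
  "sigma_mean \<sigma> n x =
     cone_map (mean_plus \<sigma> n (\<lambda>i. plus_part \<sigma> (x i)),
               mean_minus \<sigma> n (\<lambda>i. minus_part \<sigma> (x i)))"

end

theory Submission
  imports Defs
begin

text \<open>
  Since \<open>f\<^sub>\<sigma>\<close> is a bijection of \<open>\<Omega>\<^sub>\<sigma>\<^sup>+ \<times> \<Omega>\<^sub>\<sigma>\<^sup>-\<close> onto \<open>\<Omega>\<close>, the function to be minimised over \<open>\<Omega>\<close> is at \<open>f\<^sub>\<sigma>(a, b)\<close>
  the sum of a function of \<open>a\<close> and a function of \<open>b\<close>, namely the two mean squared distances on the
  factors. It is minimal exactly where both summands are. So the theorem follows from two facts: the
  map \<open>f\<^sub>\<sigma>\<close> is a bijection, and on each factor the mean squared distance has exactly one minimiser.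

  Both facts rest on the fundamental formula \<open>P(P(g) x) = P(g) P(x) P(g)\<close>. For \<open>g\<close> in the cone it is
  obtained by integrating its infinitesimal version, which is linear in \<open>u\<close>,
  \<open>2 P(x, u x) = L(u) P(x) + P(x) L(u)\<close> (\<open>jordan_P2_L\<close>), along the curve \<open>g\<^sup>t\<close>: a linear differential
  equation has only one solution (\<open>jordan_fundamental_formula\<close>). Two consequences are that \<open>P(g)\<close> maps the
  cone into itself and is an isometry (\<open>jordan_P_cone\<close>, \<open>log_dist_P\<close>), and that the Riccati equation
  \<open>P(m) p = q\<close> has a unique solution in the cone. For \<open>x = f\<^sub>\<sigma>(a, b)\<close> the element \<open>a\<close> solves
  \<open>P(a) x\<^sup>-\<^sup>1 = \<sigma>(x)\<close>, and uniqueness of the solution yields the bijection (\<open>cone_map_bij\<close>).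

  For the minimisers the key is that the exponential map does not decrease distances:
  \<open>|log b - log a|\<close> is at most the distance of \<open>a\<close> and \<open>b\<close> (\<open>exponential_metric_increasing\<close>). The
  derivative of the square root at \<open>y\<^sup>2\<close> is the inverse of \<open>2 L(y)\<close>, and the operator inequality
  \<open>P(c) \<le> L(c\<^sup>2)\<close> for \<open>c\<^sup>2 = y\<close>, which is the inequality of the arithmetic and geometric means of two spectral
  values, says that taking square roots at least halves the Riemannian length of curves. Iterating it shrinks the geodesic
  from \<open>a\<close> to \<open>b\<close> to a short curve near the unit, where Riemannian and Euclidean lengths agree in the limit, and
  \<open>2\<^sup>n\<close> times the difference of the \<open>2\<^sup>n\<close>-th roots tends to the difference of the logarithms. If the midpoint of \<open>a\<close> and \<open>b\<close>
  is moved to the unit, then \<open>a = exp v\<close> and \<open>b = exp (-v)\<close>, and the parallelogram law for logarithms becomes the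
  semiparallelogram law of the cone (\<open>semiparallelogram_law\<close>). Existence of minimisers
  follows by compactness and uniqueness from this law, in every relatively closed subset of the
  cone that is closed under midpoints (\<open>barycenter_exists_unique\<close>); both factors are such subsets.

  Simplicity of the algebra enters through the multiplicities: all primitive idempotents then have the same
  squared norm \<open>\<kappa>\<close>, so multiplicities can be read off from norms, and the squared distance of \<open>a\<close>
  and \<open>b\<close> is \<open>|log (P(a\<^sup>-\<^sup>1\<^sup>/\<^sup>2) b)|\<^sup>2 / \<kappa>\<close> in terms of the given norm.
\<close>

section \<open>Consequences of the Jordan identity\<close>

lemma bounded_bilinear_jordan_times:
  "bounded_bilinear (jordan_times :: 'a::euclidean_jordan_algebra \<Rightarrow> 'a \<Rightarrow> 'a)"
  unfolding bilinear_conv_bounded_bilinear[symmetric] bilinear_def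
  by (auto intro!: linearI
      simp: jordan_add_left jordan_add_right jordan_scaleR_left jordan_scaleR_right)

interpretation jt: bounded_bilinear "jordan_times :: 'a::euclidean_jordan_algebra \<Rightarrow> 'a \<Rightarrow> 'a"
  by (rule bounded_bilinear_jordan_times)

lemma jordan_unit_right: "x \<odot> jordan_unit = (x::'a::euclidean_jordan_algebra)"
  by (metis jordan_commute jordan_unit)

lemmas jt_simps = jordan_add_left jordan_add_right jordan_scaleR_left jordan_scaleR_right
  jt.diff_left jt.diff_right jt.minus_left jt.minus_right

text \<open>The part of the Jordan identity that is quadratic in \<open>x\<close> and linear in \<open>z\<close>.\<close>

lemma jordan_linearized_once:
  fixes x y z :: "'a::euclidean_jordan_algebra"
  shows "z \<odot> ((x \<odot> x) \<odot> y) + 2 *\<^sub>R (x \<odot> ((x \<odot> z) \<odot> y)) =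
         (x \<odot> x) \<odot> (z \<odot> y) + 2 *\<^sub>R ((x \<odot> z) \<odot> (x \<odot> y))"
proof -
  define J where "J w = w \<odot> ((w \<odot> w) \<odot> y) - (w \<odot> w) \<odot> (w \<odot> y)" for w
  have J0: "J w = 0" for w unfolding J_def by (simp add: jordan_identity)
  \<comment> \<open>The odd part of a cubic polynomial in \<open>z\<close> consists of its linear and its cubic term.\<close>
  have "J (x + z) - J (x - z) - 2 *\<^sub>R J z =
    2 *\<^sub>R ((z \<odot> ((x \<odot> x) \<odot> y) + 2 *\<^sub>R (x \<odot> ((x \<odot> z) \<odot> y))) -
         ((x \<odot> x) \<odot> (z \<odot> y) + 2 *\<^sub>R ((x \<odot> z) \<odot> (x \<odot> y))))"
    unfolding J_def using jordan_commute[of z x]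
    by (simp add: jt_simps algebra_simps scaleR_2)
  then show ?thesis by (simp add: J0)
qed

lemma jordan_linearized:
  fixes x w y z :: "'a::euclidean_jordan_algebra"
  shows "x \<odot> ((w \<odot> z) \<odot> y) + w \<odot> ((x \<odot> z) \<odot> y) + z \<odot> ((x \<odot> w) \<odot> y) =
         (x \<odot> z) \<odot> (w \<odot> y) + (w \<odot> z) \<odot> (x \<odot> y) + (x \<odot> w) \<odot> (z \<odot> y)"
proof -
  define A where "A x = (z \<odot> ((x \<odot> x) \<odot> y) + 2 *\<^sub>R (x \<odot> ((x \<odot> z) \<odot> y))) -
         ((x \<odot> x) \<odot> (z \<odot> y) + 2 *\<^sub>R ((x \<odot> z) \<odot> (x \<odot> y)))" for x
  have A0: "A x = 0" for x unfolding A_def using jordan_linearized_once[of z x y] by simp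
  have "A (x + w) - A x - A w = 2 *\<^sub>R ((x \<odot> ((w \<odot> z) \<odot> y) + w \<odot> ((x \<odot> z) \<odot> y) + z \<odot> ((x \<odot> w) \<odot> y)) -
         ((x \<odot> z) \<odot> (w \<odot> y) + (w \<odot> z) \<odot> (x \<odot> y) + (x \<odot> w) \<odot> (z \<odot> y)))"
    unfolding A_def using jordan_commute[of w x]
    by (simp add: jt_simps algebra_simps scaleR_2)
  then show ?thesis by (simp add: A0)
qed

text \<open>As an identity of operators applied to \<open>z\<close>, the linearised identity expresses the multiplication by
  a product of three factors through multiplications by products of at most two factors.\<close>

lemma jordan_L_product:
  fixes x u h z :: "'a::euclidean_jordan_algebra"
  shows "((x \<odot> u) \<odot> h) \<odot> z = (x \<odot> u) \<odot> (h \<odot> z) + (x \<odot> h) \<odot> (u \<odot> z) + (u \<odot> h) \<odot> (x \<odot> z)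
         - x \<odot> (h \<odot> (u \<odot> z)) - u \<odot> (h \<odot> (x \<odot> z))"
  using jordan_linearized[of x u z h]
  by (simp add: algebra_simps jordan_commute)

text \<open>This makes the multiplications by the members of a Jordan frame commute, which replaces the Peirce
  decomposition in what follows.\<close>

lemma jordan_L_commute_orthogonal:
  fixes c d y :: "'a::euclidean_jordan_algebra"
  assumes "c \<odot> c = c" "c \<odot> d = 0"
  shows "d \<odot> (c \<odot> y) = c \<odot> (d \<odot> y)"
  using jordan_linearized_once[of d c y] assms by (simp add: jt.zero_left jt.zero_right)

text \<open>The polarisation of the quadratic representation, \<open>P(x) = P(x, x)\<close>.\<close>

definition jordan_P2 :: "'a::euclidean_jordan_algebra \<Rightarrow> 'a \<Rightarrow> 'a \<Rightarrow> 'a" where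
  "jordan_P2 x z y = x \<odot> (z \<odot> y) + z \<odot> (x \<odot> y) - (x \<odot> z) \<odot> y"

lemma jordan_P_eq: "jordan_P x y = 2 *\<^sub>R (x \<odot> (x \<odot> y)) - (x \<odot> x) \<odot> y"
  by (simp add: jordan_P_def jordan_L_def)

text \<open>The derivative at \<open>t = 0\<close> of \<open>P(h\<^sub>t x) = h\<^sub>t P(x) h\<^sub>t\<^sup>*\<close> for \<open>h\<^sub>t = exp (t L(u))\<close>: multiplications belong to the Lie
  algebra of the structure group.\<close>

lemma jordan_P2_L:
  fixes x u y :: "'a::euclidean_jordan_algebra"
  shows "2 *\<^sub>R jordan_P2 x (u \<odot> x) y = u \<odot> jordan_P x y + jordan_P x (u \<odot> y)"
proof -
  have 1: "((x \<odot> u) \<odot> x) \<odot> y = 2 *\<^sub>R ((u \<odot> x) \<odot> (x \<odot> y)) + (x \<odot> x) \<odot> (u \<odot> y)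
         - x \<odot> (x \<odot> (u \<odot> y)) - u \<odot> (x \<odot> (x \<odot> y))"
    using jordan_L_product[of x u x y] jordan_commute[of x u] by (simp add: scaleR_2)
  have 2: "u \<odot> ((x \<odot> x) \<odot> y) + 2 *\<^sub>R (x \<odot> ((u \<odot> x) \<odot> y)) =
         (x \<odot> x) \<odot> (u \<odot> y) + 2 *\<^sub>R ((u \<odot> x) \<odot> (x \<odot> y))"
    using jordan_linearized_once[of u x y] jordan_commute[of x u] by simp
  have 3: "x \<odot> (u \<odot> x) = (x \<odot> u) \<odot> x" by (metis jordan_commute)
  have "2 *\<^sub>R jordan_P2 x (u \<odot> x) y - (u \<odot> jordan_P x y + jordan_P x (u \<odot> y)) =
    (u \<odot> ((x \<odot> x) \<odot> y) + 2 *\<^sub>R (x \<odot> ((u \<odot> x) \<odot> y))) -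
         ((x \<odot> x) \<odot> (u \<odot> y) + 2 *\<^sub>R ((u \<odot> x) \<odot> (x \<odot> y)))"
    unfolding jordan_P2_def jordan_P_eq 3 1
    by (simp add: jt_simps algebra_simps scaleR_2)
  then show ?thesis using 2 by simp
qed

lemma jordan_P_unit_left [simp]: "jordan_P jordan_unit x = x"
  by (simp add: jordan_P_eq jordan_unit scaleR_2)

lemma jordan_P_unit_right [simp]: "jordan_P x jordan_unit = x \<odot> x"
  by (simp add: jordan_P_eq jordan_unit_right scaleR_2)

lemma linear_jordan_P: "linear (jordan_P x)"
  by (rule linearI) (simp_all add: jordan_P_eq jt_simps algebra_simps)

lemma jordan_P_symmetric: "jordan_P x y \<bullet> z = y \<bullet> jordan_P x z"
  by (simp add: jordan_P_eq inner_diff_left inner_diff_right jordan_inner)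

lemma linear_jordan_L: "linear (jordan_times x)"
  by (rule linearI) (simp_all add: jt_simps)

section \<open>Idempotents\<close>

lemma idempotent_L_cubic:
  fixes c h :: "'a::euclidean_jordan_algebra"
  assumes "c \<odot> c = c"
  shows "2 *\<^sub>R (c \<odot> (c \<odot> (c \<odot> h))) = 3 *\<^sub>R (c \<odot> (c \<odot> h)) - c \<odot> h"
  using jordan_L_product[of c c c h] assms
  by (simp add: algebra_simps scaleR_2) (simp add: scaleR_left.add[of 2 1, simplified] scaleR_2)

text \<open>The cubic equation for \<open>L = L(c)\<close> has the roots \<open>0\<close>, \<open>1/2\<close> and \<open>1\<close>. At these points \<open>t = t\<^sup>2 + 4 (t\<^sup>2 - t)\<^sup>2\<close>, so \<open>L\<close> is a
  sum of squares of symmetric operators and therefore positive semidefinite.\<close>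

lemma idempotent_L_psd:
  fixes c h :: "'a::euclidean_jordan_algebra"
  assumes "c \<odot> c = c"
  shows "(c \<odot> h) \<bullet> h = (c \<odot> h) \<bullet> (c \<odot> h)
      + 4 * ((c \<odot> (c \<odot> h) - c \<odot> h) \<bullet> (c \<odot> (c \<odot> h) - c \<odot> h))"
proof -
  note L3 = idempotent_L_cubic[OF assms]
  define a where "a = (c \<odot> h) \<bullet> h"
  define b where "b = (c \<odot> (c \<odot> h)) \<bullet> h"
  have sym: "(c \<odot> u) \<bullet> v = u \<bullet> (c \<odot> v)" for u v by (rule jordan_inner)
  have 3: "2 * ((c \<odot> (c \<odot> (c \<odot> h))) \<bullet> h) = 3 * b - a" 
    using arg_cong[OF L3[of h], of "\<lambda>v. v \<bullet> h"] unfolding a_def b_def by (simp add: inner_diff_left)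
  have 4: "2 * ((c \<odot> (c \<odot> (c \<odot> (c \<odot> h)))) \<bullet> h) = 3 * ((c \<odot> (c \<odot> (c \<odot> h))) \<bullet> h) - b"
    using arg_cong[OF L3[of "c \<odot> h"], of "\<lambda>v. v \<bullet> h"] unfolding a_def b_def
    by (simp add: inner_diff_left)
  have e1: "(c \<odot> h) \<bullet> (c \<odot> h) = b" unfolding b_def by (simp add: sym)
  have e2: "(c \<odot> h) \<bullet> (c \<odot> (c \<odot> h)) = (c \<odot> (c \<odot> (c \<odot> h))) \<bullet> h"  "(c \<odot> (c \<odot> h)) \<bullet> (c \<odot> h) = (c \<odot> (c \<odot> (c \<odot> h))) \<bullet> h"
    "(c \<odot> (c \<odot> h)) \<bullet> (c \<odot> (c \<odot> h)) = (c \<odot> (c \<odot> (c \<odot> (c \<odot> h)))) \<bullet> h"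
    by (simp_all add: sym)
  show ?thesis using 3 4 unfolding inner_diff_left inner_diff_right e1 e2 a_def[symmetric] 
    by simp
qed

lemma idempotent_L_nonneg:
  fixes c h :: "'a::euclidean_jordan_algebra"
  assumes "c \<odot> c = c"
  shows "(c \<odot> h) \<bullet> h \<ge> 0"
  using idempotent_L_psd[OF assms, of h] by simp

lemma idempotent_L_zero:
  fixes c h :: "'a::euclidean_jordan_algebra"
  assumes "c \<odot> c = c" "(c \<odot> h) \<bullet> h = 0"
  shows "c \<odot> h = 0"
proof -
  have "(c \<odot> h) \<bullet> (c \<odot> h) \<ge> 0" by simp
  moreover have "4 * ((c \<odot> (c \<odot> h) - c \<odot> h) \<bullet> (c \<odot> (c \<odot> h) - c \<odot> h)) \<ge> 0" by simp
  ultimately have "(c \<odot> h) \<bullet> (c \<odot> h) = 0" using idempotent_L_psd[OF assms(1), of h] assms(2) by linarith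
  then show ?thesis by simp
qed

lemma idempotent_inner_unit: "c \<odot> c = (c::'a::euclidean_jordan_algebra) \<Longrightarrow> c \<bullet> jordan_unit = c \<bullet> c"
  by (metis jordan_inner jordan_unit_right)

lemma idempotent_inner:
  fixes c d :: "'a::euclidean_jordan_algebra"
  assumes "d \<odot> d = d"
  shows "c \<bullet> d = (c \<odot> d) \<bullet> d"
  by (metis assms inner_commute jordan_inner jordan_commute)

lemma idempotent_inner_nonneg:
  fixes c d :: "'a::euclidean_jordan_algebra"
  assumes "c \<odot> c = c" "d \<odot> d = d"
  shows "c \<bullet> d \<ge> 0"
  using idempotent_inner[OF assms(2), of c] idempotent_L_nonneg[OF assms(1), of d] by simp

lemma idempotent_orthogonal:
  fixes c d :: "'a::euclidean_jordan_algebra"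
  assumes "c \<odot> c = c" "d \<odot> d = d"
  shows "c \<odot> d = 0 \<longleftrightarrow> c \<bullet> d = 0"
  using idempotent_inner[OF assms(2), of c] idempotent_L_zero[OF assms(1), of d] by auto

definition jordan_bound :: "'a::euclidean_jordan_algebra itself \<Rightarrow> real" where
  "jordan_bound _ = (SOME K. K > 0 \<and> (\<forall>x y::'a. norm (x \<odot> y) \<le> norm x * norm y * K))"

lemma jordan_bound_exists:
  "jordan_bound TYPE('a::euclidean_jordan_algebra) > 0 \<and>
    (\<forall>x y::'a. norm (x \<odot> y) \<le> norm x * norm y * jordan_bound TYPE('a))"
proof -
  have "\<exists>K. K > 0 \<and> (\<forall>x y::'a. norm (x \<odot> y) \<le> norm x * norm y * K)"
    using jt.pos_bounded by blast
  from someI_ex[OF this] show ?thesis unfolding jordan_bound_def by auto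
qed

lemmas jordan_bound = jordan_bound_exists[THEN conjunct1] jordan_bound_exists[THEN conjunct2, rule_format]

text \<open>Since \<open>c = c c\<close>, nonzero idempotents are bounded away from zero. This limits the number of times an
  idempotent can be split, and bounds spectral values by the norm.\<close>

lemma idempotent_norm_ge:
  fixes c :: "'a::euclidean_jordan_algebra"
  assumes "c \<odot> c = c" "c \<noteq> 0"
  shows "norm c * jordan_bound TYPE('a) \<ge> 1"
  using jordan_bound(2)[of c c] assms by (simp add: mult.assoc)

section \<open>The spectral theorem\<close>

text \<open>A maximiser \<open>w\<close> of the Rayleigh quotient on the unit sphere of the invariant subspace.\<close>

lemma symmetric_has_eigenvector:
  fixes T :: "'a::euclidean_space \<Rightarrow> 'a"
  assumes T: "linear T" and sym: "\<And>u v. T u \<bullet> v = u \<bullet> T v"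
    and A: "subspace A" "\<And>v. v \<in> A \<Longrightarrow> T v \<in> A" "A \<noteq> {0}"
  obtains w \<mu> where "w \<in> A" "norm w = 1" "T w = \<mu> *\<^sub>R w"
proof -
  define S where "S = A \<inter> sphere 0 1"
  have "compact S" unfolding S_def
    by (intro closed_Int_compact closed_subspace A compact_sphere)
  obtain v where v: "v \<in> A" "v \<noteq> 0" using A subspace_0 by fast
  then have "v /\<^sub>R norm v \<in> S" unfolding S_def using subspace_scale[OF A(1)] by simp
  then have "S \<noteq> {}" by blast
  have "continuous_on S (\<lambda>x. T x \<bullet> x)"
    using T by (intro continuous_intros linear_continuous_on) (simp add: linear_conv_bounded_linear)
  then obtain w where w: "w \<in> S" and max: "\<And>v. v \<in> S \<Longrightarrow> T v \<bullet> v \<le> T w \<bullet> w"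
    using continuous_attains_sup[OF \<open>compact S\<close> \<open>S \<noteq> {}\<close>] by blast
  define \<mu> where "\<mu> = T w \<bullet> w"
  have wA: "w \<in> A" and w1: "w \<bullet> w = 1" using w unfolding S_def by (auto simp: norm_eq_1)
  have max': "T v \<bullet> v \<le> \<mu> * (v \<bullet> v)" if "v \<in> A" for v
  proof (cases "v = 0")
    case True then show ?thesis using linear_0[OF T] by simp
  next
    case False
    then have "v /\<^sub>R norm v \<in> S" unfolding S_def using subspace_scale[OF A(1)] that by simp
    from max[OF this] have "(T v \<bullet> v) / (norm v * norm v) \<le> \<mu>"
      unfolding \<mu>_def by (simp add: linear_scale[OF T] divide_inverse mult_ac)
    moreover have "norm v * norm v > 0" using False by simp
    ultimately show ?thesis by (simp add: divide_le_eq dot_square_norm power2_eq_square)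
  qed
  define h where "h = T w - \<mu> *\<^sub>R w"
  have hA: "h \<in> A" unfolding h_def using A wA by (simp add: subspace_diff subspace_scale)
  have hw: "h \<bullet> w = 0" unfolding h_def \<mu>_def by (simp add: inner_diff_left w1)
  \<comment> \<open>The first-order condition at \<open>w\<close> in the direction \<open>h = T w - \<mu> w\<close> shows \<open>h = 0\<close>.\<close>
  define a where "a = T w \<bullet> h"
  define b where "b = \<mu> * (h \<bullet> h) - T h \<bullet> h"
  have key: "2 * t * a \<le> t\<^sup>2 * b" for t
  proof -
    have "w + t *\<^sub>R h \<in> A" using A wA hA by (simp add: subspace_add subspace_scale)
    from max'[OF this] have "T (w + t *\<^sub>R h) \<bullet> (w + t *\<^sub>R h) \<le> \<mu> * ((w + t *\<^sub>R h) \<bullet> (w + t *\<^sub>R h))" .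
    moreover have "T (w + t *\<^sub>R h) \<bullet> (w + t *\<^sub>R h) = \<mu> + 2 * t * a + t\<^sup>2 * (T h \<bullet> h)"
      using sym[of h w] unfolding a_def \<mu>_def
      by (simp add: linear_add[OF T] linear_scale[OF T] inner_add_left inner_add_right power2_eq_square
          inner_commute algebra_simps)
    moreover have "(w + t *\<^sub>R h) \<bullet> (w + t *\<^sub>R h) = 1 + t\<^sup>2 * (h \<bullet> h)"
      using hw w1 by (simp add: inner_add_left inner_add_right power2_eq_square inner_commute)
    ultimately have "\<mu> + 2 * t * a + t\<^sup>2 * (T h \<bullet> h) \<le> \<mu> * (1 + t\<^sup>2 * (h \<bullet> h))" by (simp only:)
    then show ?thesis unfolding b_def by (simp add: algebra_simps)
  qed
  have "a = 0"
  proof (rule ccontr)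
    assume "a \<noteq> 0"
    \<comment> \<open>For small \<open>t\<close> of the sign of \<open>a\<close> the linear term wins; \<open>t = a / B\<close> is small enough.\<close>
    define B where "B = \<bar>b\<bar> + 1"
    have B: "B > 0" "b < B" unfolding B_def by auto
    have "2 * (a / B) * a \<le> (a / B)\<^sup>2 * b" by (rule key)
    also have "\<dots> \<le> (a / B)\<^sup>2 * B" using B by (intro mult_left_mono) auto
    also have "\<dots> = (a / B) * a" using B by (simp add: power2_eq_square)
    finally have "(a / B) * a \<le> 0" by simp
    moreover have "(a / B) * a > 0" using B \<open>a \<noteq> 0\<close> by (auto simp: zero_less_divide_iff zero_less_mult_iff)
    ultimately show False by simp
  qed
  then have "h \<bullet> h = 0"
    using hw unfolding a_def h_def by (simp add: inner_diff_left inner_diff_right inner_commute algebra_simps)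
  then have "T w = \<mu> *\<^sub>R w" unfolding h_def by simp
  with wA w1 show ?thesis using that by (auto simp: norm_eq_1)
qed

text \<open>The summand is indexed by its eigenvalue, so that different summands have different eigenvalues.\<close>

lemma symmetric_eigen_expansion:
  fixes T :: "'a::euclidean_space \<Rightarrow> 'a"
  assumes T: "linear T" and sym: "\<And>u v. T u \<bullet> v = u \<bullet> T v"
    and "subspace A" "\<And>v. v \<in> A \<Longrightarrow> T v \<in> A" "v \<in> A"
  shows "\<exists>\<Lambda> f. finite \<Lambda> \<and> (\<forall>l. f l \<in> A \<and> T (f l) = l *\<^sub>R f l) \<and> v = (\<Sum>l\<in>\<Lambda>. f l)"
  using assms(3-5)
proof (induction "dim A" arbitrary: A v rule: less_induct)
  case less
  show ?case
  proof (cases "A = {0}")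
    case True
    then show ?thesis using less.prems linear_0[OF T] by (intro exI[of _ "{}"] exI[of _ "\<lambda>_. 0"]) auto
  next
    case False
    then obtain w \<mu> where w: "w \<in> A" "norm w = 1" "T w = \<mu> *\<^sub>R w"
      using symmetric_has_eigenvector[OF T sym less.prems(1,2)] by blast
    have w1: "w \<bullet> w = 1" using w by (simp add: norm_eq_1)
    define A' where "A' = A \<inter> {v. v \<bullet> w = 0}"
    have sub: "subspace A'" unfolding A'_def using less.prems(1)
      by (auto simp: subspace_def inner_add_left)
    have inv: "T u \<in> A'" if "u \<in> A'" for u
      using that less.prems(2) sym[of u w] w unfolding A'_def by auto
    have "w \<notin> A'" using w1 unfolding A'_def by simp
    then have "A' \<subset> A" using w unfolding A'_def by blast
    then have "dim A' < dim A"
      by (intro dim_psubset) (simp add: span_eq_iff[THEN iffD2] sub less.prems(1))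
    moreover have "v - (v \<bullet> w) *\<^sub>R w \<in> A'"
      unfolding A'_def using less.prems w w1 by (auto simp: subspace_diff subspace_scale inner_diff_left)
    ultimately obtain \<Lambda> f where f: "finite \<Lambda>" "\<forall>l. f l \<in> A' \<and> T (f l) = l *\<^sub>R f l"
      "v - (v \<bullet> w) *\<^sub>R w = (\<Sum>l\<in>\<Lambda>. f l)"
      using less.hyps[OF _ sub inv, of "v - (v \<bullet> w) *\<^sub>R w"] by blast
    \<comment> \<open>The new eigenvector joins the summand of \<open>\<mu>\<close>, which may exist already.\<close>
    define f' where "f' l = (if l \<in> \<Lambda> then f l else 0) + (if l = \<mu> then (v \<bullet> w) *\<^sub>R w else 0)" for l
    have "f' l \<in> A \<and> T (f' l) = l *\<^sub>R f' l" for l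
      using f(2) w less.prems(1) unfolding f'_def A'_def
      by (auto simp: subspace_add subspace_scale subspace_0 linear_add[OF T] linear_scale[OF T]
          linear_0[OF T] scaleR_add_right)
    moreover have "v = (\<Sum>l\<in>insert \<mu> \<Lambda>. f' l)"
    proof -
      have "(\<Sum>l\<in>insert \<mu> \<Lambda>. f' l) = (\<Sum>l\<in>insert \<mu> \<Lambda>. if l \<in> \<Lambda> then f l else 0) + (v \<bullet> w) *\<^sub>R w"
        unfolding f'_def sum.distrib using f(1) by simp
      also have "(\<Sum>l\<in>insert \<mu> \<Lambda>. if l \<in> \<Lambda> then f l else 0) = (\<Sum>l\<in>\<Lambda>. f l)"
        using f(1) by (intro sum.mono_neutral_cong_right) auto
      finally show ?thesis using f(3) by (simp add: algebra_simps)
    qed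
    ultimately show ?thesis using f(1) by (intro exI[of _ "insert \<mu> \<Lambda>"] exI[of _ f']) auto
  qed
qed

definition jordan_power :: "'a::euclidean_jordan_algebra \<Rightarrow> nat \<Rightarrow> 'a" where
  "jordan_power x n = (jordan_times x ^^ n) jordan_unit"

text \<open>The multiplication by \<open>x\<^sup>n\<^sup>+\<^sup>2\<close> is by \<open>jordan_L_product\<close> a polynomial in the multiplications by \<open>x\<close>, \<open>x\<^sup>2\<close>, \<open>x\<^sup>n\<close>
  and \<open>x\<^sup>n\<^sup>+\<^sup>1\<close>, so the induction carries two consecutive powers and commutation with \<open>L(x\<^sup>2)\<close> as well.\<close>

lemma jordan_power_L_commute:
  fixes x z :: "'a::euclidean_jordan_algebra"
  shows "jordan_power x n \<odot> (x \<odot> z) = x \<odot> (jordan_power x n \<odot> z)"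
proof -
  have sq: "x \<odot> ((x \<odot> x) \<odot> z) = (x \<odot> x) \<odot> (x \<odot> z)" for z by (rule jordan_identity)
  have "(\<forall>z. jordan_power x n \<odot> (x \<odot> z) = x \<odot> (jordan_power x n \<odot> z) \<and>
      jordan_power x n \<odot> ((x \<odot> x) \<odot> z) = (x \<odot> x) \<odot> (jordan_power x n \<odot> z)) \<and>
     (\<forall>z. jordan_power x (Suc n) \<odot> (x \<odot> z) = x \<odot> (jordan_power x (Suc n) \<odot> z) \<and>
      jordan_power x (Suc n) \<odot> ((x \<odot> x) \<odot> z) = (x \<odot> x) \<odot> (jordan_power x (Suc n) \<odot> z))"
  proof (induction n)
    case 0
    then show ?case using sq by (simp add: jordan_power_def jordan_unit jordan_unit_right)
  next
    case (Suc n)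
    define p where "p = jordan_power x n"
    define q where "q = x \<odot> p"
    have q: "jordan_power x (Suc n) = q" unfolding q_def p_def jordan_power_def by simp
    have q2: "jordan_power x (Suc (Suc n)) = q \<odot> x"
      unfolding q_def p_def jordan_power_def by (simp add: jordan_commute)
    have IH: "p \<odot> (x \<odot> z) = x \<odot> (p \<odot> z)" "p \<odot> ((x \<odot> x) \<odot> z) = (x \<odot> x) \<odot> (p \<odot> z)"
      "q \<odot> (x \<odot> z) = x \<odot> (q \<odot> z)" "q \<odot> ((x \<odot> x) \<odot> z) = (x \<odot> x) \<odot> (q \<odot> z)" for z
      using Suc.IH unfolding p_def[symmetric] q by auto
    have "p \<odot> x = q" unfolding q_def by (rule jordan_commute)
    then have e: "(q \<odot> x) \<odot> z = q \<odot> (x \<odot> z) + (x \<odot> x) \<odot> (p \<odot> z) + q \<odot> (x \<odot> z)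
         - x \<odot> (x \<odot> (p \<odot> z)) - p \<odot> (x \<odot> (x \<odot> z))" for z
      using jordan_L_product[of x p x z] unfolding q_def by simp
    have "(q \<odot> x) \<odot> (x \<odot> z) = x \<odot> ((q \<odot> x) \<odot> z) \<and>
      (q \<odot> x) \<odot> ((x \<odot> x) \<odot> z) = (x \<odot> x) \<odot> ((q \<odot> x) \<odot> z)" for z
      unfolding e by (simp add: IH jordan_add_right jt.diff_right sq)
    then show ?case unfolding q2 q using Suc.IH q by simp
  qed
  then show ?thesis by blast
qed

text \<open>The unit is a sum of eigenvectors \<open>f\<^sub>\<lambda>\<close> of \<open>L(x)\<close> for different eigenvalues, taken in the span of the powers
  of \<open>x\<close>. Multiplications by such elements commute with \<open>L(x)\<close>, so \<open>f\<^sub>\<lambda> f\<^sub>\<mu>\<close> is an eigenvector for both \<open>\<lambda>\<close> and \<open>\<mu>\<close> and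
  vanishes for \<open>\<lambda> \<noteq> \<mu>\<close>. Multiplying the unit by \<open>f\<^sub>\<lambda>\<close> then shows that \<open>f\<^sub>\<lambda>\<close> is idempotent.\<close>

lemma spectral_resolution:
  fixes x :: "'a::euclidean_jordan_algebra"
  obtains \<Lambda> :: "real set" and f :: "real \<Rightarrow> 'a"
  where "finite \<Lambda>" "\<And>l. l \<in> \<Lambda> \<Longrightarrow> f l \<odot> f l = f l"
    "\<And>l m. l \<in> \<Lambda> \<Longrightarrow> m \<in> \<Lambda> \<Longrightarrow> l \<noteq> m \<Longrightarrow> f l \<odot> f m = 0"
    "(\<Sum>l\<in>\<Lambda>. f l) = jordan_unit" "(\<Sum>l\<in>\<Lambda>. l *\<^sub>R f l) = x"
proof -
  define A where "A = span (range (jordan_power x))"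
  have com: "a \<odot> (x \<odot> z) = x \<odot> (a \<odot> z)" if "a \<in> A" for a z
    using that unfolding A_def
    by (induction rule: span_induct_alt)
      (simp_all add: jt.zero_left jt.zero_right jt_simps jordan_power_L_commute image_iff, 
       metis jordan_power_L_commute)
  have inv: "x \<odot> a \<in> A" if "a \<in> A" for a
    using that unfolding A_def
  proof (induction rule: span_induct_alt)
    case base
    then show ?case by (simp add: jt.zero_right span_zero)
  next
    case (step c b y)
    then obtain n where "b = jordan_power x n" by auto
    then have "x \<odot> b = jordan_power x (Suc n)" unfolding jordan_power_def by simp
    then have "x \<odot> b \<in> span (range (jordan_power x))" by (simp add: span_base)
    then show ?case using step by (simp add: jt_simps span_add span_scale)
  qed
  have "jordan_power x 0 \<in> A" unfolding A_def by (intro span_base) simp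
  then have eA: "jordan_unit \<in> A" by (simp add: jordan_power_def)
  have sym: "(x \<odot> u) \<bullet> v = u \<bullet> (x \<odot> v)" for u v by (rule jordan_inner)
  obtain \<Lambda> f where f: "finite \<Lambda>" "\<And>l. f l \<in> A" "\<And>l. x \<odot> f l = l *\<^sub>R f l" "jordan_unit = (\<Sum>l\<in>\<Lambda>. f l)"
    using symmetric_eigen_expansion[OF linear_jordan_L sym _ inv eA] unfolding A_def by auto
  have orth: "f l \<odot> f m = 0" if "l \<noteq> m" for l m
  proof -
    have "x \<odot> (f m \<odot> f l) = l *\<^sub>R (f m \<odot> f l)"
      using com[OF f(2), of m "f l"] f(3)[of l] by (simp add: jordan_scaleR_right)
    moreover have "x \<odot> (f l \<odot> f m) = m *\<^sub>R (f l \<odot> f m)"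
      using com[OF f(2), of l "f m"] f(3)[of m] by (simp add: jordan_scaleR_right)
    ultimately have "l *\<^sub>R (f l \<odot> f m) = m *\<^sub>R (f l \<odot> f m)" by (metis jordan_commute)
    then show ?thesis using that by simp
  qed
  have idem: "f l \<odot> f l = f l" if "l \<in> \<Lambda>" for l
  proof -
    have "f l = f l \<odot> jordan_unit" by (simp add: jordan_unit_right)
    also have "\<dots> = (\<Sum>m\<in>\<Lambda>. f l \<odot> f m)" unfolding f(4) by (rule jt.sum_right)
    also have "\<dots> = (\<Sum>m\<in>\<Lambda>. if m = l then f l \<odot> f l else 0)"
      by (intro sum.cong refl) (auto simp: orth)
    also have "\<dots> = f l \<odot> f l" using f(1) that by simp
    finally show ?thesis by simp
  qed
  have "x = x \<odot> jordan_unit" by (simp add: jordan_unit_right)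
  also have "\<dots> = (\<Sum>l\<in>\<Lambda>. l *\<^sub>R f l)" unfolding f(4) by (simp add: jt.sum_right f(3))
  finally show ?thesis using that[OF f(1) idem orth f(4)[symmetric]] by simp
qed

text \<open>Inner products of idempotents are nonnegative, so a vanishing sum of them vanishes termwise.\<close>

lemma idempotent_pieces_orthogonal:
  fixes F G :: "'a::euclidean_jordan_algebra set"
  assumes F: "finite F" "\<And>f. f \<in> F \<Longrightarrow> f \<odot> f = f" and G: "finite G" "\<And>g. g \<in> G \<Longrightarrow> g \<odot> g = g"
    and "\<Sum>F \<bullet> \<Sum>G = 0" "f \<in> F" "g \<in> G"
  shows "f \<odot> g = 0"
proof -
  have nn: "f' \<bullet> g' \<ge> 0" if "f' \<in> F" "g' \<in> G" for f' g'
    using idempotent_inner_nonneg F(2) G(2) that by blast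
  have "(\<Sum>f\<in>F. \<Sum>g\<in>G. f \<bullet> g) = 0" using assms(5) unfolding inner_sum_left unfolding inner_sum_right .
  then have "(\<Sum>g\<in>G. f \<bullet> g) = 0"
    using \<open>f \<in> F\<close> F(1) by (subst (asm) sum_nonneg_eq_0_iff) (auto intro!: sum_nonneg nn)
  then have "f \<bullet> g = 0" using \<open>f \<in> F\<close> \<open>g \<in> G\<close> G(1)
    by (subst (asm) sum_nonneg_eq_0_iff) (auto intro!: nn)
  then show ?thesis using idempotent_orthogonal[OF F(2) G(2)] assms(6,7) by auto
qed

text \<open>Splitting \<open>c = p + q\<close> gives \<open>p q = 0\<close> and hence \<open>|c|\<^sup>2 = |p|\<^sup>2 + |q|\<^sup>2\<close>. As both terms are bounded below by a
  constant, splitting ends after finitely many steps.\<close>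

lemma idempotent_primitive_decomposition:
  fixes c :: "'a::euclidean_jordan_algebra"
  assumes "c \<odot> c = c"
  shows "\<exists>F. finite F \<and> (\<forall>p\<in>F. primitive_idempotent p) \<and>
    (\<forall>p\<in>F. \<forall>q\<in>F. p \<noteq> q \<longrightarrow> p \<odot> q = 0) \<and> \<Sum>F = c"
proof -
  define K where "K = (1 / jordan_bound TYPE('a))\<^sup>2"
  have Kpos: "K > 0" unfolding K_def using jordan_bound(1)[where 'a='a] by simp
  have K: "p \<bullet> p \<ge> K" if "p \<odot> p = p" "p \<noteq> 0" for p :: 'a
  proof -
    have "1 / jordan_bound TYPE('a) \<le> norm p"
      using idempotent_norm_ge[OF that] jordan_bound(1)[where 'a='a] by (simp add: field_simps)
    then show ?thesis unfolding K_def dot_square_norm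
      using jordan_bound(1)[where 'a='a] by (intro power_mono) auto
  qed
  obtain n :: nat where "c \<bullet> c < real n * K"
    using ex_less_of_nat_mult[OF Kpos] by blast
  then show ?thesis using assms
  proof (induction n arbitrary: c)
    case 0
    then show ?case using inner_ge_zero[of c] by simp
  next
    case (Suc n)
    show ?case
    proof (cases "c = 0 \<or> primitive_idempotent c")
      case True
      then show ?thesis
      proof
        assume "c = 0" then show ?thesis by (intro exI[of _ "{}"]) auto
      next
        assume "primitive_idempotent c" then show ?thesis by (intro exI[of _ "{c}"]) auto
      qed
    next
      case False
      then obtain p q where pq: "p \<odot> p = p" "q \<odot> q = q" "p \<noteq> 0" "q \<noteq> 0" "c = p + q"
        using Suc.prems unfolding primitive_idempotent_def jordan_idempotent_def by blast
      have "(p + q) \<odot> (p + q) = p + q" using Suc.prems pq by simp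
      then have "2 *\<^sub>R (p \<odot> q) = 0"
        using pq(1,2) jordan_commute[of q p] by (simp add: jt_simps scaleR_2 algebra_simps)
      then have pq0: "p \<odot> q = 0" by simp
      then have ip: "p \<bullet> q = 0" using idempotent_orthogonal[OF pq(1,2)] by simp
      have cc: "c \<bullet> c = p \<bullet> p + q \<bullet> q" unfolding pq(5) using ip
        by (simp add: inner_add_left inner_add_right inner_commute)
      have pn: "p \<bullet> p < real n * K" and qn: "q \<bullet> q < real n * K"
        using cc Suc.prems(1) K[OF pq(1,3)] K[OF pq(2,4)] by (auto simp: algebra_simps)
      obtain F where F: "finite F" "\<forall>p\<in>F. primitive_idempotent p"
        "\<forall>p\<in>F. \<forall>q\<in>F. p \<noteq> q \<longrightarrow> p \<odot> q = 0" "\<Sum>F = p"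
        using Suc.IH[OF pn pq(1)] by (elim exE conjE)
      obtain G where G: "finite G" "\<forall>p\<in>G. primitive_idempotent p"
        "\<forall>p\<in>G. \<forall>q\<in>G. p \<noteq> q \<longrightarrow> p \<odot> q = 0" "\<Sum>G = q"
        using Suc.IH[OF qn pq(2)] by (elim exE conjE)
      have id: "f \<odot> f = f" "f \<noteq> 0" if "f \<in> F \<union> G" for f
        using that F(2) G(2) unfolding primitive_idempotent_def jordan_idempotent_def by auto
      have fg: "f \<odot> g = 0" if "f \<in> F" "g \<in> G" for f g
        using idempotent_pieces_orthogonal[OF F(1) id(1) G(1) id(1), of f g] F(4) G(4) ip that by auto
      have gf: "g \<odot> f = 0" if "f \<in> F" "g \<in> G" for f g using fg[OF that] by (simp add: jordan_commute)
      have "F \<inter> G = {}" using fg id by fastforce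
      then have "\<Sum>(F \<union> G) = c" using F G pq(5) by (simp add: sum.union_disjoint)
      moreover have "\<forall>p\<in>F \<union> G. \<forall>q\<in>F \<union> G. p \<noteq> q \<longrightarrow> p \<odot> q = 0" using F(3) G(3) fg gf by blast
      ultimately show ?thesis using F(1,2) G(1,2) by (intro exI[of _ "F \<union> G"]) auto
    qed
  qed
qed

theorem spectral_decomposition_exists:
  fixes x :: "'a::euclidean_jordan_algebra"
  obtains r l c where "spectral_decomposition x r l c"
proof -
  obtain \<Lambda> :: "real set" and f :: "real \<Rightarrow> 'a"
    where f: "finite \<Lambda>" "\<And>l. l \<in> \<Lambda> \<Longrightarrow> f l \<odot> f l = f l"
    "\<And>l m. l \<in> \<Lambda> \<Longrightarrow> m \<in> \<Lambda> \<Longrightarrow> l \<noteq> m \<Longrightarrow> f l \<odot> f m = 0"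
    "(\<Sum>l\<in>\<Lambda>. f l) = jordan_unit" "(\<Sum>l\<in>\<Lambda>. l *\<^sub>R f l) = x"
    using spectral_resolution by blast
  have "\<forall>l\<in>\<Lambda>. \<exists>F. finite F \<and> (\<forall>p\<in>F. primitive_idempotent p) \<and>
    (\<forall>p\<in>F. \<forall>q\<in>F. p \<noteq> q \<longrightarrow> p \<odot> q = 0) \<and> \<Sum>F = f l"
    using idempotent_primitive_decomposition f(2) by blast
  from bchoice[OF this] obtain F where F0: "\<forall>l\<in>\<Lambda>. finite (F l) \<and> (\<forall>p\<in>F l. primitive_idempotent p) \<and>
    (\<forall>p\<in>F l. \<forall>q\<in>F l. p \<noteq> q \<longrightarrow> p \<odot> q = 0) \<and> \<Sum>(F l) = f l" ..
  then have F: "\<And>l. l \<in> \<Lambda> \<Longrightarrow> finite (F l)"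
    "\<And>l p. l \<in> \<Lambda> \<Longrightarrow> p \<in> F l \<Longrightarrow> primitive_idempotent p"
    "\<And>l p q. l \<in> \<Lambda> \<Longrightarrow> p \<in> F l \<Longrightarrow> q \<in> F l \<Longrightarrow> p \<noteq> q \<Longrightarrow> p \<odot> q = 0"
    "\<And>l. l \<in> \<Lambda> \<Longrightarrow> \<Sum>(F l) = f l" by auto
  have id: "p \<odot> p = p" "p \<noteq> 0" if "l \<in> \<Lambda>" "p \<in> F l" for l p
    using F(2)[OF that] unfolding primitive_idempotent_def jordan_idempotent_def by auto
  have cross: "p \<odot> q = 0" if "l \<in> \<Lambda>" "m \<in> \<Lambda>" "l \<noteq> m" "p \<in> F l" "q \<in> F m" for l m p q
  proof (rule idempotent_pieces_orthogonal[of "F l" "F m"])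
    show "\<Sum>(F l) \<bullet> \<Sum>(F m) = 0"
      using f(3)[OF that(1-3)] F(4) that idempotent_orthogonal[OF f(2) f(2)] by simp
  qed (use that F(1) id in auto)
  have uniq: "l = m" if "l \<in> \<Lambda>" "m \<in> \<Lambda>" "p \<in> F l" "p \<in> F m" for l m p
    using cross[OF that(1,2) _ that(3,4)] id that by force
  define G where "G = (\<Union>l\<in>\<Lambda>. F l)"
  define v where "v p = (THE l. l \<in> \<Lambda> \<and> p \<in> F l)" for p
  have v: "v p = l" if "l \<in> \<Lambda>" "p \<in> F l" for l p
    unfolding v_def by (rule the_equality) (use that uniq in auto)
  have finG: "finite G" unfolding G_def using f(1) F(1) by auto
  have sumG: "(\<Sum>p\<in>G. h p) = (\<Sum>l\<in>\<Lambda>. \<Sum>p\<in>F l. h p)" for h :: "'a \<Rightarrow> 'a"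
    unfolding G_def using f(1) F(1) uniq by (intro sum.UNION_disjoint) auto
  have e: "\<Sum>G = jordan_unit" unfolding sumG using F(4) f(4) by simp
  have "(\<Sum>p\<in>G. v p *\<^sub>R p) = (\<Sum>l\<in>\<Lambda>. \<Sum>p\<in>F l. l *\<^sub>R p)" unfolding sumG using v by simp
  also have "\<dots> = x" using F(4) f(5) by (simp add: scaleR_sum_right[symmetric])
  finally have xG: "(\<Sum>p\<in>G. v p *\<^sub>R p) = x" .
  obtain c where c: "bij_betw c {1..card G} G" using ex_bij_betw_nat_finite_1[OF finG] by blast
  have cG: "c i \<in> G" if "i \<in> {1..card G}" for i using c that by (auto dest: bij_betwE)
  have "spectral_decomposition x (card G) (v \<circ> c) c"
    unfolding spectral_decomposition_def jordan_frame_def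
  proof (intro conjI ballI impI)
    fix i assume "i \<in> {1..card G}" from cG[OF this] show "primitive_idempotent (c i)"
      unfolding G_def using F(2) by auto
  next
    fix i j assume ij: "i \<in> {1..card G}" "j \<in> {1..card G}" "i \<noteq> j"
    then have "c i \<noteq> c j" using c unfolding bij_betw_def inj_on_def by blast
    then show "c i \<odot> c j = 0" using cG[OF ij(1)] cG[OF ij(2)] cross F(3) unfolding G_def by blast
  next
    show "(\<Sum>i = 1..card G. c i) = jordan_unit"
      using sum.reindex_bij_betw[OF c, of "\<lambda>p. p"] e by simp
  next
    show "x = (\<Sum>j = 1..card G. (v \<circ> c) j *\<^sub>R c j)"
      using sum.reindex_bij_betw[OF c, of "\<lambda>p. v p *\<^sub>R p"] xG by simp
  qed
  then show ?thesis using that by blast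
qed

section \<open>Functional calculus\<close>

lemma spectral_decomposition_simps:
  fixes x :: "'a::euclidean_jordan_algebra"
  assumes "spectral_decomposition x r l c"
  shows "i \<in> {1..r} \<Longrightarrow> c i \<odot> c i = c i" "i \<in> {1..r} \<Longrightarrow> c i \<noteq> 0"
    "i \<in> {1..r} \<Longrightarrow> j \<in> {1..r} \<Longrightarrow> i \<noteq> j \<Longrightarrow> c i \<odot> c j = 0"
    "i \<in> {1..r} \<Longrightarrow> primitive_idempotent (c i)"
    "(\<Sum>i=1..r. c i) = jordan_unit" "x = (\<Sum>j=1..r. l j *\<^sub>R c j)"
  using assms unfolding spectral_decomposition_def jordan_frame_def primitive_idempotent_def
    jordan_idempotent_def by auto

lemma spectral_decomposition_times:
  fixes x :: "'a::euclidean_jordan_algebra"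
  assumes "spectral_decomposition x r l c" "i \<in> {1..r}"
  shows "(\<Sum>j=1..r. m j *\<^sub>R c j) \<odot> c i = m i *\<^sub>R c i"
proof -
  have "(\<Sum>j=1..r. m j *\<^sub>R c j) \<odot> c i = (\<Sum>j=1..r. m j *\<^sub>R (c j \<odot> c i))"
    by (simp add: jt.sum_left jordan_scaleR_left)
  also have "\<dots> = (\<Sum>j=1..r. if j = i then m i *\<^sub>R c i else 0)"
    using assms(2) spectral_decomposition_simps[OF assms(1)] by (intro sum.cong refl) auto
  also have "\<dots> = m i *\<^sub>R c i" using assms(2) by simp
  finally show ?thesis .
qed

text \<open>The sum of the \<open>c\<^sub>j\<close> with \<open>\<lambda>\<^sub>j = t\<close> is the component of the unit in the \<open>t\<close>-eigenspace of the symmetric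
  operator \<open>L(x)\<close>. Its eigenspaces are orthogonal, so this component does not depend on the decomposition.\<close>

lemma spectral_projection_unique:
  fixes x :: "'a::euclidean_jordan_algebra"
  assumes x1: "spectral_decomposition x r l c" and x2: "spectral_decomposition x s m d"
  shows "(\<Sum>j | j \<in> {1..r} \<and> l j = t. c j) = (\<Sum>j | j \<in> {1..s} \<and> m j = t. d j)"
proof -
  define E where "E t = (\<Sum>j | j \<in> {1..r} \<and> l j = t. c j)" for t
  define E' where "E' t = (\<Sum>j | j \<in> {1..s} \<and> m j = t. d j)" for t
  define D where "D t = E t - E' t" for t
  define \<Lambda> where "\<Lambda> = l ` {1..r} \<union> m ` {1..s}"
  have fin: "finite \<Lambda>" unfolding \<Lambda>_def by simp
  have xE: "x \<odot> E t = t *\<^sub>R E t" for t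
    unfolding E_def jt.sum_right scaleR_sum_right spectral_decomposition_simps(6)[OF x1]
    by (rule sum.cong[OF refl]) (use spectral_decomposition_times[OF x1] in auto)
  have xE': "x \<odot> E' t = t *\<^sub>R E' t" for t
    unfolding E'_def jt.sum_right scaleR_sum_right spectral_decomposition_simps(6)[OF x2]
    by (rule sum.cong[OF refl]) (use spectral_decomposition_times[OF x2] in auto)
  have xD: "x \<odot> D t = t *\<^sub>R D t" for t
    unfolding D_def by (simp add: jt.diff_right xE xE' scaleR_diff_right)
  have "(\<Sum>t\<in>\<Lambda>. E t) = jordan_unit"
    unfolding E_def spectral_decomposition_simps(5)[OF x1, symmetric]
    by (rule sum.group) (auto simp: \<Lambda>_def)
  moreover have "(\<Sum>t\<in>\<Lambda>. E' t) = jordan_unit"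
    unfolding E'_def spectral_decomposition_simps(5)[OF x2, symmetric]
    by (rule sum.group) (auto simp: \<Lambda>_def)
  ultimately have sumD: "(\<Sum>t\<in>\<Lambda>. D t) = 0" unfolding D_def by (simp add: sum_subtractf)
  have orth: "D t \<bullet> D u = 0" if "t \<noteq> u" for t u
  proof -
    have "t * (D t \<bullet> D u) = u * (D t \<bullet> D u)"
      using jordan_inner[of x "D t" "D u"] unfolding xD by simp
    then show ?thesis using that by simp
  qed
  have "D t = 0"
  proof (cases "t \<in> \<Lambda>")
    case True
    have "0 = D t \<bullet> (\<Sum>u\<in>\<Lambda>. D u)" by (simp add: sumD)
    also have "\<dots> = (\<Sum>u\<in>\<Lambda>. if u = t then D t \<bullet> D t else 0)"
      unfolding inner_sum_right by (intro sum.cong refl) (auto simp: orth)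
    also have "\<dots> = D t \<bullet> D t" using True fin by simp
    finally show ?thesis by simp
  next
    case False
    then have "{j. j \<in> {1..r} \<and> l j = t} = {}" "{j. j \<in> {1..s} \<and> m j = t} = {}"
      unfolding \<Lambda>_def by auto
    then show ?thesis unfolding D_def E_def E'_def by (simp only: sum.empty) simp
  qed
  then show ?thesis unfolding D_def E_def E'_def by simp
qed

lemma spectral_sum_group:
  fixes h :: "real \<Rightarrow> 'a::euclidean_jordan_algebra \<Rightarrow> 'b::comm_monoid_add" and r :: nat
  assumes "finite \<Lambda>" "l ` {1..r} \<subseteq> \<Lambda>"
  shows "(\<Sum>j=1..r. h (l j) (c j)) = (\<Sum>t\<in>\<Lambda>. \<Sum>j | j \<in> {1..r} \<and> l j = t. h t (c j))"
proof -
  have "(\<Sum>j=1..r. h (l j) (c j)) = (\<Sum>t\<in>\<Lambda>. \<Sum>j | j \<in> {1..r} \<and> l j = t. h (l j) (c j))"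
    using assms by (intro sum.group[symmetric]) auto
  then show ?thesis by simp
qed

text \<open>The functional calculus; \<open>jordan_powr\<close> is the case of a power function.\<close>

definition jordan_fun :: "(real \<Rightarrow> real) \<Rightarrow> 'a::euclidean_jordan_algebra \<Rightarrow> 'a" where
  "jordan_fun g x = (THE y. \<exists>r l c. spectral_decomposition x r l c \<and> y = (\<Sum>j=1..r. g (l j) *\<^sub>R c j))"

lemma jordan_fun_eq:
  fixes x :: "'a::euclidean_jordan_algebra"
  assumes x1: "spectral_decomposition x r l c"
  shows "jordan_fun g x = (\<Sum>j=1..r. g (l j) *\<^sub>R c j)"
  unfolding jordan_fun_def
proof (rule the_equality)
  show "\<exists>s m d. spectral_decomposition x s m d \<and> (\<Sum>j=1..r. g (l j) *\<^sub>R c j) = (\<Sum>j=1..s. g (m j) *\<^sub>R d j)"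
    using x1 by blast
next
  fix y assume "\<exists>r l c. spectral_decomposition x r l c \<and> y = (\<Sum>j=1..r. g (l j) *\<^sub>R c j)"
  then obtain s m d where x2: "spectral_decomposition x s m d" and y: "y = (\<Sum>j=1..s. g (m j) *\<^sub>R d j)"
    by blast
  define \<Lambda> where "\<Lambda> = l ` {1..r} \<union> m ` {1..s}"
  have "finite \<Lambda>" "l ` {1..r} \<subseteq> \<Lambda>" "m ` {1..s} \<subseteq> \<Lambda>" unfolding \<Lambda>_def by auto
  then show "y = (\<Sum>j=1..r. g (l j) *\<^sub>R c j)"
    unfolding y using spectral_sum_group[of \<Lambda> l r "\<lambda>t c. g t *\<^sub>R c" c]
      spectral_sum_group[of \<Lambda> m s "\<lambda>t c. g t *\<^sub>R c" d] spectral_projection_unique[OF x1 x2]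
    by (simp add: scaleR_sum_right[symmetric])
qed

lemma jordan_powr_fun: "jordan_powr x \<alpha> = jordan_fun (\<lambda>t. t powr \<alpha>) x"
  unfolding jordan_powr_def jordan_fun_def ..

lemma spectral_decomposition_fun:
  fixes x :: "'a::euclidean_jordan_algebra"
  assumes "spectral_decomposition x r l c"
  shows "spectral_decomposition (jordan_fun g x) r (g \<circ> l) c"
  using assms jordan_fun_eq[OF assms, of g] unfolding spectral_decomposition_def by auto

lemma jordan_fun_compose:
  "jordan_fun g (jordan_fun h x) = jordan_fun (\<lambda>t. g (h t)) (x :: 'a::euclidean_jordan_algebra)"
proof -
  obtain r l c where x: "spectral_decomposition x r l c" using spectral_decomposition_exists by blast
  show ?thesis
    using jordan_fun_eq[OF spectral_decomposition_fun[OF x, of h], of g] jordan_fun_eq[OF x]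
    by (simp add: comp_def)
qed

lemma jordan_fun_ident [simp]: "jordan_fun (\<lambda>t. t) x = (x :: 'a::euclidean_jordan_algebra)"
proof -
  obtain r l c where x: "spectral_decomposition x r l c" using spectral_decomposition_exists by blast
  show ?thesis using jordan_fun_eq[OF x] spectral_decomposition_simps(6)[OF x] by simp
qed

lemma jordan_fun_const [simp]:
  "jordan_fun (\<lambda>t. a) x = a *\<^sub>R (jordan_unit :: 'a::euclidean_jordan_algebra)"
proof -
  obtain r l c where x: "spectral_decomposition x r l c" using spectral_decomposition_exists by blast
  show ?thesis using jordan_fun_eq[OF x] spectral_decomposition_simps(5)[OF x]
    by (simp add: scaleR_sum_right[symmetric])
qed

lemma jordan_fun_diff:
  "jordan_fun (\<lambda>t. g t - h t) x = jordan_fun g x - jordan_fun h (x :: 'a::euclidean_jordan_algebra)"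
proof -
  obtain r l c where x: "spectral_decomposition x r l c" using spectral_decomposition_exists by blast
  show ?thesis unfolding jordan_fun_eq[OF x] by (simp add: scaleR_diff_left sum_subtractf)
qed

lemma jordan_fun_scale:
  "jordan_fun (\<lambda>t. a * g t) x = a *\<^sub>R jordan_fun g (x :: 'a::euclidean_jordan_algebra)"
proof -
  obtain r l c where x: "spectral_decomposition x r l c" using spectral_decomposition_exists by blast
  show ?thesis unfolding jordan_fun_eq[OF x] by (simp add: scaleR_sum_right)
qed

lemma jordan_fun_times:
  "jordan_fun g x \<odot> jordan_fun h x = jordan_fun (\<lambda>t. g t * h t) (x :: 'a::euclidean_jordan_algebra)"
proof -
  obtain r l c where x: "spectral_decomposition x r l c" using spectral_decomposition_exists by blast
  have "jordan_fun g x \<odot> jordan_fun h x = (\<Sum>i=1..r. h (l i) *\<^sub>R (jordan_fun g x \<odot> c i))"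
    unfolding jordan_fun_eq[OF x, of h] by (simp add: jt.sum_right jordan_scaleR_right)
  also have "\<dots> = (\<Sum>i=1..r. (g (l i) * h (l i)) *\<^sub>R c i)"
    unfolding jordan_fun_eq[OF x, of g]
    by (intro sum.cong refl, subst spectral_decomposition_times[OF x]) (auto simp: mult.commute)
  also have "\<dots> = jordan_fun (\<lambda>t. g t * h t) x" by (simp add: jordan_fun_eq[OF x])
  finally show ?thesis .
qed

lemma jordan_fun_L_commute:
  fixes x z :: "'a::euclidean_jordan_algebra"
  shows "jordan_fun g x \<odot> (jordan_fun h x \<odot> z) = jordan_fun h x \<odot> (jordan_fun g x \<odot> z)"
proof -
  obtain r l c where x: "spectral_decomposition x r l c" using spectral_decomposition_exists by blast
  have c: "c i \<odot> (c j \<odot> z) = c j \<odot> (c i \<odot> z)" if "i \<in> {1..r}" "j \<in> {1..r}" for i j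
    using jordan_L_commute_orthogonal[of "c i" "c j" z] spectral_decomposition_simps[OF x] that
    by (cases "i = j") auto
  have exp: "jordan_fun g x \<odot> (jordan_fun h x \<odot> z) =
    (\<Sum>i=1..r. \<Sum>j=1..r. (g (l i) * h (l j)) *\<^sub>R (c i \<odot> (c j \<odot> z)))" for g h
    unfolding jordan_fun_eq[OF x]
    by (simp add: jt.sum_left jt.sum_right jt_simps scaleR_sum_right)
      (subst sum.swap, simp add: mult.commute)
  show ?thesis unfolding exp[of g h] exp[of h g]
    by (subst sum.swap) (intro sum.cong refl, simp add: c mult.commute)
qed

lemma jordan_fun_cong_decomposition:
  fixes x :: "'a::euclidean_jordan_algebra"
  assumes "spectral_decomposition x r l c" "\<And>j. j \<in> {1..r} \<Longrightarrow> g (l j) = h (l j)"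
  shows "jordan_fun g x = jordan_fun h x"
  unfolding jordan_fun_eq[OF assms(1)] using assms(2) by (intro sum.cong) auto

lemma jordan_fun_inner:
  fixes x :: "'a::euclidean_jordan_algebra"
  assumes x: "spectral_decomposition x r l c"
  shows "jordan_fun g x \<bullet> jordan_fun h x = (\<Sum>j=1..r. g (l j) * h (l j) * (c j \<bullet> c j))"
proof -
  have "jordan_fun g x \<bullet> jordan_fun h x = (jordan_fun g x \<odot> jordan_fun h x) \<bullet> jordan_unit"
    by (metis jordan_inner jordan_unit_right jordan_commute)
  also have "\<dots> = (\<Sum>j=1..r. g (l j) * h (l j) * (c j \<bullet> jordan_unit))"
    unfolding jordan_fun_times unfolding jordan_fun_eq[OF x] by (simp add: inner_sum_left)
  also have "\<dots> = (\<Sum>j=1..r. g (l j) * h (l j) * (c j \<bullet> c j))"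
    using spectral_decomposition_simps[OF x] by (intro sum.cong refl) (simp add: idempotent_inner_unit)
  finally show ?thesis .
qed

lemma spectral_value_inner:
  fixes x :: "'a::euclidean_jordan_algebra"
  assumes x: "spectral_decomposition x r l c" and i: "i \<in> {1..r}"
  shows "x \<bullet> c i = l i * (c i \<bullet> c i)"
proof -
  have "x \<bullet> c i = (x \<odot> c i) \<bullet> c i"
    using idempotent_inner[of "c i" x] spectral_decomposition_simps[OF x] i by simp
  also have "\<dots> = l i * (c i \<bullet> c i)"
    using spectral_decomposition_times[OF x i, of l] spectral_decomposition_simps(6)[OF x] by simp
  finally show ?thesis .
qed

lemma spectral_value_bound:
  fixes x :: "'a::euclidean_jordan_algebra"
  assumes x: "spectral_decomposition x r l c" and i: "i \<in> {1..r}"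
  shows "\<bar>l i\<bar> \<le> norm x * jordan_bound TYPE('a)"
proof -
  have n0: "norm (c i) > 0" using spectral_decomposition_simps(2)[OF x i] by simp
  have "\<bar>l i\<bar> * (norm (c i) * norm (c i)) = \<bar>x \<bullet> c i\<bar>"
    using spectral_value_inner[OF x i] by (simp add: dot_square_norm power2_eq_square abs_mult)
  also have "\<dots> \<le> norm x * norm (c i)" by (rule Cauchy_Schwarz_ineq2)
  finally have "\<bar>l i\<bar> * norm (c i) \<le> norm x" using n0 by simp
  moreover have "\<bar>l i\<bar> * 1 \<le> \<bar>l i\<bar> * (norm (c i) * jordan_bound TYPE('a))"
    using idempotent_norm_ge[OF spectral_decomposition_simps(1)[OF x i] spectral_decomposition_simps(2)[OF x i]]
    by (intro mult_left_mono) auto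
  ultimately show ?thesis using jordan_bound(1)[where 'a='a]
    by (smt (verit) mult.assoc mult_right_mono mult.right_neutral)
qed

section \<open>Multiplicities in a simple algebra\<close>

text \<open>For \<open>x = P(c) y\<close> one has \<open>c x = x\<close>, so \<open>e - c\<close> is orthogonal to \<open>x\<^sup>2\<close>, and by positivity to every
  member of a spectral frame of \<open>x\<close> with nonzero spectral value. Such a member \<open>d\<close> satisfies \<open>d c = d\<close>, so that \<open>c - d\<close> is
  an idempotent and \<open>d = c\<close> by primitivity.\<close>

lemma jordan_P_primitive:
  fixes c y :: "'a::euclidean_jordan_algebra"
  assumes c: "primitive_idempotent c"
  obtains t where "jordan_P c y = t *\<^sub>R c"
proof -
  have cc: "c \<odot> c = c" and c0: "c \<noteq> 0" using c unfolding primitive_idempotent_def jordan_idempotent_def by auto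
  define x where "x = jordan_P c y"
  have cx: "c \<odot> x = x"
    unfolding x_def jordan_P_eq cc jordan_scaleR_right jt.diff_right idempotent_L_cubic[OF cc]
    by (simp add: algebra_simps scaleR_left.add[of 2 1, simplified])
  define c' where "c' = jordan_unit - c"
  have c'c': "c' \<odot> c' = c'" unfolding c'_def by (simp add: jt_simps jordan_unit jordan_unit_right cc)
  have c'x: "c' \<odot> x = 0" unfolding c'_def by (simp add: jt_simps jordan_unit cx)
  obtain r l d where d: "spectral_decomposition x r l d" using spectral_decomposition_exists by blast
  note ds = spectral_decomposition_simps[OF d]
  have xx: "x \<odot> x = (\<Sum>j=1..r. (l j)\<^sup>2 *\<^sub>R d j)"
    using jordan_fun_times[of "\<lambda>t. t" x "\<lambda>t. t"] jordan_fun_eq[OF d, of "\<lambda>t. t * t"]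
    by (simp add: power2_eq_square)
  have "(x \<odot> x) \<bullet> c' = 0" using jordan_inner[of x x c'] c'x by (simp add: jordan_commute)
  then have "(\<Sum>j=1..r. (l j)\<^sup>2 * (d j \<bullet> c')) = 0" unfolding xx by (simp add: inner_sum_left)
  then have z: "(l j)\<^sup>2 * (d j \<bullet> c') = 0" if "j \<in> {1..r}" for j
    using that ds(1) by (subst (asm) sum_nonneg_eq_0_iff) (auto intro!: mult_nonneg_nonneg idempotent_inner_nonneg c'c')
  have cd: "d j = c" if "j \<in> {1..r}" "l j \<noteq> 0" for j
  proof -
    have "d j \<bullet> c' = 0" using z[OF that(1)] that(2) by simp
    then have "d j \<odot> c' = 0" using idempotent_orthogonal[OF ds(1)[OF that(1)] c'c'] by simp
    then have dc: "d j \<odot> c = d j" unfolding c'_def by (simp add: jt_simps jordan_unit_right)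
    have "(c - d j) \<odot> (c - d j) = c - d j"
      using dc cc ds(1)[OF that(1)] jordan_commute[of c "d j"] by (simp add: jt_simps)
    then show ?thesis
      using c ds(1,2)[OF that(1)] unfolding primitive_idempotent_def jordan_idempotent_def
      by (metis add_diff_cancel_left' diff_add_cancel eq_iff_diff_eq_0)
  qed
  have "x = (\<Sum>j=1..r. l j *\<^sub>R c)"
    by (subst ds(6), intro sum.cong refl) (metis cd scaleR_zero_left)
  also have "\<dots> = (\<Sum>j=1..r. l j) *\<^sub>R c" by (simp add: scaleR_sum_left)
  finally show ?thesis using that unfolding x_def by blast
qed

text \<open>Write \<open>P(c) d = t c\<close> and \<open>P(d) c = s d\<close>. The number \<open>\<langle>P(c) d, d\<rangle> = 2 |c d|\<^sup>2 - \<langle>c, d\<rangle>\<close> is symmetric in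
  \<open>c\<close> and \<open>d\<close>, which gives \<open>t = s\<close>; pairing the two equations with \<open>c\<close> and \<open>d\<close> gives \<open>t |c|\<^sup>2 = \<langle>c, d\<rangle> = s |d|\<^sup>2\<close>.\<close>

lemma primitive_idempotents_same_norm:
  fixes c d :: "'a::euclidean_jordan_algebra"
  assumes c: "primitive_idempotent c" and d: "primitive_idempotent d" and cd: "c \<bullet> d \<noteq> 0"
  shows "c \<bullet> c = d \<bullet> d"
proof -
  have P: "jordan_P c d \<bullet> d = jordan_P d c \<bullet> c" and cc: "c \<odot> c = c" "d \<odot> d = d"
  proof -
    show cc: "c \<odot> c = c" "d \<odot> d = d"
      using c d unfolding primitive_idempotent_def jordan_idempotent_def by auto
    have *: "jordan_P c d \<bullet> d = 2 * ((c \<odot> d) \<bullet> (c \<odot> d)) - c \<bullet> d"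
      if "c \<odot> c = c" "d \<odot> d = d" for c d :: 'a
      unfolding jordan_P_eq that(1) using idempotent_inner[OF that(2), of c]
      by (simp add: inner_diff_left jordan_inner)
    show "jordan_P c d \<bullet> d = jordan_P d c \<bullet> c"
      unfolding *[OF cc] *[OF cc(2,1)] by (simp add: jordan_commute inner_commute)
  qed
  obtain t s where t: "jordan_P c d = t *\<^sub>R c" and s: "jordan_P d c = s *\<^sub>R d"
    using jordan_P_primitive[OF c] jordan_P_primitive[OF d] by meson
  have "t * (c \<bullet> d) = s * (c \<bullet> d)" using P unfolding t s by (simp add: inner_commute)
  then have ts: "t = s" using cd by simp
  have "t * (c \<bullet> c) = c \<bullet> d"
    using jordan_P_symmetric[of c d c] unfolding t by (simp add: jordan_P_eq cc scaleR_2 inner_commute)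
  moreover have "s * (d \<bullet> d) = c \<bullet> d"
    using jordan_P_symmetric[of d c d] unfolding s by (simp add: jordan_P_eq cc scaleR_2)
  ultimately show ?thesis using ts cd by (metis mult_cancel_left mult_zero_left)
qed

text \<open>Primitive idempotents of different norms are orthogonal, so they annihilate each other. By the spectral
  theorem the span of those with the norm of \<open>c\<close> and the span of the others are complementary, and
  each of them is an ideal.\<close>

lemma primitive_idempotent_norm_simple:
  fixes c d :: "'a::simple_euclidean_jordan_algebra"
  assumes c: "primitive_idempotent c" and d: "primitive_idempotent d"
  shows "c \<bullet> c = d \<bullet> d"
proof (rule ccontr)
  assume ne: "c \<bullet> c \<noteq> d \<bullet> d"
  define X where "X = {p::'a. primitive_idempotent p \<and> p \<bullet> p = c \<bullet> c}"
  define Y where "Y = {p::'a. primitive_idempotent p \<and> p \<bullet> p \<noteq> c \<bullet> c}"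
  have prim: "p \<odot> p = p" "p \<noteq> 0" if "primitive_idempotent p" for p :: 'a
    using that unfolding primitive_idempotent_def jordan_idempotent_def by auto
  have XY: "p \<odot> q = 0" if "p \<in> X" "q \<in> Y" for p q
    using that primitive_idempotents_same_norm[of p q] idempotent_orthogonal[OF prim(1) prim(1), of p q]
    unfolding X_def Y_def by auto
  have spXY: "p \<odot> q = 0" if "p \<in> span X" "q \<in> span Y" for p q
  proof -
    have "p \<odot> q = 0" if "p \<in> X" for p
      using \<open>q \<in> span Y\<close> by (induction rule: span_induct_alt) (auto simp: jt.zero_right jt_simps XY[OF that])
    with \<open>p \<in> span X\<close> show ?thesis
      by (induction rule: span_induct_alt) (auto simp: jt.zero_left jt_simps)
  qed
  have decomp: "\<exists>a b. a \<in> span X \<and> b \<in> span Y \<and> z = a + b" for z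
  proof -
    obtain r l p where p: "spectral_decomposition z r l p" using spectral_decomposition_exists by blast
    have "z \<in> span (X \<union> Y)"
      unfolding spectral_decomposition_simps(6)[OF p]
      using spectral_decomposition_simps(4)[OF p]
      by (intro span_sum span_scale span_base) (auto simp: X_def Y_def)
    then show ?thesis unfolding span_Un by auto
  qed
  have inXY: "a \<bullet> b = 0" if "a \<in> span X" "b \<in> span Y" for a b
    using jordan_inner[of a jordan_unit b] spXY[OF that] by (simp add: jordan_unit_right jordan_unit)
  have XX: "a \<odot> b \<in> span X" if "a \<in> span X" "b \<in> span X" for a b
  proof -
    obtain u v where uv: "u \<in> span X" "v \<in> span Y" "a \<odot> b = u + v" using decomp by blast
    have "v \<bullet> v = (a \<odot> b) \<bullet> v" using uv(3) inXY[OF uv(1,2)] by (simp add: inner_add_left)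
    also have "\<dots> = 0" using jordan_inner[of a b v] spXY[OF that(1) uv(2)] by simp
    finally show ?thesis using uv by simp
  qed
  have "jordan_ideal (span X)"
    unfolding jordan_ideal_def
  proof (intro conjI ballI allI)
    fix x y assume y: "y \<in> span X"
    obtain a b where ab: "a \<in> span X" "b \<in> span Y" "x = a + b" using decomp by blast
    have "x \<odot> y = a \<odot> y" using spXY[OF y ab(2)] ab(3) by (simp add: jt_simps jordan_commute)
    then show "x \<odot> y \<in> span X" using XX[OF ab(1) y] by simp
  qed (auto simp: span_zero span_add span_scale)
  then have "span X = {0} \<or> span X = UNIV" by (rule simple)
  moreover have "c \<in> span X" using c by (intro span_base) (simp add: X_def)
  ultimately have "span X = UNIV" using prim(2)[OF c] by auto
  moreover have "d \<in> span Y" using d ne by (intro span_base) (simp add: Y_def)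
  ultimately have "d \<bullet> d = 0" using inXY[of d d] by auto
  then show False using prim(2)[OF d] by simp
qed

definition primitive_norm_sq :: "'a::simple_euclidean_jordan_algebra itself \<Rightarrow> real" where
  "primitive_norm_sq _ = (THE k. \<forall>c::'a. primitive_idempotent c \<longrightarrow> c \<bullet> c = k)"

lemma primitive_norm_sq:
  fixes c :: "'a::simple_euclidean_jordan_algebra"
  assumes "primitive_idempotent c"
  shows "c \<bullet> c = primitive_norm_sq TYPE('a)"
proof -
  have "(THE k. \<forall>c::'a. primitive_idempotent c \<longrightarrow> c \<bullet> c = k) = c \<bullet> c"
    using primitive_idempotent_norm_simple assms by (intro the_equality) blast+
  then show ?thesis unfolding primitive_norm_sq_def by simp
qed

lemma primitive_norm_sq_pos: "primitive_norm_sq TYPE('a::simple_euclidean_jordan_algebra) > 0"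
proof -
  obtain r l c where x: "spectral_decomposition (jordan_unit :: 'a) r l c" using spectral_decomposition_exists by blast
  have "(jordan_unit :: 'a) \<noteq> 0"
  proof
    assume "(jordan_unit :: 'a) = 0"
    then have "b = 0" for b :: 'a using jordan_unit[of b] by (simp add: jt.zero_left)
    moreover obtain b :: 'a where "b \<in> Basis" using nonempty_Basis by blast
    ultimately show False using nonzero_Basis by blast
  qed
  then have "r \<ge> 1" using spectral_decomposition_simps(5)[OF x] by (cases r) auto
  then have "c 1 \<noteq> 0" "primitive_idempotent (c 1)" using spectral_decomposition_simps[OF x] by auto
  then show ?thesis using primitive_norm_sq[of "c 1"] by (metis inner_gt_zero_iff)
qed

text \<open>If \<open>\<kappa>\<close> is the common squared norm of the primitive idempotents, then \<open>t\<close> has the multiplicity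
  \<open>\<langle>E\<^sub>t, e\<rangle> / \<kappa>\<close>, where \<open>E\<^sub>t\<close> is the spectral idempotent of \<open>t\<close>.\<close>

lemma spectral_values_eq:
  fixes x :: "'a::simple_euclidean_jordan_algebra"
  assumes x1: "spectral_decomposition x r l c"
  shows "spectral_values x = image_mset l (mset_set {1..r})"
  unfolding spectral_values_def
proof (rule the_equality)
  show "\<exists>s m d. spectral_decomposition x s m d \<and> image_mset l (mset_set {1..r}) = image_mset m (mset_set {1..s})"
    using x1 by blast
next
  fix M assume "\<exists>r l c. spectral_decomposition x r l c \<and> M = image_mset l (mset_set {1..r})"
  then obtain s m d where x2: "spectral_decomposition x s m d" and M: "M = image_mset m (mset_set {1..s})"
    by blast
  have count: "(\<Sum>j | j \<in> {1..r} \<and> l j = t. c j) \<bullet> jordan_unit =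
      real (count (image_mset l (mset_set {1..r})) t) * primitive_norm_sq TYPE('a)"
    if "spectral_decomposition x r l c" for r l c t
  proof -
    note s = spectral_decomposition_simps[OF that]
    have "(\<Sum>j | j \<in> {1..r} \<and> l j = t. c j) \<bullet> jordan_unit =
      (\<Sum>j | j \<in> {1..r} \<and> l j = t. primitive_norm_sq TYPE('a))"
      unfolding inner_sum_left
      by (intro sum.cong refl) (use s in \<open>auto simp: idempotent_inner_unit primitive_norm_sq\<close>)
    moreover have "count (image_mset l (mset_set {1..r})) t = card {j. j \<in> {1..r} \<and> l j = t}"
      by (simp add: count_image_mset_eq_card_vimage)
    ultimately show ?thesis by simp
  qed
  show "M = image_mset l (mset_set {1..r})"
  proof (rule multiset_eqI)
    fix t
    show "count M t = count (image_mset l (mset_set {1..r})) t"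
      using count[OF x1, of t] count[OF x2, of t] spectral_projection_unique[OF x1 x2, of t]
        primitive_norm_sq_pos[where 'a='a] unfolding M by simp
  qed
qed

lemma spectral_values_ln_sq:
  fixes x :: "'a::simple_euclidean_jordan_algebra"
  shows "(\<Sum>t\<in>#spectral_values x. (ln t)\<^sup>2) = (norm (jordan_fun ln x))\<^sup>2 / primitive_norm_sq TYPE('a)"
proof -
  obtain r l c where x: "spectral_decomposition x r l c" using spectral_decomposition_exists by blast
  have "(norm (jordan_fun ln x))\<^sup>2 = (\<Sum>j=1..r. (ln (l j))\<^sup>2 * primitive_norm_sq TYPE('a))"
    unfolding dot_square_norm[symmetric] jordan_fun_inner[OF x]
    by (intro sum.cong refl)
      (use spectral_decomposition_simps(4)[OF x] in \<open>auto simp: primitive_norm_sq power2_eq_square\<close>)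
  then have "(norm (jordan_fun ln x))\<^sup>2 / primitive_norm_sq TYPE('a) = (\<Sum>j=1..r. (ln (l j))\<^sup>2)"
    using primitive_norm_sq_pos[where 'a='a] by (simp add: sum_distrib_right[symmetric])
  then show ?thesis
    unfolding spectral_values_eq[OF x] by (simp add: image_mset.compositionality comp_def sum_unfold_sum_mset)
qed

section \<open>The symmetric cone\<close>

lemma jordan_square_iff:
  fixes x :: "'a::euclidean_jordan_algebra"
  shows "x \<in> {y \<odot> y | y. True} \<longleftrightarrow> (\<forall>c. c \<odot> c = c \<longrightarrow> 0 \<le> x \<bullet> c)"
proof
  assume "x \<in> {y \<odot> y | y. True}"
  then obtain y where x: "x = y \<odot> y" by blast
  show "\<forall>c. c \<odot> c = c \<longrightarrow> 0 \<le> x \<bullet> c"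
  proof (intro allI impI)
    fix c :: 'a assume "c \<odot> c = c"
    from idempotent_L_nonneg[OF this, of y] show "0 \<le> x \<bullet> c"
      unfolding x by (metis inner_commute jordan_commute jordan_inner)
  qed
next
  assume h: "\<forall>c. c \<odot> c = c \<longrightarrow> 0 \<le> x \<bullet> c"
  obtain r l c where x: "spectral_decomposition x r l c" using spectral_decomposition_exists by blast
  have "l i \<ge> 0" if "i \<in> {1..r}" for i
  proof -
    have "0 \<le> x \<bullet> c i" using h spectral_decomposition_simps(1)[OF x that] by blast
    then have "0 \<le> l i * (c i \<bullet> c i)" using spectral_value_inner[OF x that] by simp
    moreover have "0 < c i \<bullet> c i" using spectral_decomposition_simps(2)[OF x that] by simp
    ultimately show ?thesis by (simp add: zero_le_mult_iff)
  qed
  then have "x = jordan_fun sqrt x \<odot> jordan_fun sqrt x"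
    unfolding jordan_fun_times using jordan_fun_cong_decomposition[OF x, of "\<lambda>t. sqrt t * sqrt t" "\<lambda>t. t"] by simp
  then show "x \<in> {y \<odot> y | y. True}" by blast
qed

text \<open>As an intersection of half-spaces the set of squares is closed and convex.\<close>

lemma jordan_squares_eq:
  "{y \<odot> y | y. True} = (\<Inter>c\<in>{c. c \<odot> c = c}. {x :: 'a::euclidean_jordan_algebra. c \<bullet> x \<ge> 0})"
  by (rule set_eqI, subst jordan_square_iff) (auto simp: inner_commute)

lemma closed_jordan_squares: "closed {y \<odot> y | y :: 'a::euclidean_jordan_algebra. True}"
  unfolding jordan_squares_eq by (intro closed_INT ballI closed_halfspace_ge)

lemma convex_jordan_squares: "convex {y \<odot> y | y :: 'a::euclidean_jordan_algebra. True}"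
  unfolding jordan_squares_eq by (intro convex_INT convex_halfspace_ge)

lemma open_symmetric_cone: "open symmetric_cone"
  unfolding symmetric_cone_def by simp

lemma convex_symmetric_cone: "convex symmetric_cone"
  unfolding symmetric_cone_def by (intro convex_interior convex_jordan_squares)

lemma symmetric_cone_subset_squares: "symmetric_cone \<subseteq> {y \<odot> y | y. True}"
  unfolding symmetric_cone_def by (rule interior_subset)

text \<open>The lower bound for the norm of idempotents gives a ball around \<open>x\<close> on which the pairing with every idempotent
  stays nonnegative.\<close>

lemma symmetric_cone_marginI:
  fixes x :: "'a::euclidean_jordan_algebra"
  assumes m: "m > 0" and sq: "x - m *\<^sub>R jordan_unit \<in> {y \<odot> y | y. True}"
  shows "x \<in> symmetric_cone"
proof -
  define K where "K = jordan_bound TYPE('a)"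
  have K: "K > 0" unfolding K_def by (rule jordan_bound)
  have "ball x (m / K) \<subseteq> {y \<odot> y | y. True}"
  proof
    fix y assume "y \<in> ball x (m / K)"
    then have "norm (x - y) < m / K" by (simp add: dist_norm)
    then have y: "norm (x - y) * K < m" using K by (simp add: field_simps)
    have "0 \<le> y \<bullet> d" if d: "d \<odot> d = d" for d
    proof (cases "d = 0")
      case False
      have "1 \<le> norm d * K" unfolding K_def by (rule idempotent_norm_ge[OF d False])
      then have "norm (x - y) * 1 \<le> norm (x - y) * (norm d * K)" by (intro mult_left_mono) auto
      also have "\<dots> = (norm (x - y) * K) * norm d" by simp
      also have "\<dots> \<le> m * norm d" using y by (intro mult_right_mono) auto
      finally have "norm (x - y) * norm d \<le> m * norm d * norm d" by (intro mult_right_mono) auto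
      then have 1: "norm (x - y) * norm d \<le> m * (d \<bullet> d)"
        by (simp add: dot_square_norm power2_eq_square)
      have "0 \<le> (x - m *\<^sub>R jordan_unit) \<bullet> d" using sq d unfolding jordan_square_iff by blast
      then have "m * (d \<bullet> d) \<le> x \<bullet> d"
        using idempotent_inner_unit[OF d] by (simp add: inner_diff_left inner_commute[of jordan_unit])
      moreover have "\<bar>(x - y) \<bullet> d\<bar> \<le> norm (x - y) * norm d" by (rule Cauchy_Schwarz_ineq2)
      ultimately show ?thesis using 1 by (simp add: inner_diff_left)
    qed simp
    then show "y \<in> {y \<odot> y | y. True}" unfolding jordan_square_iff by blast
  qed
  moreover have "m / K > 0" using m K by simp
  ultimately show ?thesis unfolding symmetric_cone_def mem_interior by blast
qed

lemma jordan_fun_square: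
  fixes x :: "'a::euclidean_jordan_algebra"
  assumes "spectral_decomposition x r l c" "\<And>i. i \<in> {1..r} \<Longrightarrow> g (l i) \<ge> 0"
  shows "jordan_fun g x \<in> {y \<odot> y | y. True}"
proof -
  have "jordan_fun g x = jordan_fun (\<lambda>t. sqrt (g t)) x \<odot> jordan_fun (\<lambda>t. sqrt (g t)) x"
    unfolding jordan_fun_times using assms(2) by (intro jordan_fun_cong_decomposition[OF assms(1)]) simp
  then show ?thesis by blast
qed

lemma symmetric_cone_spectral_pos:
  fixes x :: "'a::euclidean_jordan_algebra"
  assumes x: "spectral_decomposition x r l c" and "x \<in> symmetric_cone" and i: "i \<in> {1..r}"
  shows "l i > 0"
proof -
  obtain e where e: "e > 0" "ball x e \<subseteq> {y \<odot> y | y. True}"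
    using assms(2) unfolding symmetric_cone_def mem_interior by blast
  have n0: "norm (c i) > 0" using spectral_decomposition_simps(2)[OF x i] by simp
  define s where "s = e / (2 * norm (c i))"
  have s: "s > 0" unfolding s_def using e n0 by simp
  have "x - s *\<^sub>R c i \<in> ball x e" unfolding s_def using e n0 by (simp add: dist_norm)
  then have "0 \<le> (x - s *\<^sub>R c i) \<bullet> c i"
    using e(2) spectral_decomposition_simps(1)[OF x i] jordan_square_iff by blast
  then have "s * (c i \<bullet> c i) \<le> l i * (c i \<bullet> c i)"
    using spectral_value_inner[OF x i] by (simp add: inner_diff_left)
  moreover have "c i \<bullet> c i > 0" using n0 by simp
  ultimately show ?thesis using s by simp
qed

lemma symmetric_cone_margin:
  fixes x :: "'a::euclidean_jordan_algebra"
  assumes "spectral_decomposition x r l c" "\<And>i. i \<in> {1..r} \<Longrightarrow> m \<le> l i"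
  shows "x - m *\<^sub>R jordan_unit \<in> {y \<odot> y | y. True}"
  using jordan_fun_square[OF assms(1), of "\<lambda>t. t - m"] assms(2) by (simp add: jordan_fun_diff)

lemma symmetric_coneI:
  fixes x :: "'a::euclidean_jordan_algebra"
  assumes x: "spectral_decomposition x r l c" and pos: "\<And>i. i \<in> {1..r} \<Longrightarrow> l i > 0"
  shows "x \<in> symmetric_cone"
proof -
  define m where "m = Min (insert 1 (l ` {1..r}))"
  have "m > 0" unfolding m_def using pos by (subst Min_gr_iff) auto
  moreover have "m \<le> l i" if "i \<in> {1..r}" for i unfolding m_def using that by (intro Min_le) auto
  ultimately show ?thesis using symmetric_cone_marginI symmetric_cone_margin[OF x] by blast
qed

lemma symmetric_cone_jordan_fun:
  fixes x :: "'a::euclidean_jordan_algebra"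
  assumes "x \<in> symmetric_cone" "\<And>t. t > 0 \<Longrightarrow> g t > 0"
  shows "jordan_fun g x \<in> symmetric_cone"
proof -
  obtain r l c where x: "spectral_decomposition x r l c" using spectral_decomposition_exists by blast
  show ?thesis
    using symmetric_coneI[OF spectral_decomposition_fun[OF x]] symmetric_cone_spectral_pos[OF x assms(1)] assms(2)
    by simp
qed

lemma jordan_fun_cong_cone:
  fixes x :: "'a::euclidean_jordan_algebra"
  assumes "x \<in> symmetric_cone" "\<And>t. t > 0 \<Longrightarrow> g t = h t"
  shows "jordan_fun g x = jordan_fun h x"
proof -
  obtain r l c where x: "spectral_decomposition x r l c" using spectral_decomposition_exists by blast
  show ?thesis
    using jordan_fun_cong_decomposition[OF x] symmetric_cone_spectral_pos[OF x assms(1)] assms(2) by blast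
qed

lemma jordan_unit_cone: "jordan_unit \<in> symmetric_cone"
proof -
  have "(jordan_unit :: 'a::euclidean_jordan_algebra) - 1 *\<^sub>R jordan_unit = 0 \<odot> 0"
    by (simp add: jt.zero_left)
  then show ?thesis using symmetric_cone_marginI[of 1 jordan_unit] by auto
qed

lemma jordan_exp_cone: "jordan_fun exp x \<in> symmetric_cone"
proof -
  obtain r l c where x: "spectral_decomposition x r l c" using spectral_decomposition_exists by blast
  show ?thesis using symmetric_coneI[OF spectral_decomposition_fun[OF x]] by simp
qed

lemma jordan_ln_exp [simp]: "jordan_fun ln (jordan_fun exp x) = x"
  by (simp add: jordan_fun_compose)

lemma jordan_exp_ln [simp]: "x \<in> symmetric_cone \<Longrightarrow> jordan_fun exp (jordan_fun ln x) = x"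
  using jordan_fun_cong_cone[of x "\<lambda>t. exp (ln t)" "\<lambda>t. t"] by (simp add: jordan_fun_compose)

lemma jordan_powr_cone [intro]: "x \<in> symmetric_cone \<Longrightarrow> jordan_powr x a \<in> symmetric_cone"
  unfolding jordan_powr_fun by (rule symmetric_cone_jordan_fun) auto

lemma jordan_powr_powr: "jordan_powr (jordan_powr x a) b = jordan_powr x (a * b)"
  unfolding jordan_powr_fun jordan_fun_compose by (simp add: powr_powr)

lemma jordan_powr_1 [simp]: "x \<in> symmetric_cone \<Longrightarrow> jordan_powr x 1 = x"
  using jordan_fun_cong_cone[of x "\<lambda>t. t powr 1" "\<lambda>t. t"] by (simp add: jordan_powr_fun)

lemma jordan_powr_0 [simp]: "x \<in> symmetric_cone \<Longrightarrow> jordan_powr x 0 = jordan_unit"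
  using jordan_fun_cong_cone[of x "\<lambda>t. t powr 0" "\<lambda>t. 1"] by (simp add: jordan_powr_fun)

lemma jordan_powr_times: "jordan_powr x a \<odot> jordan_powr x b = jordan_powr x (a + b)"
  unfolding jordan_powr_fun jordan_fun_times by (simp add: powr_add)

lemma jordan_powr_unit [simp]: "jordan_powr jordan_unit a = (jordan_unit :: 'a::euclidean_jordan_algebra)"
proof -
  have "jordan_powr (jordan_powr (jordan_unit :: 'a) 0) a = jordan_powr jordan_unit 0"
    unfolding jordan_powr_powr by simp
  then show ?thesis by (simp add: jordan_unit_cone)
qed

lemma jordan_ln_powr:
  assumes "x \<in> symmetric_cone"
  shows "jordan_fun ln (jordan_powr x a) = a *\<^sub>R jordan_fun ln x"
  unfolding jordan_powr_fun jordan_fun_compose jordan_fun_scale[symmetric]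
  by (rule jordan_fun_cong_cone[OF assms]) (simp add: ln_powr)

lemma jordan_exp_powr:
  "jordan_powr (jordan_fun exp u) a = jordan_fun exp (a *\<^sub>R u)"
proof -
  have "jordan_fun exp (a *\<^sub>R u) = jordan_fun exp (jordan_fun (\<lambda>t. a * t) u)"
    using jordan_fun_scale[of a "\<lambda>t. t" u] by simp
  then show ?thesis unfolding jordan_powr_fun jordan_fun_compose by (simp add: powr_def)
qed

lemma jordan_P_powr: "jordan_P (jordan_powr x a) (jordan_powr x b) = jordan_powr x (2 * a + b)"
  unfolding jordan_P_eq jordan_powr_times by (simp add: scaleR_2 add_ac)

lemma jordan_P_L_commute:
  fixes x z :: "'a::euclidean_jordan_algebra"
  shows "jordan_P (jordan_fun g x) (jordan_fun h x \<odot> z) = jordan_fun h x \<odot> jordan_P (jordan_fun g x) z"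
proof -
  have c: "jordan_fun g x \<odot> (jordan_fun h x \<odot> z) = jordan_fun h x \<odot> (jordan_fun g x \<odot> z)" for g z
    by (rule jordan_fun_L_commute)
  show ?thesis unfolding jordan_P_eq jordan_fun_times c by (simp add: jt_simps)
qed

lemma jordan_P_P_commute:
  fixes x z :: "'a::euclidean_jordan_algebra"
  shows "jordan_P (jordan_fun g x) (jordan_P (jordan_fun h x) z) = jordan_P (jordan_fun h x) (jordan_P (jordan_fun g x) z)"
proof -
  have c: "jordan_P (jordan_fun g x) (jordan_fun h x \<odot> z) = jordan_fun h x \<odot> jordan_P (jordan_fun g x) z" for h z
    by (rule jordan_P_L_commute)
  show ?thesis
    unfolding jordan_P_eq[of "jordan_fun h x"] jordan_fun_times
      linear_diff[OF linear_jordan_P] linear_scale[OF linear_jordan_P] c ..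
qed

section \<open>The fundamental formula\<close>

lemma has_vector_derivative_jordan_P:
  fixes X k :: "real \<Rightarrow> 'a::euclidean_jordan_algebra"
  assumes X: "(X has_vector_derivative X') (at t)" and k: "(k has_vector_derivative k') (at t)"
  shows "((\<lambda>s. jordan_P (X s) (k s)) has_vector_derivative
    (2 *\<^sub>R jordan_P2 (X t) X' (k t) + jordan_P (X t) k')) (at t)"
proof -
  have 1: "((\<lambda>s. X s \<odot> k s) has_vector_derivative X t \<odot> k' + X' \<odot> k t) (at t)"
    by (rule jt.has_vector_derivative[OF X k])
  have 2: "((\<lambda>s. X s \<odot> (X s \<odot> k s)) has_vector_derivative
      X t \<odot> (X t \<odot> k' + X' \<odot> k t) + X' \<odot> (X t \<odot> k t)) (at t)"
    by (rule jt.has_vector_derivative[OF X 1])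
  have 3: "((\<lambda>s. X s \<odot> X s) has_vector_derivative X t \<odot> X' + X' \<odot> X t) (at t)"
    by (rule jt.has_vector_derivative[OF X X])
  have 4: "((\<lambda>s. (X s \<odot> X s) \<odot> k s) has_vector_derivative
      (X t \<odot> X t) \<odot> k' + (X t \<odot> X' + X' \<odot> X t) \<odot> k t) (at t)"
    by (rule jt.has_vector_derivative[OF 3 k])
  have 5: "((\<lambda>s. 2 *\<^sub>R (X s \<odot> (X s \<odot> k s)) - (X s \<odot> X s) \<odot> k s) has_vector_derivative
      2 *\<^sub>R (X t \<odot> (X t \<odot> k' + X' \<odot> k t) + X' \<odot> (X t \<odot> k t)) -
      ((X t \<odot> X t) \<odot> k' + (X t \<odot> X' + X' \<odot> X t) \<odot> k t)) (at t)"
    by (intro has_vector_derivative_diff 4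
        bounded_linear.has_vector_derivative[OF bounded_linear_scaleR_right 2])
  have eq: "2 *\<^sub>R (X t \<odot> (X t \<odot> k' + X' \<odot> k t) + X' \<odot> (X t \<odot> k t)) -
      ((X t \<odot> X t) \<odot> k' + (X t \<odot> X' + X' \<odot> X t) \<odot> k t) =
     2 *\<^sub>R jordan_P2 (X t) X' (k t) + jordan_P (X t) k'"
    using jordan_commute[of X' "X t"] unfolding jordan_P2_def jordan_P_eq
    by (simp add: jt_simps algebra_simps scaleR_2)
  show ?thesis unfolding jordan_P_eq[abs_def] using 5 unfolding eq unfolding jordan_P_eq .
qed

lemma has_vector_derivative_jordan_powr:
  fixes g :: "'a::euclidean_jordan_algebra"
  assumes g: "g \<in> symmetric_cone"
  shows "((\<lambda>s. jordan_powr g (a * s)) has_vector_derivative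
    (a *\<^sub>R (jordan_fun ln g \<odot> jordan_powr g (a * t)))) (at t)"
proof -
  obtain r l c where x: "spectral_decomposition g r l c" using spectral_decomposition_exists by blast
  have pos: "l j > 0" if "j \<in> {1..r}" for j using symmetric_cone_spectral_pos[OF x g that] .
  have "((\<lambda>s. \<Sum>j=1..r. (l j powr (a * s)) *\<^sub>R c j) has_vector_derivative
     (\<Sum>j=1..r. (a * (ln (l j) * l j powr (a * t))) *\<^sub>R c j)) (at t)"
  proof (intro has_vector_derivative_sum)
    fix j assume j: "j \<in> {1..r}"
    have "((\<lambda>s. l j powr (a * s)) has_real_derivative (a * (ln (l j) * l j powr (a * t)))) (at t)"
      using pos[OF j] unfolding powr_def by (auto intro!: derivative_eq_intros)
    then show "((\<lambda>s. (l j powr (a * s)) *\<^sub>R c j) has_vector_derivative (a * (ln (l j) * l j powr (a * t))) *\<^sub>R c j) (at t)"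
      by (auto intro!: derivative_eq_intros)
  qed
  moreover have "(\<Sum>j=1..r. (a * (ln (l j) * l j powr (a * t))) *\<^sub>R c j) = a *\<^sub>R (jordan_fun ln g \<odot> jordan_powr g (a * t))"
    unfolding jordan_powr_fun jordan_fun_times unfolding jordan_fun_eq[OF x] by (simp add: scaleR_sum_right)
  ultimately show ?thesis unfolding jordan_powr_fun jordan_fun_eq[OF x] by simp
qed

text \<open>With \<open>u = log g\<close> the curve \<open>g\<^sup>t\<close> has the derivative \<open>u g\<^sup>t\<close>. Since \<open>L(u)\<close> commutes with \<open>P(g\<^sup>t)\<close>, the identity
  \<open>jordan_P2_L\<close> turns into the linear differential equation \<open>Q' = 2 L(u) Q\<close> for \<open>Q(t) = P(g\<^sup>t)\<close>.\<close>

lemma has_vector_derivative_P_powr: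
  fixes g :: "'a::euclidean_jordan_algebra"
  assumes g: "g \<in> symmetric_cone" and k: "(k has_vector_derivative k') (at t)"
  shows "((\<lambda>s. jordan_P (jordan_powr g (a * s)) (k s)) has_vector_derivative
    (2 * a) *\<^sub>R (jordan_fun ln g \<odot> jordan_P (jordan_powr g (a * t)) (k t)) + jordan_P (jordan_powr g (a * t)) k') (at t)"
proof -
  have "2 *\<^sub>R jordan_P2 (jordan_powr g (a * t)) (a *\<^sub>R (jordan_fun ln g \<odot> jordan_powr g (a * t))) (k t)
    = a *\<^sub>R (2 *\<^sub>R jordan_P2 (jordan_powr g (a * t)) (jordan_fun ln g \<odot> jordan_powr g (a * t)) (k t))"
    unfolding jordan_P2_def by (simp add: jt_simps algebra_simps)
  also have "\<dots> = (2 * a) *\<^sub>R (jordan_fun ln g \<odot> jordan_P (jordan_powr g (a * t)) (k t))"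
    unfolding jordan_P2_L unfolding jordan_powr_fun jordan_P_L_commute by (simp add: scaleR_2[symmetric] mult.commute)
  finally show ?thesis
    using has_vector_derivative_jordan_P[OF has_vector_derivative_jordan_powr[OF g] k] by metis
qed

lemma jordan_P_powr_inverse:
  fixes g :: "'a::euclidean_jordan_algebra"
  assumes g: "g \<in> symmetric_cone"
  shows "jordan_P (jordan_powr g a) (jordan_P (jordan_powr g (-a)) h) = h"
proof -
  define u where "u = jordan_fun ln g"
  define n where "n s = jordan_P (jordan_powr g (a * s)) (jordan_P (jordan_powr g (-a * s)) h)" for s
  have "(n has_vector_derivative 0) (at s)" for s
  proof -
    have 1: "((\<lambda>s. jordan_P (jordan_powr g (-a * s)) h) has_vector_derivative
      (2 * -a) *\<^sub>R (u \<odot> jordan_P (jordan_powr g (-a * s)) h) + jordan_P (jordan_powr g (-a * s)) 0) (at s)"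
      unfolding u_def by (rule has_vector_derivative_P_powr[OF g has_vector_derivative_const])
    show ?thesis
      using has_vector_derivative_P_powr[OF g 1, of a] unfolding n_def[abs_def]
      unfolding u_def linear_0[OF linear_jordan_P] jordan_powr_fun add_0_right
      unfolding linear_scale[OF linear_jordan_P] jordan_P_L_commute by simp
  qed
  then obtain c where "\<And>s. n s = c"
    using has_vector_derivative_zero_constant[of UNIV n] by auto
  then have "n 1 = n 0" by simp
  then show ?thesis unfolding n_def using g by simp
qed

text \<open>For \<open>Q(t) = P(g\<^sup>t)\<close> and \<open>u = log g\<close> the derivative of \<open>P(Q(t) x)\<close> is \<open>2 (L(u) P(Q(t) x) + P(Q(t) x) L(u))\<close> by \<open>jordan_P2_L\<close>.
  The operator \<open>Q(-t) P(Q(t) x) Q(-t)\<close> therefore does not depend on \<open>t\<close>; its values at \<open>0\<close> and \<open>1\<close> are compared.\<close>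

theorem jordan_fundamental_formula:
  fixes g :: "'a::euclidean_jordan_algebra"
  assumes g: "g \<in> symmetric_cone"
  shows "jordan_P (jordan_P g x) h = jordan_P g (jordan_P x (jordan_P g h))"
proof -
  define u where "u = jordan_fun ln g"
  have "jordan_P (jordan_powr g (-1)) (jordan_P (jordan_P (jordan_powr g 1) x) (jordan_P (jordan_powr g (-1)) h))
     = jordan_P x h" for h
  proof -
    define X where "X s = jordan_P (jordan_powr g (1 * s)) x" for s
    define k where "k s = jordan_P (jordan_powr g (-1 * s)) h" for s
    define m where "m s = jordan_P (X s) (k s)" for s
    define n where "n s = jordan_P (jordan_powr g (-1 * s)) (m s)" for s
    have "(n has_vector_derivative 0) (at s)" for s
    proof -
      have X: "(X has_vector_derivative (2 *\<^sub>R (u \<odot> X s))) (at s)"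
        using has_vector_derivative_P_powr[OF g has_vector_derivative_const[of x], of 1 s]
        unfolding u_def X_def[abs_def] linear_0[OF linear_jordan_P] by simp
      have k: "(k has_vector_derivative (- 2 *\<^sub>R (u \<odot> k s))) (at s)"
        using has_vector_derivative_P_powr[OF g has_vector_derivative_const[of h], of "-1" s]
        unfolding u_def k_def[abs_def] linear_0[OF linear_jordan_P] by simp
      have "2 *\<^sub>R jordan_P2 (X s) (2 *\<^sub>R (u \<odot> X s)) (k s) + jordan_P (X s) (- 2 *\<^sub>R (u \<odot> k s))
        = 2 *\<^sub>R (2 *\<^sub>R jordan_P2 (X s) (u \<odot> X s) (k s)) - 2 *\<^sub>R jordan_P (X s) (u \<odot> k s)"
        unfolding linear_scale[OF linear_jordan_P] jordan_P2_def by (simp add: jt_simps algebra_simps)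
      also have "\<dots> = 2 *\<^sub>R (u \<odot> m s)"
        unfolding jordan_P2_L m_def by (simp add: scaleR_add_right)
      finally have m: "(m has_vector_derivative (2 *\<^sub>R (u \<odot> m s))) (at s)"
        using has_vector_derivative_jordan_P[OF X k] unfolding m_def[abs_def] by simp
      show ?thesis
        using has_vector_derivative_P_powr[OF g m, of "-1"] unfolding n_def[abs_def]
        unfolding u_def jordan_powr_fun linear_scale[OF linear_jordan_P] jordan_P_L_commute by simp
    qed
    then obtain c where "\<And>s. n s = c"
      using has_vector_derivative_zero_constant[of UNIV n] by auto
    then have "n 1 = n 0" by simp
    then show ?thesis unfolding n_def m_def X_def k_def using g by simp
  qed
  from this[of "jordan_P g h"]
  have "jordan_P (jordan_powr g (-1)) (jordan_P (jordan_P g x) h) = jordan_P x (jordan_P g h)"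
    using jordan_P_powr_inverse[OF g, of "-1"] g by simp
  then show ?thesis
    using jordan_P_powr_inverse[OF g, of 1 "jordan_P (jordan_P g x) h"] g by simp
qed

lemma jordan_P_inverse:
  fixes g :: "'a::euclidean_jordan_algebra"
  assumes g: "g \<in> symmetric_cone"
  shows "jordan_P g (jordan_P (jordan_powr g (-1)) h) = h" "jordan_P (jordan_powr g (-1)) (jordan_P g h) = h"
  using jordan_P_powr_inverse[OF g, of 1 h] jordan_P_powr_inverse[OF g, of "-1" h] g by simp_all

lemma jordan_P_injective:
  "g \<in> symmetric_cone \<Longrightarrow> jordan_P g x = jordan_P g y \<Longrightarrow> x = y"
  by (metis jordan_P_inverse(2))

lemma jordan_P_powr_add:
  fixes g :: "'a::euclidean_jordan_algebra"
  assumes g: "g \<in> symmetric_cone"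
  shows "jordan_P (jordan_powr g a) (jordan_P (jordan_powr g b) h) = jordan_P (jordan_powr g (a + b)) h"
proof -
  have y: "jordan_powr g (a/2) \<in> symmetric_cone" using g by blast
  have 0: "jordan_P (jordan_powr g a) h = jordan_P (jordan_powr g (a/2)) (jordan_P (jordan_powr g (a/2)) h)" for h
    using jordan_fundamental_formula[OF y, of jordan_unit h] by (simp add: jordan_powr_times)
  have "jordan_P (jordan_powr g (a + b)) h = jordan_P (jordan_powr g (a/2)) (jordan_P (jordan_powr g b) (jordan_P (jordan_powr g (a/2)) h))"
    using jordan_fundamental_formula[OF y, of "jordan_powr g b" h] by (simp add: jordan_P_powr)
  also have "\<dots> = jordan_P (jordan_powr g a) (jordan_P (jordan_powr g b) h)"
    unfolding 0[of "jordan_P (jordan_powr g b) h"] unfolding jordan_powr_fun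
    by (simp only: jordan_P_P_commute[of "\<lambda>t. t powr b"])
  finally show ?thesis by simp
qed

lemma continuous_on_jordan_P: "continuous_on S (jordan_P x)"
  using linear_jordan_P by (intro linear_continuous_on) (simp add: linear_conv_bounded_linear)

text \<open>At a boundary point \<open>w\<close> of the cone \<open>P(w)\<close> has a kernel, whereas \<open>P(P(g) y) = P(g) P(y) P(g)\<close> is
  injective. So the connected set \<open>P(g) \<Omega>\<close>, which contains the point \<open>g\<^sup>2\<close> of the cone, does not meet the
  boundary and stays in the cone.\<close>

theorem jordan_P_cone:
  fixes g :: "'a::euclidean_jordan_algebra"
  assumes g: "g \<in> symmetric_cone" and y: "y \<in> symmetric_cone"
  shows "jordan_P g y \<in> symmetric_cone"
proof -
  let ?\<Omega> = "symmetric_cone :: 'a set"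
  let ?S = "{y \<odot> y | y :: 'a. True}"
  define A where "A = jordan_P g -` ?\<Omega>"
  define B where "B = jordan_P g -` (- ?S)"
  have oA: "open A" unfolding A_def
    using open_symmetric_cone continuous_on_jordan_P[of UNIV] by (intro open_vimage) auto
  have oB: "open B" unfolding B_def
    using closed_jordan_squares continuous_on_jordan_P[of UNIV] by (intro open_vimage) auto
  have AB: "A \<inter> B \<inter> ?\<Omega> = {}" using symmetric_cone_subset_squares unfolding A_def B_def by blast
  have cover: "?\<Omega> \<subseteq> A \<union> B"
  proof (rule ccontr)
    assume "\<not> ?\<Omega> \<subseteq> A \<union> B"
    then obtain z where z: "z \<in> ?\<Omega>" "jordan_P g z \<notin> ?\<Omega>" "jordan_P g z \<in> ?S"
      unfolding A_def B_def by blast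
    define w where "w = jordan_P g z"
    obtain r l c where w: "spectral_decomposition w r l c" using spectral_decomposition_exists by blast
    obtain i where i: "i \<in> {1..r}" "l i \<le> 0"
      using symmetric_coneI[OF w] z(2) unfolding w_def by (meson not_le)
    have "0 \<le> w \<bullet> c i" using z(3) spectral_decomposition_simps(1)[OF w i(1)] 
      unfolding w_def jordan_square_iff by blast
    then have "0 \<le> l i * (c i \<bullet> c i)" using spectral_value_inner[OF w i(1)] by simp
    moreover have "c i \<bullet> c i > 0" using spectral_decomposition_simps(2)[OF w i(1)] by simp
    ultimately have "l i = 0" using i(2) by (simp add: zero_le_mult_iff)
    then have "w \<odot> c i = 0"
      using spectral_decomposition_times[OF w i(1), of l] spectral_decomposition_simps(6)[OF w] by simp
    moreover have "(w \<odot> w) \<odot> c i = 0"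
    proof -
      have "w \<odot> w = (\<Sum>j=1..r. (l j * l j) *\<^sub>R c j)"
        using jordan_fun_times[of "\<lambda>t. t" w "\<lambda>t. t"] jordan_fun_eq[OF w, of "\<lambda>t. t * t"] by simp
      then show ?thesis using spectral_decomposition_times[OF w i(1), of "\<lambda>j. l j * l j"] \<open>l i = 0\<close> by simp
    qed
    ultimately have "jordan_P w (c i) = 0" unfolding jordan_P_eq by (simp add: jt.zero_right)
    then have "jordan_P g (jordan_P z (jordan_P g (c i))) = 0"
      unfolding w_def jordan_fundamental_formula[OF g] .
    then have "c i = 0"
      using jordan_P_injective[OF g] jordan_P_injective[OF z(1)] linear_0[OF linear_jordan_P] by metis
    then show False using spectral_decomposition_simps(2)[OF w i(1)] by simp
  qed
  have "g \<odot> g \<in> ?\<Omega>" using jordan_powr_times[of g 1 1] jordan_powr_cone[OF g, of "1 + 1"] g by simp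
  then have "jordan_unit \<in> A \<inter> ?\<Omega>" unfolding A_def using jordan_unit_cone by simp
  moreover have "A \<inter> ?\<Omega> = {} \<or> B \<inter> ?\<Omega> = {}"
    using connectedD[OF convex_connected[OF convex_symmetric_cone] oA oB AB cover] .
  ultimately show ?thesis using cover y unfolding A_def by blast
qed

lemma jordan_P_powr_neg1: "w \<in> symmetric_cone \<Longrightarrow> jordan_P w (jordan_powr w (-1)) = w"
  using jordan_P_powr[of w 1 "-1"] by simp

lemma jordan_inverse_unique:
  "w \<in> symmetric_cone \<Longrightarrow> jordan_P w y = w \<Longrightarrow> y = jordan_powr w (-1)"
  using jordan_P_injective jordan_P_powr_neg1 by metis

lemma jordan_powr_neg1_P:
  fixes g :: "'a::euclidean_jordan_algebra"
  assumes g: "g \<in> symmetric_cone" and y: "y \<in> symmetric_cone"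
  shows "jordan_powr (jordan_P g y) (-1) = jordan_P (jordan_powr g (-1)) (jordan_powr y (-1))"
  using jordan_P_cone[OF g y]
  by (intro jordan_inverse_unique[symmetric])
    (simp_all add: jordan_fundamental_formula[OF g] jordan_P_inverse[OF g] jordan_P_powr_neg1 y)

section \<open>Automorphisms and the invariance of the distance\<close>

lemma jordan_automorphism_unit:
  fixes k :: "'a::euclidean_jordan_algebra \<Rightarrow> 'a"
  assumes "surj k" "\<And>x y. k (x \<odot> y) = k x \<odot> k y"
  shows "k jordan_unit = jordan_unit"
proof -
  obtain y where "k y = jordan_unit" using assms(1) by (metis surjD)
  then show ?thesis using assms(2)[of jordan_unit y] by (metis jordan_unit jordan_unit_right)
qed

lemma jordan_automorphism_spectral_decomposition:
  fixes k :: "'a::euclidean_jordan_algebra \<Rightarrow> 'a"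
  assumes k: "linear k" "bij k" "\<And>x y. k (x \<odot> y) = k x \<odot> k y"
    and x: "spectral_decomposition x r l c"
  shows "spectral_decomposition (k x) r l (k \<circ> c)"
proof -
  have inj: "k u = k v \<longleftrightarrow> u = v" for u v using k(2) by (auto simp: bij_def inj_eq)
  have k0: "k 0 = 0" using linear_0[OF k(1)] .
  have prim: "primitive_idempotent (k p)" if p: "primitive_idempotent p" for p
    unfolding primitive_idempotent_def
  proof (intro conjI notI)
    show "jordan_idempotent (k p)" using p k(3)[of p p]
      unfolding primitive_idempotent_def jordan_idempotent_def by simp
    show "k p = 0 \<Longrightarrow> False" using p inj[of p 0] k0 unfolding primitive_idempotent_def by simp
    assume "\<exists>u v. jordan_idempotent u \<and> jordan_idempotent v \<and> u \<noteq> 0 \<and> v \<noteq> 0 \<and> k p = u + v"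
    then obtain u v where uv: "u \<odot> u = u" "v \<odot> v = v" "u \<noteq> 0" "v \<noteq> 0" "k p = u + v"
      unfolding jordan_idempotent_def by blast
    obtain u' v' where uv': "u = k u'" "v = k v'" using k(2) by (metis bij_pointE)
    have "u' \<odot> u' = u'" "v' \<odot> v' = v'" "u' \<noteq> 0" "v' \<noteq> 0" "p = u' + v'"
      using uv k0 linear_add[OF k(1), of u' v'] inj[of p "u' + v'"] unfolding uv' k(3)[symmetric] by (auto simp: inj)
    then show False using p unfolding primitive_idempotent_def jordan_idempotent_def by blast
  qed
  note s = spectral_decomposition_simps[OF x]
  have "k x = (\<Sum>j = 1..r. l j *\<^sub>R k (c j))"
    by (subst s(6)) (simp add: linear_sum[OF k(1)] linear_scale[OF k(1)])
  moreover have "(\<Sum>j = 1..r. k (c j)) = jordan_unit"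
    using linear_sum[OF k(1), of c "{1..r}"] s(5) jordan_automorphism_unit[of k] k by (simp add: bij_is_surj)
  moreover have "k (c i) \<odot> k (c j) = 0" if "i \<in> {1..r}" "j \<in> {1..r}" "i \<noteq> j" for i j
    using s(3)[OF that] k(3) k0 by metis
  ultimately show ?thesis
    unfolding spectral_decomposition_def jordan_frame_def using prim s(4) by simp
qed

lemma jordan_automorphism_fun:
  fixes k :: "'a::euclidean_jordan_algebra \<Rightarrow> 'a"
  assumes k: "linear k" "bij k" "\<And>x y. k (x \<odot> y) = k x \<odot> k y"
  shows "jordan_fun g (k x) = k (jordan_fun g x)"
proof -
  obtain r l c where x: "spectral_decomposition x r l c" using spectral_decomposition_exists by blast
  show ?thesis
    using jordan_fun_eq[OF jordan_automorphism_spectral_decomposition[OF k x]] jordan_fun_eq[OF x]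
    by (simp add: linear_sum[OF k(1)] linear_scale[OF k(1)])
qed

text \<open>The distance of the cone with the given norm in place of the trace norm. The two differ by a constant factor
  when the algebra is simple, and this one is free of multiplicities.\<close>

definition log_dist :: "'a::euclidean_jordan_algebra \<Rightarrow> 'a \<Rightarrow> real" where
  "log_dist a b = norm (jordan_fun ln (jordan_P (jordan_powr a (- (1/2))) b))"

lemma cone_dist_eq:
  fixes a b :: "'a::simple_euclidean_jordan_algebra"
  shows "(cone_dist a b)\<^sup>2 = (log_dist a b)\<^sup>2 / primitive_norm_sq TYPE('a)"
  unfolding cone_dist_def spectral_values_ln_sq log_dist_def
  using primitive_norm_sq_pos[where 'a='a] by simp

text \<open>The map \<open>k = P(w\<^sup>-\<^sup>1\<^sup>/\<^sup>2) P(g) P(a\<^sup>1\<^sup>/\<^sup>2)\<close> with \<open>w = P(g) a\<close> fixes the unit, and \<open>P(k x) = k P(x) k\<^sup>*\<close> by the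
  fundamental formula. For \<open>x = e\<close> this says that \<open>k\<close> is orthogonal, and applied to \<open>e\<close> it says
  \<open>(k x)\<^sup>2 = k (x\<^sup>2)\<close>, so \<open>k\<close> is an automorphism. It takes \<open>P(a\<^sup>-\<^sup>1\<^sup>/\<^sup>2) b\<close> to \<open>P(w\<^sup>-\<^sup>1\<^sup>/\<^sup>2) P(g) b\<close>.\<close>

lemma log_dist_P:
  fixes a b g :: "'a::euclidean_jordan_algebra"
  assumes g: "g \<in> symmetric_cone" and a: "a \<in> symmetric_cone"
  shows "log_dist (jordan_P g a) (jordan_P g b) = log_dist a b"
proof -
  define w where "w = jordan_P g a"
  have w: "w \<in> symmetric_cone" unfolding w_def by (rule jordan_P_cone[OF g a])
  define A where "A = jordan_powr a (1/2)"
  define W where "W = jordan_powr w (-(1/2))"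
  have AW: "A \<in> symmetric_cone" "W \<in> symmetric_cone" unfolding A_def W_def using a w by auto
  define k where "k h = jordan_P W (jordan_P g (jordan_P A h))" for h
  define k' where "k' h = jordan_P A (jordan_P g (jordan_P W h))" for h
  have lin: "linear k" unfolding k_def[abs_def]
    using linear_compose[OF linear_compose[OF linear_jordan_P linear_jordan_P] linear_jordan_P, of W g A]
    by (simp add: comp_def)
  have "jordan_P A jordan_unit = a" unfolding A_def using a by (simp add: jordan_powr_times)
  then have ke: "k jordan_unit = jordan_unit" unfolding k_def W_def
    using jordan_P_powr[of w "-(1/2)" 1] w by (simp add: w_def[symmetric])
  have Pk: "jordan_P (k x) h = k (jordan_P x (k' h))" for x h
    unfolding k_def k'_def jordan_fundamental_formula[OF AW(2)] jordan_fundamental_formula[OF g]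
      jordan_fundamental_formula[OF AW(1)] ..
  have kk': "k (k' h) = h" for h using Pk[of jordan_unit h] ke by simp
  have "surj k" using kk' by (metis surjI)
  then have "inj k" using linear_surjective_imp_injective[OF lin] by simp
  then have bij: "bij k" using \<open>surj k\<close> by (simp add: bij_def)
  have k'k: "k' (k h) = h" for h using kk'[of "k h"] \<open>inj k\<close> by (simp add: inj_eq)
  have sq: "k x \<odot> k x = k (x \<odot> x)" for x
    using Pk[of x jordan_unit] k'k[of jordan_unit] ke by simp
  have mult: "k (x \<odot> y) = k x \<odot> k y" for x y
  proof -
    have "k ((x + y) \<odot> (x + y)) = k (x + y) \<odot> k (x + y)" by (rule sq[symmetric])
    then have "2 *\<^sub>R k (x \<odot> y) = 2 *\<^sub>R (k x \<odot> k y)"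
      using jordan_commute[of y x] jordan_commute[of "k y" "k x"] sq[of x] sq[of y]
      by (simp add: jt_simps linear_add[OF lin] scaleR_2)
    then show ?thesis by simp
  qed
  have adj: "k x \<bullet> y = x \<bullet> k' y" for x y unfolding k_def k'_def by (simp add: jordan_P_symmetric)
  have nrm: "norm (k x) = norm x" for x unfolding norm_eq_sqrt_inner adj k'k ..
  have "jordan_P W (jordan_P g b) = k (jordan_P (jordan_powr a (-(1/2))) b)"
    unfolding k_def A_def using jordan_P_powr_inverse[OF a, of "1/2" b] by simp
  then show ?thesis
    unfolding log_dist_def w_def[symmetric] W_def[symmetric]
    by (simp add: jordan_automorphism_fun[OF lin bij mult] nrm)
qed

text \<open>Moving \<open>a\<close> to the unit by an isometry reduces the claim to \<open>|log y| = |log y\<^sup>-\<^sup>1|\<close>.\<close>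

lemma log_dist_commute:
  fixes a b :: "'a::euclidean_jordan_algebra"
  assumes a: "a \<in> symmetric_cone" and b: "b \<in> symmetric_cone"
  shows "log_dist a b = log_dist b a"
proof -
  define g where "g = jordan_powr a (-(1/2))"
  define y where "y = jordan_P g b"
  have g: "g \<in> symmetric_cone" unfolding g_def using a by blast
  have y: "y \<in> symmetric_cone" unfolding y_def using g b by (rule jordan_P_cone)
  have "jordan_P g a = jordan_unit" unfolding g_def using jordan_P_powr[of a "-(1/2)" 1] a by simp
  then have "log_dist b a = log_dist y jordan_unit" unfolding y_def using log_dist_P[OF g b, of a] by simp
  also have "\<dots> = norm (jordan_fun ln (jordan_powr y (-1)))"
    unfolding log_dist_def by (simp add: jordan_powr_times)
  also have "\<dots> = norm (jordan_fun ln y)" by (simp add: jordan_ln_powr[OF y])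
  also have "\<dots> = log_dist a b" unfolding y_def g_def log_dist_def ..
  finally show ?thesis by simp
qed

lemma log_dist_eq_0:
  fixes a b :: "'a::euclidean_jordan_algebra"
  assumes a: "a \<in> symmetric_cone" and b: "b \<in> symmetric_cone" and "log_dist a b = 0"
  shows "a = b"
proof -
  define g where "g = jordan_powr a (-(1/2))"
  have g: "g \<in> symmetric_cone" unfolding g_def using a by blast
  have "jordan_fun ln (jordan_P g b) = 0" using assms(3) unfolding log_dist_def g_def by simp
  then have "jordan_P g b = jordan_fun exp 0" using jordan_exp_ln[OF jordan_P_cone[OF g b]] by simp
  also have "\<dots> = jordan_unit"
    using jordan_exp_powr[of "0::'a" 0] jordan_powr_0[OF jordan_exp_cone, of "0::'a"] by simp
  also have "\<dots> = jordan_P g a" unfolding g_def using jordan_P_powr[of a "-(1/2)" 1] a by simp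
  finally show ?thesis using jordan_P_injective[OF g] by metis
qed

section \<open>The exponential map increases distances\<close>

text \<open>A variance is nonnegative: for a spectral frame \<open>c\<^sub>j\<close> of \<open>b\<close> and \<open>k = b h\<close>, the sum of the numbers
  \<open>\<langle>c\<^sub>j (\<lambda>\<^sub>j h - k), \<lambda>\<^sub>j h - k\<rangle> \<ge> 0\<close> is \<open>\<langle>b\<^sup>2 h, h\<rangle> - |k|\<^sup>2\<close>.\<close>

lemma jordan_L_square_ge:
  fixes b h :: "'a::euclidean_jordan_algebra"
  shows "(b \<odot> h) \<bullet> (b \<odot> h) \<le> ((b \<odot> b) \<odot> h) \<bullet> h"
proof -
  obtain r l c where x: "spectral_decomposition b r l c" using spectral_decomposition_exists by blast
  note s = spectral_decomposition_simps[OF x]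
  define k where "k = b \<odot> h"
  have b: "b \<odot> v = (\<Sum>j=1..r. l j *\<^sub>R (c j \<odot> v))" for v
    by (subst s(6)) (simp add: jt.sum_left jt_simps)
  have bb: "(b \<odot> b) \<odot> v = (\<Sum>j=1..r. (l j * l j) *\<^sub>R (c j \<odot> v))" for v
    using jordan_fun_times[of "\<lambda>t. t" b "\<lambda>t. t"] jordan_fun_eq[OF x, of "\<lambda>t. t * t"]
    by (simp add: jt.sum_left jt_simps)
  have e: "v = (\<Sum>j=1..r. c j \<odot> v)" for v
    using s(5) jordan_unit[of v] by (simp add: jt.sum_left[symmetric])
  have "0 \<le> (\<Sum>j=1..r. (c j \<odot> (l j *\<^sub>R h - k)) \<bullet> (l j *\<^sub>R h - k))"
    using s(1) by (intro sum_nonneg idempotent_L_nonneg) auto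
  also have "\<dots> = (\<Sum>j=1..r. ((l j * l j) *\<^sub>R (c j \<odot> h)) \<bullet> h - (l j *\<^sub>R (c j \<odot> h)) \<bullet> k
      - (l j *\<^sub>R (c j \<odot> h)) \<bullet> k + (c j \<odot> k) \<bullet> k)"
  proof (intro sum.cong refl)
    fix j
    have "(c j \<odot> k) \<bullet> h = (c j \<odot> h) \<bullet> k" by (metis inner_commute jordan_inner)
    then show "(c j \<odot> (l j *\<^sub>R h - k)) \<bullet> (l j *\<^sub>R h - k) = ((l j * l j) *\<^sub>R (c j \<odot> h)) \<bullet> h - (l j *\<^sub>R (c j \<odot> h)) \<bullet> k
      - (l j *\<^sub>R (c j \<odot> h)) \<bullet> k + (c j \<odot> k) \<bullet> k"
      by (simp add: jt_simps inner_diff_left inner_diff_right algebra_simps)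
  qed
  also have "\<dots> = ((b \<odot> b) \<odot> h) \<bullet> h - (b \<odot> h) \<bullet> k - (b \<odot> h) \<bullet> k + k \<bullet> k"
    unfolding sum.distrib sum_subtractf inner_sum_left[symmetric] b[symmetric] bb[symmetric] e[symmetric] ..
  finally show ?thesis unfolding k_def by simp
qed

lemma jordan_P_le_L:
  fixes b k :: "'a::euclidean_jordan_algebra"
  shows "jordan_P b k \<bullet> k \<le> ((b \<odot> b) \<odot> k) \<bullet> k"
proof -
  have "jordan_P b k \<bullet> k = 2 * ((b \<odot> k) \<bullet> (b \<odot> k)) - ((b \<odot> b) \<odot> k) \<bullet> k"
    unfolding jordan_P_eq by (simp add: inner_diff_left jordan_inner)
  then show ?thesis using jordan_L_square_ge[of b k] by simp
qed

lemma jordan_L_injective: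
  fixes x h :: "'a::euclidean_jordan_algebra"
  assumes "x \<in> symmetric_cone" "x \<odot> h = 0"
  shows "h = 0"
proof -
  obtain r l c where x: "spectral_decomposition x r l c" using spectral_decomposition_exists by blast
  note s = spectral_decomposition_simps[OF x]
  have pos: "l j > 0" if "j \<in> {1..r}" for j using symmetric_cone_spectral_pos[OF x assms(1) that] .
  have "(\<Sum>j=1..r. l j * ((c j \<odot> h) \<bullet> h)) = (x \<odot> h) \<bullet> h"
    by (subst s(6)) (simp add: jt.sum_left jt_simps inner_sum_left)
  then have "(\<Sum>j=1..r. l j * ((c j \<odot> h) \<bullet> h)) = 0" using assms(2) by simp
  moreover have nn: "0 \<le> l j * ((c j \<odot> h) \<bullet> h)" if "j \<in> {1..r}" for j
    using pos[OF that] idempotent_L_nonneg[OF s(1)[OF that], of h] by simp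
  ultimately have "l j * ((c j \<odot> h) \<bullet> h) = 0" if "j \<in> {1..r}" for j
    using that by (subst (asm) sum_nonneg_eq_0_iff) auto
  then have z: "(c j \<odot> h) \<bullet> h = 0" if "j \<in> {1..r}" for j using that pos[OF that] by force
  have "h \<bullet> h = (\<Sum>j=1..r. (c j \<odot> h) \<bullet> h)"
    using s(5) jordan_unit[of h] by (simp add: jt.sum_left[symmetric] inner_sum_left[symmetric])
  also have "\<dots> = 0" using z by simp
  finally show ?thesis by simp
qed

text \<open>By the inverse function theorem: the derivative of \<open>x \<mapsto> x\<^sup>2\<close> is \<open>2 L(x)\<close>, which is invertible for \<open>x\<close> in
  the cone.\<close>

lemma jordan_sqrt_has_derivative:
  fixes y :: "'a::euclidean_jordan_algebra"
  assumes y: "y \<in> symmetric_cone"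
  obtains G where "((\<lambda>x. jordan_powr x (1/2)) has_derivative G) (at y)"
    "\<And>h. 2 *\<^sub>R (jordan_powr y (1/2) \<odot> G h) = h"
proof -
  define x where "x = jordan_powr y (1/2)"
  have x: "x \<in> symmetric_cone" unfolding x_def using y by blast
  have xx: "x \<odot> x = y" unfolding x_def jordan_powr_times using y by simp
  define f' where "f' h = x \<odot> h + h \<odot> x" for h
  have f'2: "f' h = 2 *\<^sub>R (x \<odot> h)" for h unfolding f'_def by (simp add: scaleR_2 jordan_commute)
  have lin: "linear f'" unfolding f'2[abs_def] by (rule linearI) (simp_all add: jt_simps algebra_simps)
  have "inj f'" unfolding linear_injective_0[OF lin] f'2 using jordan_L_injective[OF x] by simp
  then have "surj f'" using linear_injective_imp_surjective[OF lin] by simp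
  then have fG: "f' (inv f' h) = h" for h by (simp add: surj_f_inv_f)
  have d: "((\<lambda>x. jordan_powr x (1/2)) has_derivative inv f') (at (x \<odot> x))"
  proof (rule has_derivative_inverse_strong[of symmetric_cone x "\<lambda>x. x \<odot> x" _ f' "inv f'"])
    show "continuous_on symmetric_cone (\<lambda>x::'a. x \<odot> x)"
      by (intro jt.continuous_on continuous_on_id)
    show "jordan_powr (z \<odot> z) (1/2) = z" if "z \<in> symmetric_cone" for z :: 'a
    proof -
      have "z \<odot> z = jordan_powr z 2" using jordan_powr_times[of z 1 1] that by simp
      then show ?thesis using that by (simp add: jordan_powr_powr)
    qed
    show "((\<lambda>x. x \<odot> x) has_derivative f') (at x)"
      unfolding f'_def[abs_def] using jt.FDERIV[OF has_derivative_ident has_derivative_ident] .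
    show "f' \<circ> inv f' = id" using fG by auto
  qed (use x open_symmetric_cone in auto)
  have "2 *\<^sub>R (x \<odot> inv f' h) = h" for h using fG f'2 by simp
  then show ?thesis using that[OF d[unfolded xx]] unfolding x_def by blast
qed

text \<open>The Riemannian norm of the tangent vector \<open>h\<close> at the point \<open>y\<close> of the cone; its geodesic distance is
  \<open>log_dist\<close>.\<close>

definition cone_norm :: "'a::euclidean_jordan_algebra \<Rightarrow> 'a \<Rightarrow> real" where
  "cone_norm y h = norm (jordan_P (jordan_powr y (- (1/2))) h)"

lemma cone_norm_sq:
  assumes "y \<in> symmetric_cone"
  shows "(cone_norm y h)\<^sup>2 = jordan_P (jordan_powr y (-1)) h \<bullet> h"
  unfolding cone_norm_def dot_square_norm[symmetric] jordan_P_symmetric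
  using jordan_P_powr_add[OF assms, of "-(1/2)" "-(1/2)" h] by (simp add: inner_commute)

lemma cone_norm_P:
  assumes g: "g \<in> symmetric_cone" and x: "x \<in> symmetric_cone"
  shows "cone_norm (jordan_P g x) (jordan_P g h) = cone_norm x h"
proof -
  have gi: "jordan_powr g (-1) \<in> symmetric_cone" using g by blast
  have "(cone_norm (jordan_P g x) (jordan_P g h))\<^sup>2 = (cone_norm x h)\<^sup>2"
    unfolding cone_norm_sq[OF jordan_P_cone[OF g x]] cone_norm_sq[OF x] jordan_powr_neg1_P[OF g x]
      jordan_fundamental_formula[OF gi] jordan_P_inverse[OF g]
    by (simp add: jordan_P_symmetric jordan_P_inverse[OF g])
  then show ?thesis unfolding cone_norm_def by simp
qed

text \<open>Since \<open>P(c) \<le> L(c\<^sup>2)\<close> for \<open>c = a\<^sup>1\<^sup>/\<^sup>2\<close>, the operator \<open>P(c)\<^sup>-\<^sup>1 L(a)\<close>, whose factors commute, is at least the identity.\<close>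

lemma jordan_sqrt_contracts:
  fixes a h :: "'a::euclidean_jordan_algebra"
  assumes a: "a \<in> symmetric_cone"
  shows "norm (jordan_P (jordan_powr a (-(1/2))) h) \<le> norm (jordan_P (jordan_powr a (-1)) (a \<odot> h))"
proof -
  define k where "k = jordan_P (jordan_powr a (-(1/2))) h"
  define k' where "k' = jordan_P (jordan_powr a (-(1/4))) k"
  have com: "jordan_P (jordan_powr a s) (a \<odot> v) = a \<odot> jordan_P (jordan_powr a s) v" for s v
    using jordan_P_L_commute[of "\<lambda>t. t powr s" a "\<lambda>t. t" v] by (simp add: jordan_powr_fun)
  have 1: "jordan_P (jordan_powr a (-1)) (a \<odot> h) = a \<odot> jordan_P (jordan_powr a (-(1/2))) k"
    unfolding com k_def jordan_P_powr_add[OF a] by simp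
  have "k \<bullet> k = jordan_P (jordan_powr a (1/4)) k' \<bullet> jordan_P (jordan_powr a (1/4)) k'"
    unfolding k'_def jordan_P_powr_add[OF a] using a by simp
  also have "\<dots> = jordan_P (jordan_powr a (1/2)) k' \<bullet> k'"
    unfolding jordan_P_symmetric jordan_P_powr_add[OF a] by (simp add: inner_commute)
  also have "\<dots> \<le> ((jordan_powr a (1/2) \<odot> jordan_powr a (1/2)) \<odot> k') \<bullet> k'" by (rule jordan_P_le_L)
  also have "\<dots> = (a \<odot> k') \<bullet> k'" using a by (simp add: jordan_powr_times)
  also have "\<dots> = (a \<odot> jordan_P (jordan_powr a (-(1/2))) k) \<bullet> k"
    unfolding k'_def by (simp add: jordan_P_symmetric[symmetric] com jordan_P_powr_add[OF a])
  also have "\<dots> \<le> norm (a \<odot> jordan_P (jordan_powr a (-(1/2))) k) * norm k" by (rule norm_cauchy_schwarz)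
  finally have "norm k * norm k \<le> norm (a \<odot> jordan_P (jordan_powr a (-(1/2))) k) * norm k"
    by (simp add: dot_square_norm power2_eq_square)
  then have "norm k \<le> norm (a \<odot> jordan_P (jordan_powr a (-(1/2))) k)"
    by (cases "norm k = 0") auto
  then show ?thesis unfolding 1 k_def[symmetric] .
qed

text \<open>A tangent vector \<open>h\<close> at \<open>a\<^sup>2\<close> is \<open>2 a h'\<close> for its image \<open>h'\<close> at \<open>a\<close>, and \<open>jordan_sqrt_contracts\<close> bounds \<open>h'\<close> by half
  of \<open>h\<close>.\<close>

lemma jordan_sqrt_curve:
  fixes \<gamma> :: "real \<Rightarrow> 'a::euclidean_jordan_algebra"
  assumes d: "(\<gamma> has_vector_derivative h) (at t)" and y: "\<gamma> t \<in> symmetric_cone"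
  shows "\<exists>h'. ((\<lambda>s. jordan_powr (\<gamma> s) (1/2)) has_vector_derivative h') (at t) \<and>
    cone_norm (jordan_powr (\<gamma> t) (1/2)) h' \<le> cone_norm (\<gamma> t) h / 2"
proof -
  obtain G where G: "((\<lambda>x. jordan_powr x (1/2)) has_derivative G) (at (\<gamma> t))"
    "\<And>h. 2 *\<^sub>R (jordan_powr (\<gamma> t) (1/2) \<odot> G h) = h"
    using jordan_sqrt_has_derivative[OF y] by blast
  define a where "a = jordan_powr (\<gamma> t) (1/2)"
  have a: "a \<in> symmetric_cone" unfolding a_def using y by blast
  have "(((\<lambda>x. jordan_powr x (1/2)) \<circ> \<gamma>) has_vector_derivative G h) (at t)"
    using vector_derivative_diff_chain_within[of \<gamma> h t UNIV] d G(1) has_derivative_at_withinI by fastforce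
  moreover have "cone_norm a (G h) \<le> cone_norm (\<gamma> t) h / 2"
  proof -
    have "cone_norm (\<gamma> t) h = norm (jordan_P (jordan_powr a (-1)) (2 *\<^sub>R (a \<odot> G h)))"
      unfolding cone_norm_def a_def G(2) by (simp add: jordan_powr_powr)
    also have "\<dots> = 2 * norm (jordan_P (jordan_powr a (-1)) (a \<odot> G h))"
      by (simp add: linear_scale[OF linear_jordan_P])
    finally show ?thesis using jordan_sqrt_contracts[OF a, of "G h"] unfolding cone_norm_def by simp
  qed
  ultimately show ?thesis unfolding a_def comp_def by blast
qed

lemma jordan_root_curve:
  fixes \<gamma> :: "real \<Rightarrow> 'a::euclidean_jordan_algebra"
  assumes d: "(\<gamma> has_vector_derivative h) (at t)" and y: "\<And>s. \<gamma> s \<in> symmetric_cone"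
  shows "\<exists>h'. ((\<lambda>s. jordan_powr (\<gamma> s) ((1/2)^n)) has_vector_derivative h') (at t) \<and>
    cone_norm (jordan_powr (\<gamma> t) ((1/2)^n)) h' \<le> cone_norm (\<gamma> t) h * (1/2)^n"
proof (induction n)
  case 0
  show ?case using d y by (intro exI[of _ h]) simp
next
  case (Suc n)
  then obtain h' where h': "((\<lambda>s. jordan_powr (\<gamma> s) ((1/2)^n)) has_vector_derivative h') (at t)"
    "cone_norm (jordan_powr (\<gamma> t) ((1/2)^n)) h' \<le> cone_norm (\<gamma> t) h * (1/2)^n" by blast
  have c: "jordan_powr (\<gamma> t) ((1/2)^n) \<in> symmetric_cone" using y by blast
  obtain h'' where "((\<lambda>s. jordan_powr (jordan_powr (\<gamma> s) ((1/2)^n)) (1/2)) has_vector_derivative h'') (at t)"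
    "cone_norm (jordan_powr (jordan_powr (\<gamma> t) ((1/2)^n)) (1/2)) h'' \<le> cone_norm (jordan_powr (\<gamma> t) ((1/2)^n)) h' / 2"
    using jordan_sqrt_curve[OF h'(1) c] by blast
  then show ?case using h'(2) by (intro exI[of _ h'']) (simp add: jordan_powr_powr mult.commute)
qed

text \<open>For \<open>\<alpha> \<rightarrow> 0\<close> the constant tends to \<open>1\<close>, so near the unit the Euclidean norm is controlled by \<open>cone_norm\<close> with a
  constant close to \<open>1\<close>.\<close>

lemma jordan_P_norm_bound:
  fixes y k :: "'a::euclidean_jordan_algebra"
  assumes y: "y \<in> symmetric_cone" and M: "norm y * jordan_bound TYPE('a) \<le> M" and \<alpha>: "\<alpha> \<ge> 0"
  shows "norm (jordan_P (jordan_powr y (\<alpha> / 2)) k) \<le> M powr \<alpha> * norm k"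
proof -
  obtain r l c where x: "spectral_decomposition y r l c" using spectral_decomposition_exists by blast
  note s = spectral_decomposition_simps[OF x]
  have l: "0 < l j" "l j \<le> M" if "j \<in> {1..r}" for j
    using symmetric_cone_spectral_pos[OF x y that] spectral_value_bound[OF x that] M by auto
  have "(norm (jordan_P (jordan_powr y (\<alpha> / 2)) k))\<^sup>2 = jordan_P (jordan_powr y \<alpha>) k \<bullet> k"
    unfolding dot_square_norm[symmetric] jordan_P_symmetric jordan_P_powr_add[OF y] by (simp add: inner_commute)
  also have "\<dots> \<le> (jordan_powr y (\<alpha> + \<alpha>) \<odot> k) \<bullet> k"
    using jordan_P_le_L[of "jordan_powr y \<alpha>" k] unfolding jordan_powr_times .
  also have "\<dots> = (\<Sum>j=1..r. l j powr (\<alpha> + \<alpha>) * ((c j \<odot> k) \<bullet> k))"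
    unfolding jordan_powr_fun jordan_fun_eq[OF x] by (simp add: jt.sum_left jt_simps inner_sum_left)
  also have "\<dots> \<le> (\<Sum>j=1..r. M powr (\<alpha> + \<alpha>) * ((c j \<odot> k) \<bullet> k))"
    using l \<alpha> s(1)
    by (intro sum_mono mult_right_mono powr_mono2 idempotent_L_nonneg) (auto intro: less_imp_le)
  also have "\<dots> = M powr (\<alpha> + \<alpha>) * (k \<bullet> k)"
    using s(5) jordan_unit[of k]
    by (simp add: jt.sum_left[symmetric] inner_sum_left[symmetric] sum_distrib_left[symmetric])
  also have "\<dots> = (M powr \<alpha> * norm k)\<^sup>2"
    unfolding powr_add by (simp add: dot_square_norm power2_eq_square)
  finally show ?thesis by (rule power2_le_imp_le) simp
qed

lemma jordan_ln_limit:
  fixes x :: "'a::euclidean_jordan_algebra"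
  assumes "x \<in> symmetric_cone"
  shows "(\<lambda>n. 2^n *\<^sub>R (jordan_powr x ((1/2)^n) - jordan_unit)) \<longlonglongrightarrow> jordan_fun ln x"
proof -
  obtain r l c where x: "spectral_decomposition x r l c" using spectral_decomposition_exists by blast
  note s = spectral_decomposition_simps[OF x]
  have "(\<lambda>n. 2^n * (l j powr ((1/2)^n) - 1)) \<longlonglongrightarrow> ln (l j)" if "j \<in> {1..r}" for j
  proof -
    have pos: "l j > 0" using symmetric_cone_spectral_pos[OF x assms that] .
    have "((\<lambda>t. l j powr t) has_real_derivative ln (l j)) (at 0)"
      using pos unfolding powr_def by (auto intro!: derivative_eq_intros)
    then have "((\<lambda>h. (l j powr h - 1) / h) \<longlongrightarrow> ln (l j)) (at 0)"
      using pos unfolding DERIV_def by simp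
    moreover have "filterlim (\<lambda>n. (1/2::real)^n) (at 0) sequentially"
      by (auto simp: filterlim_at intro: LIMSEQ_power_zero)
    ultimately have "(\<lambda>n. (l j powr ((1/2)^n) - 1) / (1/2)^n) \<longlonglongrightarrow> ln (l j)"
      by (rule filterlim_compose)
    then show ?thesis by (simp add: power_divide field_simps)
  qed
  then have "(\<lambda>n. \<Sum>j=1..r. (2^n * (l j powr ((1/2)^n) - 1)) *\<^sub>R c j) \<longlonglongrightarrow> (\<Sum>j=1..r. ln (l j) *\<^sub>R c j)"
    by (intro tendsto_sum tendsto_scaleR tendsto_const) auto
  moreover have "2^n *\<^sub>R (jordan_powr x ((1/2)^n) - jordan_unit) = (\<Sum>j=1..r. (2^n * (l j powr ((1/2)^n) - 1)) *\<^sub>R c j)" for n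
    unfolding jordan_powr_fun jordan_fun_eq[OF x] s(5)[symmetric]
    by (simp add: scaleR_sum_right scaleR_diff_left scaleR_diff_right right_diff_distrib sum_subtractf)
  ultimately show ?thesis unfolding jordan_fun_eq[OF x] by simp
qed

text \<open>The curve \<open>\<gamma>(s) = P(a\<^sup>1\<^sup>/\<^sup>2) q\<^sup>s\<close> runs from \<open>a\<close> to \<open>b\<close> with constant Riemannian speed \<open>|z|\<close>, where \<open>z = log q\<close>
  and \<open>q = P(a\<^sup>-\<^sup>1\<^sup>/\<^sup>2) b\<close>. Its \<open>2\<^sup>n\<close>-th root has speed at most \<open>2\<^sup>-\<^sup>n |z|\<close> and comes close to the unit, so the mean
  value theorem bounds the Euclidean distance of its end points by nearly \<open>2\<^sup>-\<^sup>n |z|\<close>. Multiplication by \<open>2\<^sup>n\<close> and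
  \<open>n \<rightarrow> \<infinity>\<close> give the claim.\<close>

theorem exponential_metric_increasing:
  fixes a b :: "'a::euclidean_jordan_algebra"
  assumes a: "a \<in> symmetric_cone" and b: "b \<in> symmetric_cone"
  shows "norm (jordan_fun ln b - jordan_fun ln a) \<le> log_dist a b"
proof -
  define g where "g = jordan_powr a (1/2)"
  define q where "q = jordan_P (jordan_powr a (-(1/2))) b"
  define z where "z = jordan_fun ln q"
  \<comment> \<open>The factor \<open>1\<close> matches the exponent \<open>a * s\<close> of the derivative rule for powers.\<close>
  define \<gamma> where "\<gamma> s = jordan_P g (jordan_powr q (1 * s))" for s :: real
  have g: "g \<in> symmetric_cone" unfolding g_def using a by blast
  have q: "q \<in> symmetric_cone" unfolding q_def using a b by (intro jordan_P_cone) auto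
  have \<gamma>0: "\<gamma> 0 = a" unfolding \<gamma>_def g_def using a q by (simp add: jordan_powr_times)
  have \<gamma>1: "\<gamma> 1 = b" unfolding \<gamma>_def g_def using q jordan_P_powr_inverse[OF a, of "1/2" b] by (simp add: q_def)
  have \<gamma>c: "\<gamma> s \<in> symmetric_cone" for s unfolding \<gamma>_def using g q by (intro jordan_P_cone) auto
  \<comment> \<open>The velocity of \<open>\<gamma>\<close> and, by invariance of the Riemannian norm under \<open>P(g)\<close>, its constant norm.\<close>
  have d\<gamma>: "(\<gamma> has_vector_derivative jordan_P g (z \<odot> jordan_powr q (1 * s))) (at s)" for s
    unfolding \<gamma>_def[abs_def] z_def
    using bounded_linear.has_vector_derivative[OF _ has_vector_derivative_jordan_powr[OF q, of 1 s]]
      linear_jordan_P[of g] by (fastforce simp: linear_conv_bounded_linear)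
  have speed: "cone_norm (\<gamma> s) (jordan_P g (z \<odot> jordan_powr q (1 * s))) = norm z" for s
  proof -
    have "jordan_P (jordan_powr (jordan_powr q s) (-(1/2))) (z \<odot> jordan_powr q s) =
       z \<odot> jordan_P (jordan_powr (jordan_powr q s) (-(1/2))) (jordan_powr q s)"
      unfolding z_def jordan_powr_powr
      using jordan_P_L_commute[of "\<lambda>t. t powr (s * -(1/2))" q ln] unfolding jordan_powr_fun .
    also have "\<dots> = z" unfolding jordan_powr_powr jordan_P_powr using q by (simp add: jordan_unit_right)
    finally show ?thesis
      unfolding \<gamma>_def using cone_norm_P[OF g jordan_powr_cone[OF q, of s]] by (simp add: cone_norm_def)
  qed
  have cont: "continuous_on {0..1} \<gamma>"
    using d\<gamma> has_vector_derivative_continuous by (intro continuous_at_imp_continuous_on) blast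
  then have "bounded (\<gamma> ` {0..1})" by (intro compact_imp_bounded compact_continuous_image) auto
  then obtain B where B: "\<And>s. s \<in> {0..1} \<Longrightarrow> norm (\<gamma> s) \<le> B" unfolding bounded_iff by blast
  define M where "M = \<bar>B\<bar> * jordan_bound TYPE('a) + 1"
  have Mpos: "M > 0" unfolding M_def using jordan_bound(1)[where 'a='a] by (simp add: add_nonneg_pos)
  have M: "norm (\<gamma> s) * jordan_bound TYPE('a) \<le> M" if "s \<in> {0..1}" for s
  proof -
    have "norm (\<gamma> s) * jordan_bound TYPE('a) \<le> \<bar>B\<bar> * jordan_bound TYPE('a)"
      using B[OF that] jordan_bound(1)[where 'a='a] by (intro mult_right_mono) auto
    then show ?thesis unfolding M_def by simp
  qed
  have est: "2^n * norm (jordan_powr b ((1/2)^n) - jordan_powr a ((1/2)^n)) \<le> M powr ((1/2)^n) * norm z" for n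
  proof -
    define \<alpha> where "\<alpha> = (1/2::real)^n"
    have "\<forall>s. \<exists>h'. ((\<lambda>s. jordan_powr (\<gamma> s) \<alpha>) has_vector_derivative h') (at s) \<and>
      cone_norm (jordan_powr (\<gamma> s) \<alpha>) h' \<le> norm z * \<alpha>"
      using jordan_root_curve[OF d\<gamma> \<gamma>c, where n = n] unfolding speed \<alpha>_def by blast
    from choice[OF this] obtain h where
      h: "\<And>s. ((\<lambda>s. jordan_powr (\<gamma> s) \<alpha>) has_vector_derivative h s) (at s)"
      "\<And>s. cone_norm (jordan_powr (\<gamma> s) \<alpha>) (h s) \<le> norm z * \<alpha>" by blast
    have "continuous_on {0..1} (\<lambda>s. jordan_powr (\<gamma> s) \<alpha>)"
      using h(1) has_vector_derivative_continuous by (intro continuous_at_imp_continuous_on) blast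
    then obtain s where s: "s \<in> {0<..<1}"
      "norm (jordan_powr (\<gamma> 1) \<alpha> - jordan_powr (\<gamma> 0) \<alpha>) \<le> norm ((1 - 0) *\<^sub>R h s)"
      using mvt_general[of 0 1 "\<lambda>s. jordan_powr (\<gamma> s) \<alpha>" "\<lambda>s d. d *\<^sub>R h s"] h(1)
      unfolding has_vector_derivative_def by auto
    have "h s = jordan_P (jordan_powr (\<gamma> s) (\<alpha>/2)) (jordan_P (jordan_powr (\<gamma> s) (-(\<alpha>/2))) (h s))"
      using jordan_P_powr_inverse[OF \<gamma>c] by simp
    also have "norm \<dots> \<le> M powr \<alpha> * norm (jordan_P (jordan_powr (\<gamma> s) (-(\<alpha>/2))) (h s))"
      using s(1) by (intro jordan_P_norm_bound[OF \<gamma>c M]) (auto simp: \<alpha>_def)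
    also have "norm (jordan_P (jordan_powr (\<gamma> s) (-(\<alpha>/2))) (h s)) \<le> norm z * \<alpha>"
      using h(2)[of s] unfolding cone_norm_def jordan_powr_powr by simp
    finally have "norm (h s) \<le> M powr \<alpha> * (norm z * \<alpha>)" by (simp add: mult_left_mono)
    then have "norm (jordan_powr b \<alpha> - jordan_powr a \<alpha>) \<le> M powr \<alpha> * norm z * \<alpha>"
      using s(2) unfolding \<gamma>0 \<gamma>1 by (simp add: mult.assoc)
    then have "2^n * norm (jordan_powr b \<alpha> - jordan_powr a \<alpha>) \<le> 2^n * (M powr \<alpha> * norm z * \<alpha>)"
      by (intro mult_left_mono) auto
    also have "\<dots> = M powr \<alpha> * norm z" unfolding \<alpha>_def by (simp add: power_divide)
    finally show ?thesis unfolding \<alpha>_def .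
  qed
  have "(\<lambda>n. 2^n *\<^sub>R (jordan_powr b ((1/2)^n) - jordan_unit) - 2^n *\<^sub>R (jordan_powr a ((1/2)^n) - jordan_unit))
     \<longlonglongrightarrow> jordan_fun ln b - jordan_fun ln a"
    by (intro tendsto_diff jordan_ln_limit a b)
  then have "(\<lambda>n. norm (2^n *\<^sub>R (jordan_powr b ((1/2)^n) - jordan_unit) - 2^n *\<^sub>R (jordan_powr a ((1/2)^n) - jordan_unit)))
     \<longlonglongrightarrow> norm (jordan_fun ln b - jordan_fun ln a)" by (rule tendsto_norm)
  moreover have "norm (2^n *\<^sub>R (jordan_powr b ((1/2)^n) - jordan_unit) - 2^n *\<^sub>R (jordan_powr a ((1/2)^n) - jordan_unit))
    = 2^n * norm (jordan_powr b ((1/2)^n) - jordan_powr a ((1/2)^n))" for n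
    by (simp add: scaleR_diff_right[symmetric])
  ultimately have L: "(\<lambda>n. 2^n * norm (jordan_powr b ((1/2)^n) - jordan_powr a ((1/2)^n)))
     \<longlonglongrightarrow> norm (jordan_fun ln b - jordan_fun ln a)" by simp
  have "(\<lambda>n. M powr ((1/2)^n) * norm z) \<longlonglongrightarrow> M powr 0 * norm z"
    using Mpos by (intro tendsto_intros LIMSEQ_power_zero) auto
  then have R: "(\<lambda>n. M powr ((1/2)^n) * norm z) \<longlonglongrightarrow> norm z" using Mpos by simp
  have "norm (jordan_fun ln b - jordan_fun ln a) \<le> norm z"
    using LIMSEQ_le[OF L R] est by blast
  then show ?thesis unfolding z_def q_def log_dist_def .
qed

section \<open>Midpoints\<close>

text \<open>Conjugation by \<open>P(p\<^sup>1\<^sup>/\<^sup>2)\<close> turns the equation into \<open>s\<^sup>2 = P(p\<^sup>1\<^sup>/\<^sup>2) q\<close> for \<open>s = P(p\<^sup>1\<^sup>/\<^sup>2) m\<close>. The solution \<open>m\<close> is the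
  geometric mean of \<open>p\<^sup>-\<^sup>1\<close> and \<open>q\<close>.\<close>

lemma jordan_riccati_exists:
  fixes p q :: "'a::euclidean_jordan_algebra"
  assumes p: "p \<in> symmetric_cone" and q: "q \<in> symmetric_cone"
  obtains m where "m \<in> symmetric_cone" "jordan_P m p = q"
proof -
  define g where "g = jordan_powr p (1/2)"
  define s where "s = jordan_powr (jordan_P g q) (1/2)"
  define m where "m = jordan_P (jordan_powr p (-(1/2))) s"
  have g: "g \<in> symmetric_cone" unfolding g_def using p by blast
  have s: "s \<in> symmetric_cone" unfolding s_def using jordan_P_cone[OF g q] by blast
  have m: "m \<in> symmetric_cone" unfolding m_def using p s by (intro jordan_P_cone) auto
  have gm: "jordan_P g m = s" unfolding g_def m_def using jordan_P_powr_inverse[OF p, of "1/2" s] by simp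
  have ge: "jordan_P g jordan_unit = p" unfolding g_def using p by (simp add: jordan_powr_times)
  have "jordan_P g (jordan_P m p) = jordan_P (jordan_P g m) jordan_unit"
    unfolding jordan_fundamental_formula[OF g] ge ..
  also have "\<dots> = jordan_P g q"
    unfolding gm s_def using jordan_P_cone[OF g q] by (simp add: jordan_powr_times)
  finally show ?thesis using that m jordan_P_injective[OF g] by blast
qed

lemma jordan_riccati_unique:
  fixes p m m' :: "'a::euclidean_jordan_algebra"
  assumes p: "p \<in> symmetric_cone" and m: "m \<in> symmetric_cone" "m' \<in> symmetric_cone"
    and eq: "jordan_P m p = jordan_P m' p"
  shows "m = m'"
proof -
  define g where "g = jordan_powr p (1/2)"
  have g: "g \<in> symmetric_cone" unfolding g_def using p by blast
  have ge: "jordan_P g jordan_unit = p" unfolding g_def using p by (simp add: jordan_powr_times)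
  have sq: "jordan_P g (jordan_P m p) = jordan_powr (jordan_P g m) 2" if "m \<in> symmetric_cone" for m
    using jordan_fundamental_formula[OF g, of m jordan_unit] jordan_P_cone[OF g that]
      jordan_powr_times[of "jordan_P g m" 1 1] unfolding ge by simp
  have root: "jordan_powr (jordan_powr (jordan_P g m) 2) (1/2) = jordan_P g m" if "m \<in> symmetric_cone" for m
    using jordan_P_cone[OF g that] by (simp add: jordan_powr_powr)
  have "jordan_P g m = jordan_P g m'"
    using root[OF m(1)] root[OF m(2)] sq[OF m(1)] sq[OF m(2)] eq by simp
  then show ?thesis by (rule jordan_P_injective[OF g])
qed

text \<open>The equation for \<open>m\<close> says that \<open>m\<close> is the geometric mean of \<open>a\<close> and \<open>b\<close>. The isometry \<open>P(m\<^sup>-\<^sup>1\<^sup>/\<^sup>2)\<close> takes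
  \<open>m\<close>, \<open>a\<close>, \<open>b\<close>, \<open>c\<close> to \<open>e\<close>, \<open>exp v\<close>, \<open>exp (-v)\<close>, \<open>exp w\<close>. The distances from \<open>m\<close> to \<open>c\<close> and from \<open>a\<close> to \<open>b\<close> become
  \<open>|w|\<close> and \<open>2 |v|\<close>, the other two are at least \<open>|w - v|\<close> and \<open>|w + v|\<close>, and the parallelogram law applies.\<close>

theorem semiparallelogram_law:
  fixes a b c m :: "'a::euclidean_jordan_algebra"
  assumes a: "a \<in> symmetric_cone" and b: "b \<in> symmetric_cone" and c: "c \<in> symmetric_cone"
    and m: "m \<in> symmetric_cone" and mid: "jordan_P m (jordan_powr a (-1)) = b"
  shows "(log_dist m c)\<^sup>2 \<le> (log_dist a c)\<^sup>2 / 2 + (log_dist b c)\<^sup>2 / 2 - (log_dist a b)\<^sup>2 / 4"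
proof -
  define g where "g = jordan_powr m (-(1/2))"
  have g: "g \<in> symmetric_cone" unfolding g_def using m by blast
  define a' where "a' = jordan_P g a"
  define c' where "c' = jordan_P g c"
  have a': "a' \<in> symmetric_cone" and c': "c' \<in> symmetric_cone"
    unfolding a'_def c'_def using g a c by (auto intro: jordan_P_cone)
  have b': "jordan_P g b = jordan_powr a' (-1)"
    unfolding a'_def jordan_powr_neg1_P[OF g a] unfolding g_def mid[symmetric]
    using jordan_P_powr_add[OF m, of "-(1/2)" 1 "jordan_powr a (-1)"] m by (simp add: jordan_powr_powr)
  define v where "v = jordan_fun ln a'"
  define w where "w = jordan_fun ln c'"
  have "norm (w - v) \<le> log_dist a c"
    using exponential_metric_increasing[OF a' c'] log_dist_P[OF g a, of c] unfolding v_def w_def a'_def c'_def by simp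
  then have 1: "(norm (w - v))\<^sup>2 \<le> (log_dist a c)\<^sup>2" by (intro power_mono) auto
  have "norm (w - jordan_fun ln (jordan_powr a' (-1))) \<le> log_dist b c"
    using exponential_metric_increasing[OF jordan_powr_cone[OF a'] c', of "-1"] log_dist_P[OF g b, of c]
    unfolding w_def c'_def b' by simp
  then have "norm (w + v) \<le> log_dist b c" unfolding jordan_ln_powr[OF a'] v_def by simp
  then have 2: "(norm (w + v))\<^sup>2 \<le> (log_dist b c)\<^sup>2" by (intro power_mono) auto
  have "log_dist a b = log_dist a' (jordan_powr a' (-1))"
    using log_dist_P[OF g a, of b] unfolding a'_def b'[unfolded a'_def] by simp
  also have "\<dots> = norm (jordan_fun ln (jordan_powr a' (-2)))"
    unfolding log_dist_def jordan_P_powr by simp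
  also have "\<dots> = 2 * norm v" unfolding jordan_ln_powr[OF a'] v_def by simp
  finally have 3: "log_dist a b = 2 * norm v" .
  have 4: "log_dist m c = norm w" unfolding log_dist_def w_def c'_def g_def ..
  have "(norm (w - v))\<^sup>2 + (norm (w + v))\<^sup>2 = 2 * (norm v)\<^sup>2 + 2 * (norm w)\<^sup>2"
    unfolding dot_square_norm[symmetric]
    by (simp add: inner_diff_left inner_diff_right inner_add_left inner_add_right inner_commute)
  then show ?thesis using 1 2 unfolding 3 4 by (simp add: power_mult_distrib)
qed

section \<open>Existence and uniqueness of barycenters\<close>

lemma norm_jordan_ln_le:
  fixes y :: "'a::euclidean_jordan_algebra"
  assumes "y \<in> symmetric_cone" "norm (y - jordan_unit) * jordan_bound TYPE('a) \<le> 1/2"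
  shows "norm (jordan_fun ln y) \<le>
    2 * (norm (y - jordan_unit) * jordan_bound TYPE('a)) * norm (jordan_unit :: 'a)"
proof -
  define \<delta> where "\<delta> = norm (y - jordan_unit) * jordan_bound TYPE('a)"
  obtain r l c where x: "spectral_decomposition y r l c" using spectral_decomposition_exists by blast
  have d: "\<bar>l j - 1\<bar> \<le> \<delta>" if "j \<in> {1..r}" for j
    using spectral_value_bound[OF spectral_decomposition_fun[OF x, of "\<lambda>t. t - 1"] that]
    unfolding \<delta>_def jordan_fun_diff by simp
  have ln: "\<bar>ln (l j)\<bar> \<le> 2 * \<delta>" if "j \<in> {1..r}" for j
  proof -
    have u: "\<bar>l j - 1\<bar> \<le> 1/2" using d[OF that] assms(2) unfolding \<delta>_def by simp
    then have "\<bar>ln (1 + (l j - 1)) - (l j - 1)\<bar> \<le> 2 * (l j - 1)\<^sup>2"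
      by (intro abs_ln_one_plus_x_minus_x_bound)
    moreover have "2 * (l j - 1)\<^sup>2 \<le> \<bar>l j - 1\<bar>"
    proof -
      have "(2 * \<bar>l j - 1\<bar>) * \<bar>l j - 1\<bar> \<le> 1 * \<bar>l j - 1\<bar>" using u by (intro mult_right_mono) auto
      then show ?thesis by (simp add: power2_eq_square flip: abs_mult)
    qed
    ultimately show ?thesis using d[OF that] by simp
  qed
  have "(norm (jordan_fun ln y))\<^sup>2 = (\<Sum>j=1..r. ln (l j) * ln (l j) * (c j \<bullet> c j))"
    unfolding dot_square_norm[symmetric] by (rule jordan_fun_inner[OF x])
  also have "\<dots> \<le> (\<Sum>j=1..r. (2 * \<delta>) * (2 * \<delta>) * (c j \<bullet> c j))"
  proof (intro sum_mono mult_right_mono)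
    fix j assume j: "j \<in> {1..r}"
    have "\<bar>ln (l j)\<bar> * \<bar>ln (l j)\<bar> \<le> (2 * \<delta>) * (2 * \<delta>)" using ln[OF j] by (intro mult_mono) auto
    then show "ln (l j) * ln (l j) \<le> (2 * \<delta>) * (2 * \<delta>)" by simp
  qed simp
  also have "\<dots> = (2 * \<delta>) * (2 * \<delta>) * (norm (jordan_unit :: 'a))\<^sup>2"
    using jordan_fun_inner[OF x, of "\<lambda>_. 1" "\<lambda>_. 1"]
    by (simp add: sum_distrib_left dot_square_norm)
  also have "\<dots> = (2 * \<delta> * norm (jordan_unit :: 'a))\<^sup>2" by (simp add: power2_eq_square)
  finally show ?thesis
    unfolding \<delta>_def[symmetric]
    using jordan_bound(1)[where 'a='a] by (elim power2_le_imp_le) (simp add: \<delta>_def)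
qed

text \<open>The bound \<open>|log b - log a| \<le> |log (P(a\<^sup>-\<^sup>1\<^sup>/\<^sup>2) b)|\<close> reduces continuity at \<open>a\<close> to the estimate near the unit.\<close>

lemma continuous_on_jordan_ln:
  "continuous_on (symmetric_cone :: 'a::euclidean_jordan_algebra set) (jordan_fun ln)"
  unfolding continuous_on_def
proof
  fix a :: 'a assume a: "a \<in> symmetric_cone"
  define K where "K = jordan_bound TYPE('a)"
  define g where "g = jordan_powr a (-(1/2))"
  have g: "g \<in> symmetric_cone" unfolding g_def using a by blast
  have ga: "jordan_P g a = jordan_unit" unfolding g_def using jordan_P_powr[of a "-(1/2)" 1] a by simp
  define r where "r b = norm (jordan_P g b - jordan_unit) * K" for b
  have "(jordan_P g \<longlongrightarrow> jordan_P g a) (at a within symmetric_cone)"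
    using continuous_on_jordan_P[of symmetric_cone g] a unfolding continuous_on_def by blast
  then have "(r \<longlongrightarrow> norm (jordan_P g a - jordan_unit) * K) (at a within symmetric_cone)"
    unfolding r_def[abs_def] by (intro tendsto_intros)
  then have r0: "(r \<longlongrightarrow> 0) (at a within symmetric_cone)" unfolding ga by simp
  then have lim: "((\<lambda>b. 2 * r b * norm (jordan_unit :: 'a)) \<longlongrightarrow> 0) (at a within symmetric_cone)"
    using tendsto_mult[OF tendsto_mult[OF tendsto_const[of 2] r0] tendsto_const[of "norm (jordan_unit :: 'a)"]] by simp
  have "eventually (\<lambda>b. r b < 1/2) (at a within symmetric_cone)"
    using order_tendstoD(2)[OF r0, of "1/2"] by simp
  moreover have "eventually (\<lambda>b. b \<in> symmetric_cone) (at a within symmetric_cone)"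
    unfolding eventually_at_filter by simp
  ultimately have "eventually (\<lambda>b. norm (jordan_fun ln b - jordan_fun ln a) \<le> 2 * r b * norm (jordan_unit :: 'a))
     (at a within symmetric_cone)"
  proof eventually_elim
    case (elim b)
    have "norm (jordan_fun ln b - jordan_fun ln a) \<le> norm (jordan_fun ln (jordan_P g b))"
      using exponential_metric_increasing[OF a elim(2)] unfolding log_dist_def g_def .
    also have "\<dots> \<le> 2 * r b * norm (jordan_unit :: 'a)"
      using norm_jordan_ln_le[OF jordan_P_cone[OF g elim(2)]] elim(1) unfolding r_def K_def by simp
    finally show ?case .
  qed
  from Lim_null_comparison[OF this lim]
  show "(jordan_fun ln \<longlongrightarrow> jordan_fun ln a) (at a within symmetric_cone)" by (rule LIM_zero_cancel)
qed

lemma continuous_on_log_dist: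
  fixes p :: "'a::euclidean_jordan_algebra"
  assumes p: "p \<in> symmetric_cone"
  shows "continuous_on symmetric_cone (\<lambda>z. log_dist z p)"
proof -
  define g where "g = jordan_powr p (-(1/2))"
  have g: "g \<in> symmetric_cone" unfolding g_def using p by blast
  have "continuous_on symmetric_cone (\<lambda>z. norm (jordan_fun ln (jordan_P g z)))"
    using jordan_P_cone[OF g]
    by (intro continuous_on_norm continuous_on_compose2[OF continuous_on_jordan_ln continuous_on_jordan_P]) auto
  then show ?thesis
    using log_dist_commute[OF _ p] by (subst continuous_on_cong[OF refl]) (auto simp: log_dist_def g_def)
qed

text \<open>A bound for \<open>log y\<close> confines the spectral values of \<open>y\<close> to a compact interval of positive numbers, hence \<open>y\<close> to a
  compact subset \<open>Z\<close> of the cone.\<close>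

lemma compact_log_ball:
  "compact {y \<in> symmetric_cone :: 'a::euclidean_jordan_algebra set. norm (jordan_fun ln y) \<le> R}"
proof -
  define K where "K = jordan_bound TYPE('a)"
  have K: "K > 0" unfolding K_def by (rule jordan_bound)
  define m where "m = exp (- (R * K))"
  define C where "C = exp (R * K) * norm (jordan_unit :: 'a)"
  define Z where "Z = cball 0 C \<inter> {y :: 'a. y - m *\<^sub>R jordan_unit \<in> {x \<odot> x | x. True}}"
  have "closed ((\<lambda>y :: 'a. y - m *\<^sub>R jordan_unit) -` {x \<odot> x | x. True})"
    by (intro closed_vimage closed_jordan_squares continuous_intros)
  then have Z: "compact Z" unfolding Z_def vimage_def by (intro compact_Int_closed) auto
  have Z\<Omega>: "Z \<subseteq> symmetric_cone"
    unfolding Z_def using symmetric_cone_marginI[of m] by (auto simp: m_def)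
  have cont: "continuous_on Z (\<lambda>y. norm (jordan_fun ln y))"
    by (intro continuous_on_norm continuous_on_subset[OF continuous_on_jordan_ln Z\<Omega>])
  have "closed (Z \<inter> (\<lambda>y. norm (jordan_fun ln y)) -` {..R})"
    by (rule continuous_closed_preimage[OF cont compact_imp_closed[OF Z]]) simp
  then have "compact (Z \<inter> (Z \<inter> (\<lambda>y. norm (jordan_fun ln y)) -` {..R}))" by (intro compact_Int_closed Z)
  moreover have "Z \<inter> (Z \<inter> (\<lambda>y. norm (jordan_fun ln y)) -` {..R}) = {y \<in> symmetric_cone. norm (jordan_fun ln y) \<le> R}"
  proof (intro subset_antisym subsetI)
    fix y :: 'a assume y: "y \<in> {y \<in> symmetric_cone. norm (jordan_fun ln y) \<le> R}"
    obtain r l c where x: "spectral_decomposition y r l c" using spectral_decomposition_exists by blast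
    have l: "m \<le> l j" "l j \<le> exp (R * K)" if "j \<in> {1..r}" for j
    proof -
      have pos: "l j > 0" using symmetric_cone_spectral_pos[OF x _ that] y by simp
      have "\<bar>ln (l j)\<bar> \<le> norm (jordan_fun ln y) * K"
        using spectral_value_bound[OF spectral_decomposition_fun[OF x, of ln] that] unfolding K_def by simp
      also have "\<dots> \<le> R * K" using y K by (intro mult_right_mono) auto
      finally have "ln (l j) \<le> R * K" "- (R * K) \<le> ln (l j)" by auto
      then have "exp (ln (l j)) \<le> exp (R * K)" "exp (- (R * K)) \<le> exp (ln (l j))" by simp_all
      then show "m \<le> l j" "l j \<le> exp (R * K)" unfolding m_def using pos by simp_all
    qed
    have "(norm y)\<^sup>2 = (\<Sum>j=1..r. l j * l j * (c j \<bullet> c j))"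
      using jordan_fun_inner[OF x, of "\<lambda>t. t" "\<lambda>t. t"] by (simp add: dot_square_norm)
    also have "\<dots> \<le> (\<Sum>j=1..r. exp (R * K) * exp (R * K) * (c j \<bullet> c j))"
    proof (intro sum_mono mult_right_mono mult_mono)
      fix j assume "j \<in> {1..r}"
      then show "0 \<le> l j" using symmetric_cone_spectral_pos[OF x] y by (simp add: less_imp_le)
    qed (use l in auto)
    also have "\<dots> = C\<^sup>2"
      using jordan_fun_inner[OF x, of "\<lambda>_. 1" "\<lambda>_. 1"] unfolding C_def
      by (simp add: sum_distrib_left[symmetric] dot_square_norm power2_eq_square)
    finally have "norm y \<le> C" by (rule power2_le_imp_le) (simp add: C_def)
    then have "y \<in> Z" unfolding Z_def using symmetric_cone_margin[OF x l(1)] by simp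
    then show "y \<in> Z \<inter> (Z \<inter> (\<lambda>y. norm (jordan_fun ln y)) -` {..R})" using y by simp
  qed (use Z\<Omega> in auto)
  ultimately show ?thesis by simp
qed

text \<open>The points where the sum does not exceed its value at \<open>p\<^sub>1\<close> lie in a closed ball about \<open>p\<^sub>1\<close>, which is the image of a
  compact logarithmic ball under \<open>P(p\<^sub>1\<^sup>1\<^sup>/\<^sup>2)\<close>; so a minimum is attained. Summed over the \<open>p\<^sub>i\<close>, the
  semiparallelogram law shows that the midpoint of two different minimisers would have a smaller value.\<close>

lemma barycenter_exists_unique:
  fixes p :: "nat \<Rightarrow> 'a::euclidean_jordan_algebra"
  assumes S: "S \<subseteq> symmetric_cone" "closedin (top_of_set symmetric_cone) S"
    and mid: "\<And>a b. a \<in> S \<Longrightarrow> b \<in> S \<Longrightarrow> \<exists>m\<in>S. jordan_P m (jordan_powr a (-1)) = b"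
    and n: "n \<ge> 1" and p: "\<And>i. i \<in> {1..n} \<Longrightarrow> p i \<in> S"
  shows "\<exists>!z. is_arg_min (\<lambda>z. \<Sum>i=1..n. (log_dist z (p i))\<^sup>2) (\<lambda>z. z \<in> S) z"
proof -
  define F where "F z = (\<Sum>i=1..n. (log_dist z (p i))\<^sup>2)" for z
  have p\<Omega>: "p i \<in> symmetric_cone" if "i \<in> {1..n}" for i using p[OF that] S by blast
  have p1: "p 1 \<in> S" "p 1 \<in> symmetric_cone" using p p\<Omega> n by auto
  define R where "R = sqrt (F (p 1))"
  have F0: "F z \<ge> 0" for z unfolding F_def by (intro sum_nonneg) auto
  then have R: "R \<ge> 0" "R\<^sup>2 = F (p 1)" unfolding R_def by auto
  define g where "g = jordan_powr (p 1) (1/2)"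
  have g: "g \<in> symmetric_cone" unfolding g_def using p1 by blast
  define D where "D = jordan_P g ` {y \<in> symmetric_cone. norm (jordan_fun ln y) \<le> R}"
  have D: "compact D" unfolding D_def
    by (intro compact_continuous_image continuous_on_jordan_P compact_log_ball)
  have D\<Omega>: "D \<subseteq> symmetric_cone" unfolding D_def using jordan_P_cone[OF g] by auto
  have inD: "z \<in> D" if "z \<in> symmetric_cone" "log_dist z (p 1) \<le> R" for z
  proof -
    define y where "y = jordan_P (jordan_powr (p 1) (-(1/2))) z"
    have "y \<in> symmetric_cone" unfolding y_def using p1 that by (intro jordan_P_cone) auto
    moreover have "norm (jordan_fun ln y) \<le> R"
      using that log_dist_commute[OF that(1) p1(2)] unfolding y_def log_dist_def by simp
    moreover have "jordan_P g y = z" unfolding g_def y_def using jordan_P_powr_inverse[OF p1(2), of "1/2" z] by simp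
    ultimately show ?thesis unfolding D_def by blast
  qed
  obtain C where C: "closed C" "S = symmetric_cone \<inter> C" using S(2) unfolding closedin_closed by auto
  then have "S \<inter> D = C \<inter> D" using D\<Omega> by blast
  then have cSD: "compact (S \<inter> D)" using closed_Int_compact[OF C(1) D] by simp
  have "log_dist (p 1) (p 1) = 0"
    unfolding log_dist_def using jordan_P_powr[of "p 1" "-(1/2)" 1] p1 jordan_ln_powr[OF jordan_unit_cone, of 0] by simp
  then have ne: "S \<inter> D \<noteq> {}" using inD[OF p1(2)] p1(1) R by auto
  have contF: "continuous_on (S \<inter> D) F" unfolding F_def[abs_def]
    using S(1) by (intro continuous_intros continuous_on_subset[OF continuous_on_log_dist] p\<Omega>) auto
  obtain z where z: "z \<in> S \<inter> D" "\<And>y. y \<in> S \<inter> D \<Longrightarrow> F z \<le> F y"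
    using continuous_attains_inf[OF cSD ne contF] by blast
  have p1D: "p 1 \<in> D" using inD[OF p1(2)] \<open>log_dist (p 1) (p 1) = 0\<close> R by simp
  have min: "F z \<le> F y" if "y \<in> S" for y
  proof (cases "y \<in> D")
    case True then show ?thesis using z(2) that by blast
  next
    case False
    then have "log_dist y (p 1) > R" using inD that S(1) by force
    then have "F (p 1) \<le> (log_dist y (p 1))\<^sup>2" unfolding R(2)[symmetric] using R(1) by (intro power_mono) auto
    also have "\<dots> \<le> F y" unfolding F_def using n by (intro member_le_sum) auto
    finally show ?thesis using z(2)[of "p 1"] p1(1) p1D by simp
  qed
  have "is_arg_min F (\<lambda>z. z \<in> S) z" using z(1) min unfolding is_arg_min_linorder by blast
  moreover have "z' = z" if z': "is_arg_min F (\<lambda>z. z \<in> S) z'" for z'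
  proof -
    have zS: "z \<in> S" "z' \<in> S" and eq: "F z' = F z"
      using z(1) z' min[of z'] unfolding is_arg_min_linorder by (auto intro: antisym)
    obtain m where m: "m \<in> S" "jordan_P m (jordan_powr z (-1)) = z'" using mid zS by blast
    have "F m \<le> (\<Sum>i=1..n. (log_dist z (p i))\<^sup>2 / 2 + (log_dist z' (p i))\<^sup>2 / 2 - (log_dist z z')\<^sup>2 / 4)"
      unfolding F_def using zS m(1) S(1) p\<Omega>
      by (intro sum_mono semiparallelogram_law[OF _ _ _ _ m(2)]) auto
    also have "\<dots> = F z / 2 + F z' / 2 - n * ((log_dist z z')\<^sup>2 / 4)"
      unfolding F_def by (simp add: sum.distrib sum_subtractf sum_divide_distrib)
    finally have "real n * (log_dist z z')\<^sup>2 \<le> 0" using min[OF m(1)] eq by simp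
    then have "log_dist z z' = 0" using n by (simp add: mult_le_0_iff)
    then show ?thesis using log_dist_eq_0 zS S(1) by blast
  qed
  ultimately show ?thesis unfolding F_def[abs_def] by blast
qed

section \<open>The two factors of the cone\<close>

lemma involutive_automorphism_simps:
  fixes \<sigma> :: "'a::euclidean_jordan_algebra \<Rightarrow> 'a"
  assumes "involutive_jordan_automorphism \<sigma>"
  shows "linear \<sigma>" "bij \<sigma>" "\<sigma> (x \<odot> y) = \<sigma> x \<odot> \<sigma> y" "\<sigma> (\<sigma> x) = x"
    "\<sigma> (jordan_powr x t) = jordan_powr (\<sigma> x) t" "\<sigma> (jordan_P x y) = jordan_P (\<sigma> x) (\<sigma> y)"
    "x \<in> symmetric_cone \<Longrightarrow> \<sigma> x \<in> symmetric_cone"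
proof -
  show s: "linear \<sigma>" "bij \<sigma>" and m: "\<sigma> (x \<odot> y) = \<sigma> x \<odot> \<sigma> y" and "\<sigma> (\<sigma> x) = x" for x y
    using assms unfolding involutive_jordan_automorphism_def by (auto simp: fun_eq_iff)
  show "\<sigma> (jordan_powr x t) = jordan_powr (\<sigma> x) t"
    unfolding jordan_powr_fun jordan_automorphism_fun[OF s m] ..
  show "\<sigma> (jordan_P x y) = jordan_P (\<sigma> x) (\<sigma> y)"
    unfolding jordan_P_eq by (simp add: linear_diff[OF s(1)] linear_scale[OF s(1)] m)
  show "\<sigma> x \<in> symmetric_cone" if "x \<in> symmetric_cone"
  proof -
    obtain r l c where x: "spectral_decomposition x r l c" using spectral_decomposition_exists by blast
    show ?thesis
      using symmetric_coneI[OF jordan_automorphism_spectral_decomposition[OF s m x]]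
        symmetric_cone_spectral_pos[OF x that] by blast
  qed
qed

lemma cone_plus_closed:
  assumes "involutive_jordan_automorphism \<sigma>"
  shows "closedin (top_of_set symmetric_cone) (cone_plus \<sigma>)"
proof -
  have "continuous_on UNIV \<sigma>"
    using involutive_automorphism_simps(1)[OF assms] by (simp add: linear_continuous_on linear_conv_bounded_linear)
  then have "closed {a. \<sigma> a = a}" by (intro closed_Collect_eq continuous_on_id)
  moreover have "cone_plus \<sigma> = symmetric_cone \<inter> {a. \<sigma> a = a}" unfolding cone_plus_def by blast
  ultimately show ?thesis unfolding closedin_closed by blast
qed

text \<open>Rewrites the condition \<open>\<sigma> b = b\<^sup>-\<^sup>1\<close> as a polynomial equation, which defines a closed set.\<close>

lemma cone_minus_iff:
  "b \<in> cone_minus \<sigma> \<longleftrightarrow> b \<in> symmetric_cone \<and> jordan_P b (\<sigma> b) = b"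
  unfolding cone_minus_def using jordan_inverse_unique jordan_P_powr_neg1 by fastforce

lemma cone_minus_closed:
  assumes "involutive_jordan_automorphism \<sigma>"
  shows "closedin (top_of_set symmetric_cone) (cone_minus \<sigma>)"
proof -
  have "continuous_on UNIV \<sigma>"
    using involutive_automorphism_simps(1)[OF assms] by (simp add: linear_continuous_on linear_conv_bounded_linear)
  then have "closed {b. jordan_P b (\<sigma> b) = b}"
    unfolding jordan_P_eq by (intro closed_Collect_eq continuous_on_id continuous_intros jt.continuous_on)
  moreover have "cone_minus \<sigma> = symmetric_cone \<inter> {b. jordan_P b (\<sigma> b) = b}" using cone_minus_iff by blast
  ultimately show ?thesis unfolding closedin_closed by blast
qed

text \<open>If \<open>m\<close> solves \<open>P(m) a\<^sup>-\<^sup>1 = b\<close>, then so does \<open>\<sigma> m\<close>; hence \<open>\<sigma> m = m\<close>.\<close>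

lemma cone_plus_midpoint:
  assumes \<sigma>: "involutive_jordan_automorphism \<sigma>" and ab: "a \<in> cone_plus \<sigma>" "b \<in> cone_plus \<sigma>"
  shows "\<exists>m\<in>cone_plus \<sigma>. jordan_P m (jordan_powr a (-1)) = b"
proof -
  note s = involutive_automorphism_simps[OF \<sigma>]
  have a: "a \<in> symmetric_cone" "\<sigma> a = a" and b: "b \<in> symmetric_cone" "\<sigma> b = b"
    using ab unfolding cone_plus_def by auto
  have ai: "jordan_powr a (-1) \<in> symmetric_cone" using a by blast
  obtain m where m: "m \<in> symmetric_cone" "jordan_P m (jordan_powr a (-1)) = b"
    using jordan_riccati_exists[OF ai b(1)] by blast
  have "jordan_P (\<sigma> m) (jordan_powr a (-1)) = jordan_P m (jordan_powr a (-1))"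
    using arg_cong[OF m(2), of \<sigma>, unfolded s(5,6) a(2) b(2)] m(2) by simp
  then have "\<sigma> m = m" using jordan_riccati_unique[OF ai s(7)[OF m(1)] m(1)] by simp
  then show ?thesis using m unfolding cone_plus_def by blast
qed

text \<open>If \<open>m\<close> solves \<open>P(m) a\<^sup>-\<^sup>1 = b\<close>, then applying \<open>\<sigma>\<close> and inverting shows that \<open>(\<sigma> m)\<^sup>-\<^sup>1\<close> is also a solution; hence
  \<open>\<sigma> m = m\<^sup>-\<^sup>1\<close>.\<close>

lemma cone_minus_midpoint:
  assumes \<sigma>: "involutive_jordan_automorphism \<sigma>" and ab: "a \<in> cone_minus \<sigma>" "b \<in> cone_minus \<sigma>"
  shows "\<exists>m\<in>cone_minus \<sigma>. jordan_P m (jordan_powr a (-1)) = b"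
proof -
  note s = involutive_automorphism_simps[OF \<sigma>]
  have a: "a \<in> symmetric_cone" "\<sigma> a = jordan_powr a (-1)" and b: "b \<in> symmetric_cone" "\<sigma> b = jordan_powr b (-1)"
    using ab unfolding cone_minus_def by auto
  have ai: "jordan_powr a (-1) \<in> symmetric_cone" using a by blast
  obtain m where m: "m \<in> symmetric_cone" "jordan_P m (jordan_powr a (-1)) = b"
    using jordan_riccati_exists[OF ai b(1)] by blast
  have sm: "\<sigma> m \<in> symmetric_cone" using s(7)[OF m(1)] .
  have "jordan_P (\<sigma> m) a = jordan_powr b (-1)"
    using arg_cong[OF m(2), of \<sigma>] a b by (simp add: s jordan_powr_powr)
  then have "jordan_powr (jordan_P (\<sigma> m) a) (-1) = b" using b by (simp add: jordan_powr_powr)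
  then have "jordan_P (jordan_powr (\<sigma> m) (-1)) (jordan_powr a (-1)) = jordan_P m (jordan_powr a (-1))"
    using jordan_powr_neg1_P[OF sm a(1)] m(2) by simp
  then have "jordan_powr (\<sigma> m) (-1) = m" using jordan_riccati_unique[OF ai jordan_powr_cone[OF sm] m(1)] by simp
  then have "\<sigma> m = jordan_powr m (-1)" using jordan_powr_powr[of "\<sigma> m" "-1" "-1"] sm by simp
  then show ?thesis using m unfolding cone_minus_def by blast
qed

text \<open>The first factor of \<open>x = P(a\<^sup>1\<^sup>/\<^sup>2) b\<close> is recovered from \<open>x\<close> as the solution of a Riccati equation, because \<open>\<sigma> x = P(a\<^sup>1\<^sup>/\<^sup>2) b\<^sup>-\<^sup>1\<close>
  and \<open>x\<^sup>-\<^sup>1 = P(a\<^sup>-\<^sup>1\<^sup>/\<^sup>2) b\<^sup>-\<^sup>1\<close>.\<close>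

lemma cone_map_riccati:
  assumes \<sigma>: "involutive_jordan_automorphism \<sigma>" and ab: "a \<in> cone_plus \<sigma>" "b \<in> cone_minus \<sigma>"
  shows "cone_map (a, b) \<in> symmetric_cone"
    "jordan_P a (jordan_powr (cone_map (a, b)) (-1)) = \<sigma> (cone_map (a, b))"
proof -
  note s = involutive_automorphism_simps[OF \<sigma>]
  have a: "a \<in> symmetric_cone" "\<sigma> a = a" and b: "b \<in> symmetric_cone" "\<sigma> b = jordan_powr b (-1)"
    using ab unfolding cone_minus_def cone_plus_def by auto
  have ah: "jordan_powr a (1/2) \<in> symmetric_cone" using a by blast
  show "cone_map (a, b) \<in> symmetric_cone" unfolding cone_map_def using jordan_P_cone[OF ah b(1)] by simp
  have "jordan_powr (cone_map (a, b)) (-1) = jordan_P (jordan_powr a (-(1/2))) (jordan_powr b (-1))"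
    unfolding cone_map_def using jordan_powr_neg1_P[OF ah b(1)] by (simp add: jordan_powr_powr)
  then have "jordan_P a (jordan_powr (cone_map (a, b)) (-1)) = jordan_P (jordan_powr a (1/2)) (jordan_powr b (-1))"
    using jordan_P_powr_add[OF a(1), of 1 "-(1/2)"] a(1) by simp
  also have "\<dots> = \<sigma> (cone_map (a, b))" unfolding cone_map_def using a b by (simp add: s)
  finally show "jordan_P a (jordan_powr (cone_map (a, b)) (-1)) = \<sigma> (cone_map (a, b))" .
qed

text \<open>Uniqueness of the Riccati solution \<open>a\<close> gives injectivity. For surjectivity take \<open>a\<close> to be the solution and
  \<open>b = P(a\<^sup>-\<^sup>1\<^sup>/\<^sup>2) x\<close>: applying \<open>\<sigma>\<close> to the equation and inverting shows that \<open>\<sigma> a\<close> is also a solution, so \<open>\<sigma> a = a\<close>, and then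
  \<open>\<sigma> b = b\<^sup>-\<^sup>1\<close>.\<close>

theorem cone_map_bij:
  fixes \<sigma> :: "'a::euclidean_jordan_algebra \<Rightarrow> 'a"
  assumes \<sigma>: "involutive_jordan_automorphism \<sigma>"
  shows "bij_betw cone_map (cone_plus \<sigma> \<times> cone_minus \<sigma>) symmetric_cone"
  unfolding bij_betw_def
proof
  note s = involutive_automorphism_simps[OF \<sigma>]
  show "inj_on cone_map (cone_plus \<sigma> \<times> cone_minus \<sigma>)"
  proof (rule inj_onI, clarsimp)
    fix a b c d assume h: "a \<in> cone_plus \<sigma>" "b \<in> cone_minus \<sigma>" "c \<in> cone_plus \<sigma>" "d \<in> cone_minus \<sigma>"
      and eq: "cone_map (a, b) = cone_map (c, d)"
    have ac: "a \<in> symmetric_cone" "c \<in> symmetric_cone" using h unfolding cone_plus_def by auto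
    have "a = c"
      using cone_map_riccati(2)[OF \<sigma> h(1,2)] cone_map_riccati(2)[OF \<sigma> h(3,4)] unfolding eq
      by (intro jordan_riccati_unique[OF jordan_powr_cone[OF cone_map_riccati(1)[OF \<sigma> h(3,4)], of "-1"] ac]) simp
    moreover have "b = d"
      using eq jordan_P_injective[OF jordan_powr_cone[OF ac(1)]] unfolding \<open>a = c\<close> cone_map_def by auto
    ultimately show "a = c \<and> b = d" by simp
  qed
  show "cone_map ` (cone_plus \<sigma> \<times> cone_minus \<sigma>) = symmetric_cone"
  proof (intro subset_antisym subsetI)
    fix x :: 'a assume x: "x \<in> symmetric_cone"
    have xi: "jordan_powr x (-1) \<in> symmetric_cone" using x by blast
    obtain a where a: "a \<in> symmetric_cone" "jordan_P a (jordan_powr x (-1)) = \<sigma> x"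
      using jordan_riccati_exists[OF xi s(7)[OF x]] by blast
    have sa: "\<sigma> a \<in> symmetric_cone" using s(7)[OF a(1)] .
    have sai: "jordan_powr (\<sigma> a) (-1) \<in> symmetric_cone" using sa by blast
    have "jordan_P (\<sigma> a) (jordan_powr (\<sigma> x) (-1)) = x" using arg_cong[OF a(2), of \<sigma>] by (simp add: s)
    then have "jordan_powr (jordan_P (\<sigma> a) (jordan_powr (\<sigma> x) (-1))) (-1) = jordan_powr x (-1)" by simp
    then have "jordan_P (jordan_powr (\<sigma> a) (-1)) (\<sigma> x) = jordan_powr x (-1)"
      using jordan_powr_neg1_P[OF sa jordan_powr_cone[OF s(7)[OF x], of "-1"]] s(7)[OF x] by (simp add: jordan_powr_powr)
    then have "jordan_P (\<sigma> a) (jordan_powr x (-1)) = \<sigma> x" using jordan_P_inverse(1)[OF sa, of "\<sigma> x"] by simp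
    then have fix_a: "\<sigma> a = a" using jordan_riccati_unique[OF xi sa a(1)] a(2) by simp
    define b where "b = jordan_P (jordan_powr a (-(1/2))) x"
    have ah: "jordan_powr a (-(1/2)) \<in> symmetric_cone" using a by blast
    have b: "b \<in> symmetric_cone" unfolding b_def by (rule jordan_P_cone[OF ah x])
    have "\<sigma> b = jordan_P (jordan_powr a (-(1/2))) (\<sigma> x)" unfolding b_def by (simp add: s fix_a)
    also have "\<dots> = jordan_P (jordan_powr a (1/2)) (jordan_powr x (-1))"
      unfolding a(2)[symmetric] using jordan_P_powr_add[OF a(1), of "-(1/2)" 1] a(1) by simp
    also have "\<dots> = jordan_powr b (-1)"
      unfolding b_def jordan_powr_neg1_P[OF ah x] by (simp add: jordan_powr_powr)
    finally have "b \<in> cone_minus \<sigma>" using b unfolding cone_minus_def by blast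
    moreover have "a \<in> cone_plus \<sigma>" using a fix_a unfolding cone_plus_def by blast
    moreover have "cone_map (a, b) = x"
      unfolding cone_map_def b_def using jordan_P_powr_inverse[OF a(1), of "1/2" x] by simp
    ultimately show "x \<in> cone_map ` (cone_plus \<sigma> \<times> cone_minus \<sigma>)" by force
  qed (use cone_map_riccati(1)[OF \<sigma>] in auto)
qed

section \<open>Karcher means\<close>

lemma mean_sq_dist_cone:
  fixes p :: "nat \<Rightarrow> 'a::simple_euclidean_jordan_algebra"
  shows "mean_sq_dist cone_dist n p z =
    (1 / (real n * primitive_norm_sq TYPE('a))) * (\<Sum>i=1..n. (log_dist z (p i))\<^sup>2)"
  unfolding mean_sq_dist_def cone_dist_eq by (simp add: sum_divide_distrib[symmetric])

lemma is_arg_min_scale: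
  fixes f :: "'b \<Rightarrow> real"
  assumes "c > 0"
  shows "is_arg_min (\<lambda>z. c * f z) P z \<longleftrightarrow> is_arg_min f P z"
  using assms unfolding is_arg_min_def by simp

lemma cone_mean_unique:
  fixes p :: "nat \<Rightarrow> 'a::simple_euclidean_jordan_algebra"
  assumes "S \<subseteq> symmetric_cone" "closedin (top_of_set symmetric_cone) S"
    "\<And>a b. a \<in> S \<Longrightarrow> b \<in> S \<Longrightarrow> \<exists>m\<in>S. jordan_P m (jordan_powr a (-1)) = b"
    "n \<ge> 1" "\<And>i. i \<in> {1..n} \<Longrightarrow> p i \<in> S"
  shows "\<exists>!z. is_arg_min (mean_sq_dist cone_dist n p) (\<lambda>z. z \<in> S) z"
proof -
  have "1 / (real n * primitive_norm_sq TYPE('a)) > 0"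
    using assms(4) primitive_norm_sq_pos[where 'a='a] by simp
  note scale = is_arg_min_scale[OF this]
  show ?thesis
    unfolding mean_sq_dist_cone[abs_def] scale by (rule barycenter_exists_unique[OF assms])
qed

theorem theorem8p2:
  fixes \<sigma> :: "'a::simple_euclidean_jordan_algebra \<Rightarrow> 'a"
    and n :: nat
    and x :: "nat \<Rightarrow> 'a"
  assumes "involutive_jordan_automorphism \<sigma>"
    and "n \<ge> 1"
    and "\<And>i. i \<in> {1..n} \<Longrightarrow> x i \<in> symmetric_cone"
  shows "is_arg_min (mean_sq_dist (sigma_dist \<sigma>) n x) (\<lambda>z. z \<in> symmetric_cone) (sigma_mean \<sigma> n x) \<and>
         (\<forall>z. is_arg_min (mean_sq_dist (sigma_dist \<sigma>) n x) (\<lambda>z. z \<in> symmetric_cone) z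
              \<longrightarrow> z = sigma_mean \<sigma> n x)"
proof -
  let ?f = "mean_sq_dist (sigma_dist \<sigma>) n x"
  define p where "p i = plus_part \<sigma> (x i)" for i
  define q where "q i = minus_part \<sigma> (x i)" for i
  define F where "F = mean_sq_dist cone_dist n p"
  define G where "G = mean_sq_dist cone_dist n q"
  note bij = cone_map_bij[OF assms(1)]
  have inv: "the_inv_into (cone_plus \<sigma> \<times> cone_minus \<sigma>) cone_map z \<in> cone_plus \<sigma> \<times> cone_minus \<sigma>"
    if "z \<in> symmetric_cone" for z
    using bij_betwE[OF bij_betw_the_inv_into[OF bij]] that by blast
  have pq: "p i \<in> cone_plus \<sigma>" "q i \<in> cone_minus \<sigma>" if "i \<in> {1..n}" for i
    using inv[OF assms(3)[OF that]] unfolding p_def q_def plus_part_def minus_part_def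
    by (simp_all add: mem_Times_iff)
  have parts: "plus_part \<sigma> (cone_map (a, b)) = a" "minus_part \<sigma> (cone_map (a, b)) = b"
    if "a \<in> cone_plus \<sigma>" "b \<in> cone_minus \<sigma>" for a b
    using the_inv_into_f_f[OF bij_betw_imp_inj_on[OF bij], of "(a, b)"] that
    unfolding plus_part_def minus_part_def by simp_all
  have f: "?f (cone_map (a, b)) = F a + G b" if "a \<in> cone_plus \<sigma>" "b \<in> cone_minus \<sigma>" for a b
    unfolding F_def G_def p_def[abs_def] q_def[abs_def] mean_sq_dist_def sigma_dist_def parts[OF that]
    by (simp add: sum.distrib ring_distribs)
  have exF: "\<exists>!z. is_arg_min F (\<lambda>z. z \<in> cone_plus \<sigma>) z" unfolding F_def
    by (rule cone_mean_unique[OF _ cone_plus_closed[OF assms(1)] cone_plus_midpoint[OF assms(1)] assms(2) pq(1)])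
      (auto simp: cone_plus_def)
  have exG: "\<exists>!z. is_arg_min G (\<lambda>z. z \<in> cone_minus \<sigma>) z" unfolding G_def
    by (rule cone_mean_unique[OF _ cone_minus_closed[OF assms(1)] cone_minus_midpoint[OF assms(1)] assms(2) pq(2)])
      (auto simp: cone_minus_def)
  define a0 where "a0 = mean_plus \<sigma> n p"
  define b0 where "b0 = mean_minus \<sigma> n q"
  have mean: "sigma_mean \<sigma> n x = cone_map (a0, b0)"
    unfolding sigma_mean_def a0_def b0_def p_def[abs_def] q_def[abs_def] ..
  have a0: "is_arg_min F (\<lambda>z. z \<in> cone_plus \<sigma>) a0"
    unfolding a0_def mean_plus_def F_def[symmetric] arg_min_def using exF by (metis someI_ex)
  have b0: "is_arg_min G (\<lambda>z. z \<in> cone_minus \<sigma>) b0"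
    unfolding b0_def mean_minus_def G_def[symmetric] arg_min_def using exG by (metis someI_ex)
  have ab: "a0 \<in> cone_plus \<sigma>" "b0 \<in> cone_minus \<sigma>" using a0 b0 unfolding is_arg_min_def by auto
  have lower: "F a0 \<le> F a" "G b0 \<le> G b" if "a \<in> cone_plus \<sigma>" "b \<in> cone_minus \<sigma>" for a b
    using a0 b0 that unfolding is_arg_min_linorder by auto
  have split: "\<exists>a b. a \<in> cone_plus \<sigma> \<and> b \<in> cone_minus \<sigma> \<and> z = cone_map (a, b)" if "z \<in> symmetric_cone" for z
    using bij_betw_imp_surj_on[OF bij] that by blast
  have mem: "cone_map (a, b) \<in> symmetric_cone" if "a \<in> cone_plus \<sigma>" "b \<in> cone_minus \<sigma>" for a b
    using bij_betwE[OF bij] that by blast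
  have min: "?f (cone_map (a0, b0)) \<le> ?f z" if "z \<in> symmetric_cone" for z
    using split[OF that] lower f ab by (metis add_mono)
  have "is_arg_min ?f (\<lambda>z. z \<in> symmetric_cone) (cone_map (a0, b0))"
    unfolding is_arg_min_linorder using mem[OF ab] min by blast
  moreover have "z = cone_map (a0, b0)" if z: "is_arg_min ?f (\<lambda>z. z \<in> symmetric_cone) z" for z
  proof -
    obtain a b where zab: "a \<in> cone_plus \<sigma>" "b \<in> cone_minus \<sigma>" "z = cone_map (a, b)"
      using split z unfolding is_arg_min_def by blast
    have "?f z \<le> ?f (cone_map (a0, b0))" using z mem[OF ab] unfolding is_arg_min_linorder by blast
    then have "F a + G b \<le> F a0 + G b0" using f[OF ab] f[OF zab(1,2)] zab(3) by simp
    then have eq: "F a = F a0" "G b = G b0" using lower[OF zab(1,2)] by simp_all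
    have "is_arg_min F (\<lambda>z. z \<in> cone_plus \<sigma>) a" "is_arg_min G (\<lambda>z. z \<in> cone_minus \<sigma>) b"
      using a0 b0 zab eq unfolding is_arg_min_linorder by auto
    then have "a = a0" "b = b0" using exF exG a0 b0 by blast+
    then show ?thesis using zab by simp
  qed
  ultimately show ?thesis unfolding mean by blast
qed

end
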